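(* Let $N\ge2$. For all $u\in C_c^\infty(\mathbb{H}^N\setminus\{x_0\})$, $$\begin{aligned}\int_{\mathbb{H}^N}|\Delta_{r,\mathbb{H}^N}u|^2\,dv_{\mathbb{H}^N}={}&\left(\frac{N-1}{2}\right)^2\int_{\mathbb{H}^N}|\nabla_{r,\mathbb{H}^N}u|^2\,dv_{\mathbb{H}^N}+\frac14\int_{\mathbb{H}^N}\frac{|\nabla_{r,\mathbb{H}^N}u|^2}{r^2}\,dv_{\mathbb{H}^N}\\&+\frac{N^2-1}{4}\int_{\mathbb{H}^N}\frac{|\nabla_{r,\mathbb{H}^N}u|^2}{\sinh^2 r}\,dv_{\mathbb{H}^N}\\&+\int_{\mathbb{H}^N}\frac{r}{(\sinh r)^{N-1}}\left|\nabla_{r,\mathbb{H}^N}\left(\frac{(\sinh r)^{\frac{N-1}{2}}u_r}{r^{1/2}}\right)\right|^2dv_{\mathbb{H}^N}.\end{aligned}$$ Moreover, if $N\ge5$, for all $u\in C_c^\infty(\mathbb{H}^N\setminus\{x_0\})$, $$\begin{aligned}\int_{\mathbb{H}^N}|\Delta_{\mathbb{H}^N}u|^2\,dv_{\mathbb{H}^N}\ge{}&\left(\frac{N-1}{2}\right)^2\int_{\mathbb{H}^N}|\nabla_{\mathbb{H}^N}u|^2\,dv_{\mathbb{H}^N}+\frac14\int_{\mathbb{H}^N}\frac{|\nabla_{\mathbb{H}^N}u|^2}{r^2}\,dv_{\mathbb{H}^N}\\&+\frac{N^2-1}{4}\int_{\mathbb{H}^N}\frac{|\nabla_{\mathbb{H}^N}u|^2}{\sinh^2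 r}\,dv_{\mathbb{H}^N}\\&+\int_{\mathbb{H}^N}\frac{r}{(\sinh r)^{N-1}}\left|\nabla_{\mathbb{H}^N}\left(\frac{(\sinh r)^{\frac{N-1}{2}}u_r}{r^{1/2}}\right)\right|^2dv_{\mathbb{H}^N}.\end{aligned}$$ The constant $\left(\frac{N-1}{2}\right)^2$ on the right-hand side of both relations is sharp, i.e. it is the largest constant $C$ such that $\int_{\mathbb{H}^N}|\Delta_{r,\mathbb{H}^N}u|^2dv_{\mathbb{H}^N}\ge C\int_{\mathbb{H}^N}|\nabla_{r,\mathbb{H}^N}u|^2dv_{\mathbb{H}^N}$, respectively (for $N\ge5$) $\int_{\mathbb{H}^N}|\Delta_{\mathbb{H}^N}u|^2dv_{\mathbb{H}^N}\ge C\int_{\mathbb{H}^N}|\nabla_{\mathbb{H}^N}u|^2dv_{\mathbb{H}^N}$, holds for all $u\in C_c^\infty(\mathbb{H}^N\setminus\{x_0\})$. Moreover, for $N\ge5$, the constants $\frac14$ and $\frac{N^2-1}{4}$ are jointly sharp in both relations in the following sense: keeping the constant $\frac14$ fixed, if the last (remainder) integral is dropped, then the resulting inequality ($\ge$) fails for some $u\in C_c^\infty(\mathbb{H}^N\setminus\{x_0\})$ as soon as $\frac{N^2-1}{4}$ is replaced by any larger constant.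
   Context: $\mathbb{H}^N$ is the $N$-dimensional hyperbolic space (constant curvature $-1$) with Riemannian volume $dv_{\mathbb{H}^N}$, Laplace-Beltrami operator $\Delta_{\mathbb{H}^N}$ and Riemannian gradient $\nabla_{\mathbb{H}^N}$; $x_0\in\mathbb{H}^N$ is a fixed pole, $r=d(x,x_0)$ is the geodesic distance, and $(r,\Theta)\in(0,\infty)\times\mathbb{S}^{N-1}$ are polar coordinates about $x_0$, in which $dv_{\mathbb{H}^N}=(\sinh r)^{N-1}\,dr\,d\Theta$ and $|\nabla_{\mathbb{H}^N}u|^2=u_r^2+\frac{1}{\sinh^2 r}|\nabla_{\mathbb{S}^{N-1}}u|^2$. Functions are real-valued (not necessarily radial) and $u_r=\frac{\partial u}{\partial r}$. The radial gradient is $\nabla_{r,\mathbb{H}^N}u=(u_r,0)$, so $|\nabla_{r,\mathbb{H}^N}u|^2=u_r^2$; the radial Laplacian is $\Delta_{r,\mathbb{H}^N}u=u_{rr}+(N-1)\coth r\,u_r$. *)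

theory Defs
  imports "HOL-Analysis.Analysis"
begin

text \<open>
  Hyperbolic space of dimension \<open>N = CARD('n)\<close> is the Poincare ball: the open unit ball of
  \<open>real ^ 'n\<close> with the conformal metric \<open>4 |dx|^2 / (1 - |x|^2)^2\<close>, of constant curvature \<open>-1\<close>.
  The pole \<open>p\<close> is an arbitrary point of the ball. Functions on hyperbolic space are total
  functions on \<open>real ^ 'n\<close>; only their values in the ball matter.
\<close>

definition hyp_space :: "(real ^ 'n) set"
  where "hyp_space = ball 0 1"

definition conf :: "real ^ 'n \<Rightarrow> real"
  where "conf x = 2 / (1 - (norm x)\<^sup>2)"

definition hmetric :: "real ^ 'n \<Rightarrow> real ^ 'n \<Rightarrow> real ^ 'n \<Rightarrow> real"
  where "hmetric x v w = (conf x)\<^sup>2 * (v \<bullet> w)"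

definition hdist :: "real ^ 'n \<Rightarrow> real ^ 'n \<Rightarrow> real"
  where "hdist x y =
    arcosh (1 + 2 * (norm (x - y))\<^sup>2 / ((1 - (norm x)\<^sup>2) * (1 - (norm y)\<^sup>2)))"

text \<open>The Riemannian volume has density \<open>sqrt (det g) = conf x ^ N\<close>.\<close>

definition hvol :: "(real ^ 'n) measure"
  where "hvol = density (restrict_space lborel hyp_space) (\<lambda>x. ennreal (conf x ^ CARD('n)))"

definition partial :: "'n \<Rightarrow> (real ^ 'n \<Rightarrow> real) \<Rightarrow> real ^ 'n \<Rightarrow> real"
  where "partial i f x = frechet_derivative f (at x) (axis i 1)"

definition smooth_on :: "(real ^ 'n) set \<Rightarrow> (real ^ 'n \<Rightarrow> real) \<Rightarrow> bool"
  where "smooth_on S f \<longleftrightarrow>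
    (\<forall>is. \<forall>x\<in>S. foldr partial is f differentiable (at x))"

text \<open>The closure below is taken in \<open>real ^ 'n\<close>; being compact and contained in
  \<open>hyp_space - {p}\<close>, it is the support of \<open>u\<close> there.\<close>

definition test_fun :: "real ^ 'n \<Rightarrow> (real ^ 'n \<Rightarrow> real) set"
  where "test_fun p = {u. smooth_on (hyp_space - {p}) u \<and>
    compact (closure {x. u x \<noteq> 0}) \<and> closure {x. u x \<noteq> 0} \<subseteq> hyp_space - {p}}"

text \<open>Riemannian gradient \<open>g\<^sup>i\<^sup>j \<partial>\<^sub>j u\<close>, its squared length in \<open>g\<close>, and the
  Laplace-Beltrami operator \<open>(1 / sqrt (det g)) \<partial>\<^sub>i (sqrt (det g) (grad u)\<^sup>i)\<close>.\<close>

definition hgrad :: "(real ^ 'n \<Rightarrow> real) \<Rightarrow> real ^ 'n \<Rightarrow> real ^ 'n"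
  where "hgrad u x = (\<chi> i. partial i u x / (conf x)\<^sup>2)"

definition hgrad_sq :: "(real ^ 'n \<Rightarrow> real) \<Rightarrow> real ^ 'n \<Rightarrow> real"
  where "hgrad_sq u x = hmetric x (hgrad u x) (hgrad u x)"

definition hlap :: "(real ^ 'n \<Rightarrow> real) \<Rightarrow> real ^ 'n \<Rightarrow> real"
  where "hlap u x =
    (\<Sum>i\<in>UNIV. partial i (\<lambda>y. conf y ^ CARD('n) * hgrad u y $ i) x) / conf x ^ CARD('n)"

text \<open>
  Geodesic polar coordinates about \<open>p\<close>. The unit-speed geodesics issuing from \<open>0\<close> are
  \<open>t \<mapsto> tanh (t / 2) \<Theta>\<close> with \<open>norm \<Theta> = 1\<close>; Moebius addition \<open>mobius_add p\<close> is the isometry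
  of the ball (hyperbolic translation) that takes \<open>0\<close> to \<open>p\<close>, and \<open>mobius_add (- p)\<close> is its
  inverse. Hence \<open>t \<mapsto> hpolar p t \<Theta>\<close> is the unit-speed geodesic ray from \<open>p\<close> in direction \<open>\<Theta>\<close>.
\<close>

definition mobius_add :: "real ^ 'n \<Rightarrow> real ^ 'n \<Rightarrow> real ^ 'n"
  where "mobius_add p x =
    ((1 + 2 * (p \<bullet> x) + (norm x)\<^sup>2) *\<^sub>R p + (1 - (norm p)\<^sup>2) *\<^sub>R x) /\<^sub>R
      (1 + 2 * (p \<bullet> x) + (norm p)\<^sup>2 * (norm x)\<^sup>2)"

definition hpolar :: "real ^ 'n \<Rightarrow> real \<Rightarrow> real ^ 'n \<Rightarrow> real ^ 'n"
  where "hpolar p t \<Theta> = mobius_add p (tanh (t / 2) *\<^sub>R \<Theta>)"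

text \<open>The angular coordinate \<open>\<Theta>\<close> of \<open>x\<close>; the radial one is \<open>hdist p x\<close>.\<close>

definition hdir :: "real ^ 'n \<Rightarrow> real ^ 'n \<Rightarrow> real ^ 'n"
  where "hdir p x = sgn (mobius_add (- p) x)"

text \<open>The radial derivative \<open>\<partial>u/\<partial>r\<close> in these coordinates, the squared length \<open>u\<^sub>r\<^sup>2\<close> of the
  radial gradient \<open>(u\<^sub>r, 0)\<close>, and the radial Laplacian.\<close>

definition hrad :: "real ^ 'n \<Rightarrow> (real ^ 'n \<Rightarrow> real) \<Rightarrow> real ^ 'n \<Rightarrow> real"
  where "hrad p u x = deriv (\<lambda>t. u (hpolar p t (hdir p x))) (hdist p x)"

definition hrgrad_sq :: "real ^ 'n \<Rightarrow> (real ^ 'n \<Rightarrow> real) \<Rightarrow> real ^ 'n \<Rightarrow> real"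
  where "hrgrad_sq p u x = (hrad p u x)\<^sup>2"

definition hrlap :: "real ^ 'n \<Rightarrow> (real ^ 'n \<Rightarrow> real) \<Rightarrow> real ^ 'n \<Rightarrow> real"
  where "hrlap p u x = hrad p (hrad p u) x +
    (real CARD('n) - 1) * (cosh (hdist p x) / sinh (hdist p x)) * hrad p u x"

text \<open>The following facts confirm that \<open>(hdist p x, hdir p x)\<close> are the coordinates of \<open>x\<close>.\<close>

lemma mobius_denom_pos:
  fixes p x :: "real ^ 'n"
  assumes "p \<in> hyp_space" "x \<in> hyp_space"
  shows "1 + 2 * (p \<bullet> x) + (norm p)\<^sup>2 * (norm x)\<^sup>2 > 0"
proof -
  have "norm p * norm x < 1"
    using assms mult_strict_mono'[of "norm p" 1 "norm x" 1] by (simp add: hyp_space_def)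
  then have "(1 - norm p * norm x)\<^sup>2 > 0" by simp
  moreover have "p \<bullet> x \<ge> - (norm p * norm x)"
    using Cauchy_Schwarz_ineq2[of p x] by linarith
  ultimately show ?thesis by (simp add: power2_eq_square algebra_simps)
qed

lemma norm_mobius_add:
  fixes p x :: "real ^ 'n"
  assumes "p \<in> hyp_space" "x \<in> hyp_space"
  shows "1 - (norm (mobius_add p x))\<^sup>2 =
    (1 - (norm p)\<^sup>2) * (1 - (norm x)\<^sup>2) / (1 + 2 * (p \<bullet> x) + (norm p)\<^sup>2 * (norm x)\<^sup>2)"
proof -
  define D where "D = 1 + 2 * (p \<bullet> x) + (norm p)\<^sup>2 * (norm x)\<^sup>2"
  have D: "D > 0" using mobius_denom_pos[OF assms] by (simp add: D_def)
  have "(norm (mobius_add p x))\<^sup>2 * D\<^sup>2 =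
      (norm ((1 + 2 * (p \<bullet> x) + (norm x)\<^sup>2) *\<^sub>R p + (1 - (norm p)\<^sup>2) *\<^sub>R x))\<^sup>2"
    using D by (simp add: mobius_add_def flip: D_def) (simp add: power_mult_distrib power_divide field_simps)
  also have "\<dots> = ((norm x)\<^sup>2 + 2 * (p \<bullet> x) + (norm p)\<^sup>2) * D"
    unfolding power2_norm_eq_inner D_def
    by (simp add: inner_add_left inner_add_right inner_commute[of x p] algebra_simps)
  finally have "(norm (mobius_add p x))\<^sup>2 = ((norm x)\<^sup>2 + 2 * (p \<bullet> x) + (norm p)\<^sup>2) / D"
    using D by (simp add: power2_eq_square eq_divide_eq flip: mult.assoc)
  then show ?thesis
    unfolding D_def[symmetric] using D by (simp add: field_simps) (simp add: D_def algebra_simps)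
qed

lemma mobius_add_in:
  assumes "p \<in> hyp_space" "x \<in> hyp_space"
  shows "mobius_add p x \<in> hyp_space"
proof -
  have "1 - (norm p)\<^sup>2 > 0" "1 - (norm x)\<^sup>2 > 0"
    using assms by (simp_all add: hyp_space_def power_less_one_iff abs_square_less_1)
  then have "1 - (norm (mobius_add p x))\<^sup>2 > 0"
    using norm_mobius_add[OF assms] mobius_denom_pos[OF assms] by simp
  then show ?thesis by (simp add: hyp_space_def abs_square_less_1)
qed

lemma mobius_add_cancel:
  fixes p x :: "real ^ 'n"
  assumes p: "p \<in> hyp_space" and x: "x \<in> hyp_space"
  shows "mobius_add p (mobius_add (- p) x) = x"
proof -
  have p': "- p \<in> hyp_space" using p by (simp add: hyp_space_def)
  define y where "y = mobius_add (- p) x"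
  define P where "P = (norm p)\<^sup>2"
  define X where "X = (norm x)\<^sup>2"
  define s where "s = p \<bullet> x"
  define D where "D = 1 - 2 * s + P * X"
  have D: "D > 0" using mobius_denom_pos[OF p' x] by (simp add: D_def s_def P_def X_def)
  have P: "1 - P > 0" using p by (simp add: hyp_space_def P_def abs_square_less_1)
  have y: "y = (- (1 - 2 * s + X) / D) *\<^sub>R p + ((1 - P) / D) *\<^sub>R x"
    by (simp add: y_def mobius_add_def D_def s_def P_def X_def scaleR_add_right
        scaleR_diff_right scaleR_left_diff_distrib scaleR_add_left divide_inverse_commute algebra_simps)
  have ny: "(norm y)\<^sup>2 = 1 - (1 - P) * (1 - X) / D"
    using norm_mobius_add[OF p' x] by (simp add: D_def y_def s_def P_def X_def)
  have py: "p \<bullet> y = (- (1 - 2 * s + X) * P + (1 - P) * s) / D"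
    unfolding y using D
    by (simp add: inner_add_right s_def[symmetric] P_def power2_norm_eq_inner field_simps)
  have E: "1 + 2 * (p \<bullet> y) + P * (norm y)\<^sup>2 = (1 - P)\<^sup>2 / D"
    unfolding ny py using D by (simp add: field_simps) (simp add: D_def power2_eq_square algebra_simps)
  have A: "1 + 2 * (p \<bullet> y) + (norm y)\<^sup>2 = (1 - P) * (1 - 2 * s + X) / D"
    unfolding ny py using D by (simp add: field_simps) (simp add: D_def power2_eq_square algebra_simps)
  have "mobius_add p y =
      (((1 - P) * (1 - 2 * s + X) / D) *\<^sub>R p + (1 - P) *\<^sub>R y) /\<^sub>R ((1 - P)\<^sup>2 / D)"
    unfolding mobius_add_def P_def[symmetric] E A ..
  also have "((1 - P) * (1 - 2 * s + X) / D) *\<^sub>R p + (1 - P) *\<^sub>R y = ((1 - P)\<^sup>2 / D) *\<^sub>R x"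
  proof -
    have "k *\<^sub>R p + m *\<^sub>R ((- c / D) *\<^sub>R p + (m / D) *\<^sub>R x) = (m\<^sup>2 / D) *\<^sub>R x"
      if "k = m * c / D" for k m c
      using that by (simp add: scaleR_diff_right power2_eq_square)
    then show ?thesis unfolding y by blast
  qed
  finally show ?thesis using D P by (simp add: y_def)
qed

lemma hdist_0_ray:
  fixes \<Theta> :: "real ^ 'n"
  assumes t: "0 \<le> t" and \<Theta>: "norm \<Theta> = 1"
  shows "hdist 0 (tanh (t / 2) *\<^sub>R \<Theta>) = t"
proof -
  have "1 - (tanh (t / 2))\<^sup>2 = 1 / (cosh (t / 2))\<^sup>2"
    using cosh_real_nonzero[of "t / 2"]
    by (simp add: tanh_def power_divide field_simps) (simp add: cosh_square_eq)
  then have "1 + 2 * (tanh (t / 2))\<^sup>2 / (1 - (tanh (t / 2))\<^sup>2) = 1 + 2 * (sinh (t / 2))\<^sup>2"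
    by (simp add: tanh_def power_divide)
  also have "\<dots> = cosh t"
    using cosh_double[of "t / 2"] by (simp add: cosh_square_eq)
  finally show ?thesis
    using t by (simp add: hdist_def \<Theta> arcosh_cosh_real)
qed

lemma hdist_translate:
  fixes p x :: "real ^ 'n"
  assumes p: "p \<in> hyp_space" and x: "x \<in> hyp_space"
  shows "hdist p x = hdist 0 (mobius_add (- p) x)"
proof -
  have p': "- p \<in> hyp_space" using p by (simp add: hyp_space_def)
  define M where "M = (1 - (norm p)\<^sup>2) * (1 - (norm x)\<^sup>2)"
  define D where "D = 1 - 2 * (p \<bullet> x) + (norm p)\<^sup>2 * (norm x)\<^sup>2"
  have D: "D > 0" using mobius_denom_pos[OF p' x] by (simp add: D_def)
  have M: "M > 0" using p x by (simp add: M_def hyp_space_def abs_square_less_1)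
  have y: "1 - (norm (mobius_add (- p) x))\<^sup>2 = M / D"
    using norm_mobius_add[OF p' x] by (simp add: D_def M_def)
  have px: "(norm (p - x))\<^sup>2 = D - M"
    by (simp add: D_def M_def power2_norm_eq_inner inner_diff_left inner_diff_right
        inner_commute[of x p] algebra_simps)
  have "(norm (mobius_add (- p) x))\<^sup>2 = (D - M) / D"
    using y D by (simp add: field_simps)
  then have "2 * (norm (mobius_add (- p) x))\<^sup>2 / (1 - (norm (mobius_add (- p) x))\<^sup>2) =
      2 * (norm (p - x))\<^sup>2 / M"
    unfolding y px using D by simp
  then show ?thesis by (simp add: hdist_def M_def)
qed

lemma hpolar_hdist_hdir:
  fixes p x :: "real ^ 'n"
  assumes p: "p \<in> hyp_space" and x: "x \<in> hyp_space" and "x \<noteq> p"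
  shows "hpolar p (hdist p x) (hdir p x) = x"
proof -
  define y where "y = mobius_add (- p) x"
  have y: "norm y < 1"
    using mobius_add_in[of "- p" x] p x by (simp add: y_def hyp_space_def)
  have "y \<noteq> 0"
    using mobius_add_cancel[OF p x] \<open>x \<noteq> p\<close> by (auto simp: y_def mobius_add_def)
  have "(1 - norm y) / (1 + norm y) = exp (- 2 * artanh (norm y))"
    using y by (simp add: artanh_def exp_minus add_pos_nonneg)
  then have "tanh (artanh (norm y)) = (1 - (1 - norm y) / (1 + norm y)) / (1 + (1 - norm y) / (1 + norm y))"
    by (simp add: tanh_real_altdef)
  also have "\<dots> = norm y"
    using norm_ge_zero[of y] by (simp add: divide_simps add_nonneg_eq_0_iff)
  finally have eq: "tanh (2 * artanh (norm y) / 2) *\<^sub>R sgn y = y"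
    using \<open>y \<noteq> 0\<close> by (simp add: sgn_div_norm)
  have "artanh (norm y) \<ge> 0"
    using y by (simp add: artanh_def)
  then have "hdist 0 y = 2 * artanh (norm y)"
    using hdist_0_ray[of "2 * artanh (norm y)" "sgn y"] \<open>y \<noteq> 0\<close> eq by (simp add: norm_sgn)
  then have "tanh (hdist p x / 2) *\<^sub>R hdir p x = y"
    using eq hdist_translate[OF p x] by (simp add: hdir_def y_def)
  then show ?thesis
    using mobius_add_cancel[OF p x] by (simp add: hpolar_def y_def)
qed

lemma hdist_hpolar:
  fixes p \<Theta> :: "real ^ 'n"
  assumes p: "p \<in> hyp_space" and t: "0 \<le> t" and \<Theta>: "norm \<Theta> = 1"
  shows "hdist p (hpolar p t \<Theta>) = t"
proof -
  have p': "- p \<in> hyp_space" using p by (simp add: hyp_space_def)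
  have y: "tanh (t / 2) *\<^sub>R \<Theta> \<in> hyp_space"
    using t tanh_real_lt_1[of "t / 2"] by (simp add: hyp_space_def \<Theta>)
  show ?thesis
    using hdist_translate[OF p mobius_add_in[OF p y]] mobius_add_cancel[OF p' y] hdist_0_ray[OF t \<Theta>]
    by (simp add: hpolar_def)
qed

end

theory Submission
  imports Defs
begin

text \<open>
  The translation \<open>mobius_add p\<close> is an isometry of the ball, so the pole may be moved to the origin.
  In the punctured ball with the dilation-invariant measure \<open>|x|\<^sup>-\<^sup>N dx\<close>, of which the hyperbolic
  volume is the multiple by \<open>sinh\<^sup>N r\<close>, the Euler field \<open>x \<cdot> grad\<close> has integral zero on test functions,
  and so have, up to a zero order term, the tangential fields \<open>ang i = |x| \<partial>\<^sub>i - (x\<^sub>i / |x|) x \<cdot> grad\<close>, which are the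
  components of the gradient of the unit sphere. Moreover \<open>\<partial>\<^sub>r = (x \<cdot> grad) / sinh r\<close>.

  The radial equality is a pointwise identity up to the \<open>r\<close>-derivative of a test function. In the full
  inequality, \<open>|\<Delta>u|\<^sup>2\<close> consists of \<open>|\<Delta>\<^sub>r u|\<^sup>2\<close>, the square of the spherical Laplacian, and a cross term. The
  same completion of squares, applied to each \<open>ang i u\<close>, bounds the cross term from below by the missing
  tangential part of the right-hand side minus \<open>4 \<integral> |grad\<^sub>S u|\<^sup>2 sinh\<^sup>-\<^sup>4 r\<close>; the spectral gap
  \<open>\<integral> |\<Delta>\<^sub>S u|\<^sup>2 \<ge> (N - 1) \<integral> |grad\<^sub>S u|\<^sup>2\<close> of the sphere pays for it since \<open>N - 1 \<ge> 4\<close>.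

  For the sharpness, let \<open>u\<close> be radial and \<open>g = (sinh r) powr ((N - 1) / 2) u\<^sub>r / sqrt r\<close>. In the variable \<open>s = ln r\<close> the
  remainder is a multiple of \<open>\<integral> g'\<^sup>2 ds\<close>, which is small against \<open>\<integral> g\<^sup>2 ds\<close> for long bumps \<open>g\<close>. Placing them near
  \<open>s = \<infinity>\<close> or near \<open>s = -\<infinity>\<close> makes the first or the third term decisive, and a combination of two disjoint
  bumps makes the primitive \<open>u\<close> compactly supported.
\<close>

section \<open>Smooth functions\<close>

text \<open>Neither integration over the sphere nor a chart of it is set up. All integrations by
  parts come from one fact, that a partial derivative of a compactly supported smooth function has
  integral zero, applied to fields on the punctured ball. The radial argument can be reused for
  \<open>ang i u\<close> because \<open>ang i\<close> commutes with \<open>rad\<close>. The loss 4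
  is the outcome of a count. With respect to dr dTheta, the expression -2 (sinh r)^(N-3) g (g'' +
  (N-1) coth r g') integrates to (sinh r)^(N-3) times 2 g'^2 + 2 ((N-3) + (N-4) / sinh^2 r) g^2. One
  g'^2 is the tangential part of the remainder; completing the square in the other yields the
  coefficients ((N-3)/2)^2 of 1, 1/4 of 1/r^2 and (N-3)(N-5)/4 of 1/sinh^2 r. The totals are
  ((N-1)/2)^2 + (N-4), then 1/4, then (N^2-1)/4 - 4. For sharpness, the disjointness of the two
  bumps matters twice: their coefficient is free to cancel the moment that obstructs a compactly
  supported primitive, and it does not change the quotient of the integrals of g'^2 and g^2.\<close>

lemma partial_cong:
  assumes "open S" "x \<in> S" "\<And>y. y \<in> S \<Longrightarrow> f y = g y"
  shows "partial i f x = partial i g x"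
proof -
  have "(f has_derivative F) (at x) \<longleftrightarrow> (g has_derivative F) (at x)" for F
    using assms has_derivative_transform_within_open[of f F x UNIV S g]
      has_derivative_transform_within_open[of g F x UNIV S f] by auto
  then show ?thesis by (simp add: partial_def frechet_derivative_def)
qed

lemma differentiable_cong_open:
  assumes "open S" "x \<in> S" "\<And>y. y \<in> S \<Longrightarrow> f y = g y"
  shows "f differentiable at x \<longleftrightarrow> g differentiable at x"
proof -
  have "(f has_derivative F) (at x) \<longleftrightarrow> (g has_derivative F) (at x)" for F
    using assms has_derivative_transform_within_open[of f F x UNIV S g]
      has_derivative_transform_within_open[of g F x UNIV S f] by auto
  then show ?thesis by (simp add: differentiable_def)
qed

lemma foldr_partial_cong:
  assumes "open S" "x \<in> S" "\<And>y. y \<in> S \<Longrightarrow> f y = g y"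
  shows "foldr partial is f x = foldr partial is g x"
  using assms(2)
proof (induction "is" arbitrary: x)
  case (Cons i "is")
  then show ?case using partial_cong[OF assms(1), of x "foldr partial is f" "foldr partial is g" i] by simp
qed (use assms in simp)

lemma smooth_on_cong:
  assumes "open S" "\<And>y. y \<in> S \<Longrightarrow> f y = g y"
  shows "smooth_on S f \<longleftrightarrow> smooth_on S g"
proof -
  have "foldr partial is f differentiable at x \<longleftrightarrow> foldr partial is g differentiable at x" if "x \<in> S" for "is" x
    using differentiable_cong_open[OF assms(1) that, of "foldr partial is f" "foldr partial is g"]
      foldr_partial_cong[OF assms(1) _ assms(2), of _ "\<lambda>y. y" "is"] by blast
  then show ?thesis by (simp add: smooth_on_def)
qed

lemma smooth_on_differentiable: "smooth_on S f \<Longrightarrow> x \<in> S \<Longrightarrow> f differentiable at x"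
  unfolding smooth_on_def by (drule spec[of _ "[]"]) simp

lemma smooth_on_partial:
  assumes "smooth_on S f" shows "smooth_on S (partial i f)"
  unfolding smooth_on_def
proof (intro allI ballI)
  fix "is" x assume "x \<in> S"
  then have "foldr partial (is @ [i]) f differentiable at x"
    using assms unfolding smooth_on_def by blast
  then show "foldr partial is (partial i f) differentiable at x" by simp
qed

lemma smooth_on_subset: "smooth_on S f \<Longrightarrow> T \<subseteq> S \<Longrightarrow> smooth_on T f"
  unfolding smooth_on_def by blast

lemma has_derivative_partial:
  fixes f :: "real ^ 'n \<Rightarrow> real"
  assumes "f differentiable at x"
  shows "(f has_derivative (\<lambda>v. \<Sum>i\<in>UNIV. v $ i * partial i f x)) (at x)"
proof -
  obtain F where F: "(f has_derivative F) (at x)" using assms by (auto simp: differentiable_def)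
  have "linear F" using F has_derivative_linear by blast
  have "F v = (\<Sum>i\<in>UNIV. v $ i * partial i f x)" for v
  proof -
    have "F v = F (\<Sum>i\<in>UNIV. v $ i *\<^sub>R axis i 1)"
      by (rule arg_cong[of _ _ F]) (simp add: vec_eq_iff axis_def if_distrib cong: if_cong)
    also have "\<dots> = (\<Sum>i\<in>UNIV. v $ i * F (axis i 1))"
      using \<open>linear F\<close> by (simp add: linear_sum linear_cmul)
    finally show ?thesis
      using frechet_derivative_at[OF F] by (simp add: partial_def)
  qed
  then have "F = (\<lambda>v. \<Sum>i\<in>UNIV. v $ i * partial i f x)" by auto
  with F show ?thesis by simp
qed

lemma partial_eqI:
  assumes "(f has_derivative F) (at x)"
  shows "partial i f x = F (axis i 1)"
  using frechet_derivative_at[OF assms] by (simp add: partial_def)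

lemma smooth_on_has_derivative:
  "smooth_on S f \<Longrightarrow> x \<in> S \<Longrightarrow> (f has_derivative (\<lambda>v. \<Sum>i\<in>UNIV. v $ i * partial i f x)) (at x)"
  by (intro has_derivative_partial smooth_on_differentiable)

text \<open>\<open>foldr\<close> applies the last index of the list to \<open>f\<close> first, so
  the induction peels the list from its end: the innermost derivative is replaced by some
  \<open>g\<close> in \<open>P\<close>, and agreement on the open set \<open>S\<close> passes
  through the remaining derivatives.\<close>

lemma smooth_on_coinduct:
  assumes S: "open S" and P: "P f"
    and d: "\<And>f x. P f \<Longrightarrow> x \<in> S \<Longrightarrow> f differentiable at x"
    and p: "\<And>f i. P f \<Longrightarrow> \<exists>g. P g \<and> (\<forall>x\<in>S. partial i f x = g x)"
  shows "smooth_on S f"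
  unfolding smooth_on_def
proof (intro allI)
  fix "is"
  show "\<forall>x\<in>S. foldr partial is f differentiable at x"
    using P
  proof (induction "is" arbitrary: f rule: rev_induct)
    case (snoc i "is")
    obtain g where g: "P g" "\<forall>x\<in>S. partial i f x = g x" using p snoc.prems by blast
    have "foldr partial is (partial i f) differentiable at x" if x: "x \<in> S" for x
      using differentiable_cong_open[OF S x, of "foldr partial is (partial i f)" "foldr partial is g"]
        foldr_partial_cong[OF S, of _ "partial i f" g "is"] snoc.IH[OF g(1)] g(2) x by auto
    then show ?case by simp
  qed (use d in auto)
qed

text \<open>The closure of the smooth functions under the operations below is stable under partial
  derivatives, so by coinduction it consists of smooth functions.\<close>

inductive smooth_closure :: "(real ^ 'n) set \<Rightarrow> (real ^ 'n \<Rightarrow> real) \<Rightarrow> bool" for S where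
  base: "smooth_on S f \<Longrightarrow> smooth_closure S f"
| add: "smooth_closure S f \<Longrightarrow> smooth_closure S g \<Longrightarrow> smooth_closure S (\<lambda>x. f x + g x)"
| mult: "smooth_closure S f \<Longrightarrow> smooth_closure S g \<Longrightarrow> smooth_closure S (\<lambda>x. f x * g x)"
| comp: "(\<And>n t. t \<in> J \<Longrightarrow> (h n has_real_derivative h (Suc n) t) (at t)) \<Longrightarrow>
    smooth_closure S f \<Longrightarrow> (\<And>x. x \<in> S \<Longrightarrow> f x \<in> J) \<Longrightarrow> smooth_closure S (\<lambda>x. h (m::nat) (f x))"
| vcomp: "smooth_on (S' :: (real ^ 'n) set) u \<Longrightarrow> (\<And>x. x \<in> S \<Longrightarrow> \<phi> x \<in> S') \<Longrightarrow>
    (\<And>k. smooth_on S (\<lambda>x. \<phi> x $ k)) \<Longrightarrow> smooth_closure S (\<lambda>x. u (\<phi> x))"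

lemma has_derivative_vec_partial:
  fixes \<phi> :: "real ^ 'n \<Rightarrow> real ^ 'n"
  assumes "\<And>k. smooth_on S (\<lambda>x. \<phi> x $ k)" "x \<in> S"
  shows "(\<phi> has_derivative (\<lambda>v. \<chi> k. \<Sum>i\<in>UNIV. v $ i * partial i (\<lambda>x. \<phi> x $ k) x)) (at x)"
proof -
  have "((\<lambda>x. \<phi> x $ k) has_derivative (\<lambda>v. \<Sum>i\<in>UNIV. v $ i * partial i (\<lambda>x. \<phi> x $ k) x)) (at x)" for k
    using smooth_on_has_derivative[OF assms(1) assms(2)] .
  then show ?thesis
    by (subst has_derivative_componentwise_within) (auto simp: Basis_vec_def inner_axis)
qed

lemma sum_axis: "(\<Sum>i\<in>UNIV. axis j 1 $ i * f i) = (f j :: real)"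
  by (simp add: axis_def if_distrib[of "\<lambda>c. c * _"] cong: if_cong)

lemma partial_vcomp:
  fixes u :: "real ^ 'n \<Rightarrow> real" and \<phi> :: "real ^ 'n \<Rightarrow> real ^ 'n"
  assumes "smooth_on S' u" "\<phi> x \<in> S'" "\<And>k. smooth_on S (\<lambda>x. \<phi> x $ k)" "x \<in> S"
  shows "(\<lambda>x. u (\<phi> x)) differentiable at x"
    and "partial i (\<lambda>x. u (\<phi> x)) x = (\<Sum>k\<in>UNIV. partial i (\<lambda>x. \<phi> x $ k) x * partial k u (\<phi> x))"
proof -
  note d = has_derivative_compose[OF has_derivative_vec_partial[OF assms(3,4)]
     smooth_on_has_derivative[OF assms(1,2)]]
  show "(\<lambda>x. u (\<phi> x)) differentiable at x" using d by (auto simp: differentiable_def)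
  show "partial i (\<lambda>x. u (\<phi> x)) x = (\<Sum>k\<in>UNIV. partial i (\<lambda>x. \<phi> x $ k) x * partial k u (\<phi> x))"
    using partial_eqI[OF d, of i] by (simp add: sum_axis)
qed

lemma smooth_on_const: "smooth_on (S :: (real ^ 'n) set) (\<lambda>x. c)"
proof -
  have "foldr partial is (\<lambda>x. c) = (if is = [] then (\<lambda>x. c) else (\<lambda>x. 0))" for "is" :: "'n list" and c
  proof (induction "is")
    case (Cons i "is")
    have "partial i (\<lambda>x. c) = (\<lambda>x. 0)" for c
      using partial_eqI[OF has_derivative_const] by blast
    then show ?case using Cons by auto
  qed auto
  then show ?thesis unfolding smooth_on_def by simp
qed

lemma smooth_closure_sum:
  assumes "finite I" "\<And>i. i \<in> I \<Longrightarrow> smooth_closure S (f i)"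
  shows "smooth_closure S (\<lambda>x. \<Sum>i\<in>I. f i x)"
  using assms
proof (induction I)
  case (insert j I)
  then show ?case using smooth_closure.add[of S "f j" "\<lambda>x. \<Sum>i\<in>I. f i x"] by simp
qed (simp add: smooth_closure.base smooth_on_const)

lemma smooth_closure_differentiable:
  assumes "smooth_closure S f" "x \<in> S" shows "f differentiable at x"
  using assms
proof (induction)
  case (comp J h f m)
  have "(h m has_derivative (*) (h (Suc m) (f x))) (at (f x))"
    using comp(1)[of "f x" m] comp.hyps comp.prems by (simp add: has_field_derivative_def)
  then have "h m differentiable at (f x)" by (auto simp: differentiable_def)
  with comp show ?case
    using differentiable_chain_at[of f x "h m"] by (simp add: o_def)
next
  case (vcomp S' u \<phi>)
  then show ?case using partial_vcomp(1)[of S' u \<phi> x S] by blast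
qed (auto intro: smooth_on_differentiable differentiable_add differentiable_mult)

lemma partial_add:
  assumes "f differentiable at x" "g differentiable at x"
  shows "partial i (\<lambda>x. f x + g x) x = partial i f x + partial i g x"
  using partial_eqI[OF has_derivative_add[OF has_derivative_partial[OF assms(1)] has_derivative_partial[OF assms(2)]]]
  by (simp add: sum_axis)

lemma partial_mult:
  assumes "f differentiable at x" "g differentiable at x"
  shows "partial i (\<lambda>x. f x * g x) x = partial i f x * g x + f x * partial i g x"
  using partial_eqI[OF has_derivative_mult[OF has_derivative_partial[OF assms(1)] has_derivative_partial[OF assms(2)]]]
  by (simp add: sum_axis)

lemma partial_comp:
  assumes "f differentiable at x" "(h has_real_derivative h') (at (f x))"
  shows "partial i (\<lambda>x. h (f x)) x = h' * partial i f x"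
proof -
  have "(h has_derivative (*) h') (at (f x))" using assms(2) by (simp add: has_field_derivative_def)
  from partial_eqI[OF has_derivative_compose[OF has_derivative_partial[OF assms(1)] this]]
  show ?thesis by (simp add: sum_axis)
qed

text \<open>The differentiation rule of every constructor stays within the constructors. For
  \<open>comp\<close> the chain rule raises the index \<open>m\<close>, which is why that
  constructor carries a whole sequence of derivatives rather than one outer function.\<close>

lemma smooth_closure_partial:
  assumes "smooth_closure S f"
  shows "\<exists>g. smooth_closure S g \<and> (\<forall>x\<in>S. partial i f x = g x)"
  using assms
proof (induction)
  case (base f)
  then show ?case
    using smooth_closure.base[OF smooth_on_partial] by blast
next
  case (add f g)
  then obtain f' g' where "smooth_closure S f'" "\<forall>x\<in>S. partial i f x = f' x"
    "smooth_closure S g'" "\<forall>x\<in>S. partial i g x = g' x" by blast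
  with add show ?case
    by (intro exI[of _ "\<lambda>x. f' x + g' x"])
      (auto intro!: smooth_closure.add simp: partial_add smooth_closure_differentiable)
next
  case (mult f g)
  then obtain f' g' where "smooth_closure S f'" "\<forall>x\<in>S. partial i f x = f' x"
    "smooth_closure S g'" "\<forall>x\<in>S. partial i g x = g' x" by blast
  with mult show ?case
    by (intro exI[of _ "\<lambda>x. f' x * g x + f x * g' x"])
      (auto intro!: smooth_closure.add smooth_closure.mult simp: partial_mult smooth_closure_differentiable)
next
  case (comp J h f m)
  then obtain f' where f': "smooth_closure S f'" "\<forall>x\<in>S. partial i f x = f' x" by blast
  have "smooth_closure S (\<lambda>x. h (Suc m) (f x))"
    using comp.hyps by (intro smooth_closure.comp[of J h S f "Suc m"]) auto
  then have "smooth_closure S (\<lambda>x. h (Suc m) (f x) * f' x)"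
    using f' by (intro smooth_closure.mult)
  moreover have "partial i (\<lambda>a. h m (f a)) x = h (Suc m) (f x) * f' x" if "x \<in> S" for x
    using partial_comp[of f x "h m" "h (Suc m) (f x)" i] comp.hyps that f'
      smooth_closure_differentiable[of S f x] by auto
  ultimately show ?case by blast
next
  case (vcomp S' u \<phi>)
  have "smooth_closure S (\<lambda>x. \<Sum>k\<in>UNIV. partial i (\<lambda>x. \<phi> x $ k) x * partial k u (\<phi> x))"
    using vcomp
    by (intro smooth_closure_sum smooth_closure.mult smooth_closure.base[OF smooth_on_partial]
        smooth_closure.vcomp[of S' "partial _ u" S \<phi>] smooth_on_partial) auto
  moreover have "\<forall>x\<in>S. partial i (\<lambda>x. u (\<phi> x)) x = (\<Sum>k\<in>UNIV. partial i (\<lambda>x. \<phi> x $ k) x * partial k u (\<phi> x))"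
    using vcomp partial_vcomp(2)[of S' u \<phi> _ S] by blast
  ultimately show ?case by blast
qed

lemma smooth_closure_imp_smooth_on:
  assumes "open S" "smooth_closure S f" shows "smooth_on S f"
  using smooth_on_coinduct[of S "smooth_closure S" f] assms smooth_closure_differentiable smooth_closure_partial by blast

lemma smooth_on_add: "open S \<Longrightarrow> smooth_on S f \<Longrightarrow> smooth_on S g \<Longrightarrow> smooth_on S (\<lambda>x. f x + g x)"
  by (simp add: smooth_closure_imp_smooth_on smooth_closure.add smooth_closure.base)

lemma smooth_on_mult: "open S \<Longrightarrow> smooth_on S f \<Longrightarrow> smooth_on S g \<Longrightarrow> smooth_on S (\<lambda>x. f x * g x)"
  by (simp add: smooth_closure_imp_smooth_on smooth_closure.mult smooth_closure.base)

lemma smooth_on_comp: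
  assumes "open S" "smooth_on S f" "\<And>n t. t \<in> J \<Longrightarrow> (h n has_real_derivative h (Suc n) t) (at t)"
    "\<And>x. x \<in> S \<Longrightarrow> f x \<in> J"
  shows "smooth_on S (\<lambda>x. h (m::nat) (f x))"
  using assms by (intro smooth_closure_imp_smooth_on smooth_closure.comp[of J h S f m]) (auto simp: smooth_closure.base)

lemma smooth_on_vcomp:
  fixes S S' :: "(real ^ 'n) set"
  assumes "open S" "smooth_on S' u" "\<And>x. x \<in> S \<Longrightarrow> \<phi> x \<in> S'" "\<And>k. smooth_on S (\<lambda>x. \<phi> x $ k)"
  shows "smooth_on S (\<lambda>x. u (\<phi> x))"
proof (rule smooth_closure_imp_smooth_on[OF assms(1)])
  show "smooth_closure S (\<lambda>x. u (\<phi> x))"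
  proof (rule smooth_closure.vcomp[of S' u S \<phi>])
    show "smooth_on S' u" by (rule assms(2))
    show "smooth_on S (\<lambda>x. \<phi> x $ k)" for k by (rule assms(4))
  qed (rule assms(3))
qed

lemma smooth_on_sum:
  assumes "open S" "finite I" "\<And>i. i \<in> I \<Longrightarrow> smooth_on S (f i)"
  shows "smooth_on S (\<lambda>x. \<Sum>i\<in>I. f i x)"
  by (rule smooth_closure_imp_smooth_on[OF assms(1) smooth_closure_sum[OF assms(2) smooth_closure.base[OF assms(3)]]])

lemma smooth_on_coord:
  fixes S :: "(real ^ 'n) set"
  shows "smooth_on S (\<lambda>x. x $ i)"
proof -
  have 1: "partial j (\<lambda>x. x $ i) = (\<lambda>x. if i = j then 1 else 0)" for j
    using partial_eqI[OF bounded_linear_imp_has_derivative[OF bounded_linear_vec_nth[of i]]]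
    by (auto simp: axis_def)
  have "foldr partial is (\<lambda>x. x $ i) differentiable at x" for "is" x
  proof (cases "is" rule: rev_exhaust)
    case (snoc js j)
    then show ?thesis using smooth_on_const[of "UNIV :: (real ^ 'n) set" 1] smooth_on_const[of "UNIV :: (real ^ 'n) set" 0] 1
      by (auto simp: smooth_on_def)
  qed (simp add: bounded_linear_imp_differentiable bounded_linear_vec_nth)
  then show ?thesis by (simp add: smooth_on_def)
qed

lemma smooth_on_minus: "open S \<Longrightarrow> smooth_on S f \<Longrightarrow> smooth_on S (\<lambda>x. - f x)"
  using smooth_on_mult[OF _ smooth_on_const[of S "-1"]] by fastforce

lemma smooth_on_diff: "open S \<Longrightarrow> smooth_on S f \<Longrightarrow> smooth_on S g \<Longrightarrow> smooth_on S (\<lambda>x. f x - g x)"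
  using smooth_on_add[OF _ _ smooth_on_minus] by fastforce

lemma smooth_on_power: "open S \<Longrightarrow> smooth_on S f \<Longrightarrow> smooth_on S (\<lambda>x. f x ^ n)"
  by (induction n) (auto intro: smooth_on_const smooth_on_mult)

text \<open>The successive derivatives of 1/t, as a sequence of the kind that
  \<open>smooth_on_comp\<close> asks for.\<close>

lemma DERIV_inverse_powers:
  assumes "t \<noteq> (0::real)"
  shows "((\<lambda>t. (-1) ^ n * fact n * inverse t ^ (Suc n)) has_real_derivative
    (-1) ^ Suc n * fact (Suc n) * inverse t ^ (Suc (Suc n))) (at t)"
  by (rule DERIV_cong[OF DERIV_cmult[OF DERIV_power[OF DERIV_inverse[OF assms]]]])
    (simp add: algebra_simps)

lemma smooth_on_inverse:
  assumes "open S" "smooth_on S f" "\<And>x. x \<in> S \<Longrightarrow> f x \<noteq> 0"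
  shows "smooth_on S (\<lambda>x. inverse (f x))"
  using smooth_on_comp[OF assms(1,2), of "- {0}" "\<lambda>n t. (-1) ^ n * fact n * inverse t ^ (Suc n)" 0]
    DERIV_inverse_powers assms(3) by auto

lemma smooth_on_divide:
  assumes "open S" "smooth_on S f" "smooth_on S g" "\<And>x. x \<in> S \<Longrightarrow> g x \<noteq> 0"
  shows "smooth_on S (\<lambda>x. f x / g x)"
  unfolding divide_inverse using assms by (intro smooth_on_mult smooth_on_inverse)

lemma smooth_on_exp:
  assumes "open S" "smooth_on S f"
  shows "smooth_on S (\<lambda>x. exp (f x))"
  using smooth_on_comp[OF assms, of UNIV "\<lambda>n. exp"] by simp

lemma smooth_on_ln:
  assumes "open S" "smooth_on S f" "\<And>x. x \<in> S \<Longrightarrow> f x > 0"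
  shows "smooth_on S (\<lambda>x. ln (f x))"
proof -
  \<comment> \<open>The derivatives of \<open>ln\<close>: the sequence for 1/t shifted by one place,
    with \<open>ln\<close> itself in front.\<close>
  define h :: "nat \<Rightarrow> real \<Rightarrow> real" where "h n = (case n of 0 \<Rightarrow> ln | Suc n \<Rightarrow> (\<lambda>t. (-1) ^ n * fact n * inverse t ^ (Suc n)))" for n :: nat
  have "(h n has_real_derivative h (Suc n) t) (at t)" if "t \<in> {0<..}" for n and t :: real
  proof (cases n)
    case 0
    then show ?thesis using that by (auto simp: h_def inverse_eq_divide intro!: derivative_eq_intros)
  next
    case (Suc m)
    then show ?thesis using DERIV_inverse_powers[of t m] that by (auto simp: h_def)
  qed
  then show ?thesis using smooth_on_comp[OF assms(1,2), of "{0<..}" h 0] assms(3) by (simp add: h_def[of 0])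
qed

lemma smooth_on_powr:
  assumes "open S" "smooth_on S f" "\<And>x. x \<in> S \<Longrightarrow> f x > 0"
  shows "smooth_on S (\<lambda>x. f x powr a)"
proof -
  have "smooth_on S (\<lambda>x. exp (a * ln (f x)))"
    using assms by (intro smooth_on_exp smooth_on_mult smooth_on_ln smooth_on_const)
  moreover have "exp (a * ln (f x)) = f x powr a" if "x \<in> S" for x
    using assms(3)[OF that] by (simp add: powr_def)
  ultimately show ?thesis
    using smooth_on_cong[OF assms(1), of "\<lambda>x. exp (a * ln (f x))" "\<lambda>x. f x powr a"] by blast
qed

lemma smooth_on_sqrt:
  assumes "open S" "smooth_on S f" "\<And>x. x \<in> S \<Longrightarrow> f x > 0"
  shows "smooth_on S (\<lambda>x. sqrt (f x))"
  using smooth_on_powr[OF assms, of "1/2"] smooth_on_cong[OF assms(1), of "\<lambda>x. f x powr (1/2)" "\<lambda>x. sqrt (f x)"] assms(3)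
  by (simp add: powr_half_sqrt less_imp_le)

lemma smooth_on_norm2: "open S \<Longrightarrow> smooth_on S (\<lambda>x. (norm x)\<^sup>2)"
  unfolding power2_norm_eq_inner inner_vec_def
  by (auto intro!: smooth_on_sum smooth_on_mult smooth_on_coord)

lemma smooth_on_norm: "open S \<Longrightarrow> 0 \<notin> S \<Longrightarrow> smooth_on S norm"
  using smooth_on_sqrt[of S "\<lambda>x. (norm x)\<^sup>2", OF _ smooth_on_norm2] by fastforce

lemma smooth_on_continuous: "smooth_on S f \<Longrightarrow> continuous_on S f"
  by (meson continuous_at_imp_continuous_on differentiable_imp_continuous_within smooth_on_differentiable)

lemma smooth_on_vec:
  assumes "open S" shows "smooth_on S (\<lambda>x. a \<bullet> x)"
  unfolding inner_vec_def using assms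
  by (auto intro!: smooth_on_sum smooth_on_mult smooth_on_coord smooth_on_const)

text \<open>Vanishing is asked only inside \<open>S\<close>: functions are total and their values
  outside \<open>S\<close> are arbitrary (division by zero, compositions leaving the domain), so a
  support taken in the whole space would be the wrong notion.\<close>

definition csmooth_on :: "(real ^ 'n) set \<Rightarrow> (real ^ 'n \<Rightarrow> real) \<Rightarrow> bool"
  where "csmooth_on S f \<longleftrightarrow>
    smooth_on S f \<and> (\<exists>K. compact K \<and> K \<subseteq> S \<and> (\<forall>x\<in>S - K. f x = 0))"

lemma csmooth_onI:
  "smooth_on S f \<Longrightarrow> compact K \<Longrightarrow> K \<subseteq> S \<Longrightarrow> (\<And>x. x \<in> S \<Longrightarrow> x \<notin> K \<Longrightarrow> f x = 0) \<Longrightarrow> csmooth_on S f"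
  unfolding csmooth_on_def by blast

lemma csmooth_on_smooth: "csmooth_on S f \<Longrightarrow> smooth_on S f"
  by (simp add: csmooth_on_def)

lemma csmooth_on_cong:
  assumes "open S" "\<And>y. y \<in> S \<Longrightarrow> f y = g y"
  shows "csmooth_on S f \<longleftrightarrow> csmooth_on S g"
  using smooth_on_cong[OF assms] assms(2) unfolding csmooth_on_def by force

lemma csmooth_on_add:
  assumes "open S" "csmooth_on S f" "csmooth_on S g"
  shows "csmooth_on S (\<lambda>x. f x + g x)"
proof -
  obtain K L where "compact K" "K \<subseteq> S" "\<forall>x\<in>S - K. f x = 0" "compact L" "L \<subseteq> S" "\<forall>x\<in>S - L. g x = 0"
    using assms by (auto simp: csmooth_on_def)
  then show ?thesis
    using csmooth_onI[OF smooth_on_add[OF assms(1) csmooth_on_smooth[OF assms(2)] csmooth_on_smooth[OF assms(3)]], of "K \<union> L"]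
    by auto
qed

lemma csmooth_on_mult_left:
  assumes "open S" "smooth_on S f" "csmooth_on S g"
  shows "csmooth_on S (\<lambda>x. f x * g x)"
  using assms smooth_on_mult[of S f g] unfolding csmooth_on_def by force

lemma csmooth_on_mult_right:
  assumes "open S" "csmooth_on S f" "smooth_on S g"
  shows "csmooth_on S (\<lambda>x. f x * g x)"
  using csmooth_on_mult_left[OF assms(1,3,2)] by (simp add: mult.commute)

lemma csmooth_on_minus: "open S \<Longrightarrow> csmooth_on S f \<Longrightarrow> csmooth_on S (\<lambda>x. - f x)"
  using csmooth_on_mult_left[OF _ smooth_on_const[of S "-1"]] by fastforce

lemma csmooth_on_diff:
  "open S \<Longrightarrow> csmooth_on S f \<Longrightarrow> csmooth_on S g \<Longrightarrow> csmooth_on S (\<lambda>x. f x - g x)"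
  using csmooth_on_add[OF _ _ csmooth_on_minus] by fastforce

lemma csmooth_on_zero: "csmooth_on S (\<lambda>x. 0)"
  by (rule csmooth_onI[of _ _ "{}"]) (auto intro: smooth_on_const)

lemma csmooth_on_sum:
  assumes "open S" "finite I" "\<And>i. i \<in> I \<Longrightarrow> csmooth_on S (f i)"
  shows "csmooth_on S (\<lambda>x. \<Sum>i\<in>I. f i x)"
  using assms(2,3)
proof (induction I)
  case (insert j I)
  then show ?case using csmooth_on_add[OF assms(1), of "f j" "\<lambda>x. \<Sum>i\<in>I. f i x"] by simp
qed (simp add: csmooth_on_zero)

lemma csmooth_on_power:
  assumes "open S" "csmooth_on S f" "n > 0"
  shows "csmooth_on S (\<lambda>x. f x ^ n)"
  using assms(3) csmooth_on_mult_left[OF assms(1) smooth_on_power[OF assms(1) csmooth_on_smooth[OF assms(2)], of "n - 1"] assms(2)]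
  by (cases n) (auto simp: mult.commute)

lemma csmooth_on_divide:
  "open S \<Longrightarrow> csmooth_on S f \<Longrightarrow> smooth_on S g \<Longrightarrow> (\<And>x. x \<in> S \<Longrightarrow> g x \<noteq> 0) \<Longrightarrow> csmooth_on S (\<lambda>x. f x / g x)"
  unfolding divide_inverse by (intro csmooth_on_mult_right smooth_on_inverse)

lemma partial_const: "partial i (\<lambda>x. c) x = 0"
  using partial_eqI[OF has_derivative_const, of i c x] by simp

lemma csmooth_on_partial:
  assumes "open S" "csmooth_on S f" shows "csmooth_on S (partial i f)"
proof -
  obtain K where K: "compact K" "K \<subseteq> S" "\<forall>x\<in>S - K. f x = 0" using assms by (auto simp: csmooth_on_def)
  have "partial i f x = 0" if "x \<in> S - K" for x
    using partial_cong[of "S - K" x f "\<lambda>x. 0" i] K that assms(1) compact_imp_closed[of K] partial_const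
    by (metis DiffD1 open_Diff)
  then show ?thesis
    using K by (intro csmooth_onI[OF smooth_on_partial[OF csmooth_on_smooth[OF assms(2)]]]) auto
qed

lemma csmooth_on_integrable:
  assumes "csmooth_on S f"
  shows "set_integrable lborel S f"
proof -
  obtain K where K: "compact K" "K \<subseteq> S" "\<forall>x\<in>S - K. f x = 0" using assms by (auto simp: csmooth_on_def)
  have "continuous_on K f" using K smooth_on_continuous[OF csmooth_on_smooth[OF assms]] continuous_on_subset by blast
  from borel_integrable_compact[OF K(1) this]
  have "integrable lborel (\<lambda>x. indicator K x *\<^sub>R f x)" .
  moreover have "(\<lambda>x. indicator K x *\<^sub>R f x) = (\<lambda>x. indicator S x *\<^sub>R f x)"
    using K by (auto simp: indicator_def fun_eq_iff split: if_splits)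
  ultimately show ?thesis by (simp only: set_integrable_def)
qed

section \<open>Integrals of partial derivatives, and symmetry of second derivatives\<close>

lemma has_real_derivative_line:
  fixes g :: "real ^ 'n \<Rightarrow> real"
  assumes "g differentiable at (c + s *\<^sub>R axis k 1)"
  shows "((\<lambda>s. g (c + s *\<^sub>R axis k 1)) has_real_derivative partial k g (c + s *\<^sub>R axis k 1)) (at s)"
proof -
  let ?y = "c + s *\<^sub>R axis k 1"
  have "((\<lambda>s. c + s *\<^sub>R axis k 1) has_derivative (\<lambda>s. s *\<^sub>R axis k 1)) (at s)"
    by (auto intro!: derivative_eq_intros)
  note d = has_derivative_compose[OF this has_derivative_partial[OF assms]]
  have "(\<Sum>j\<in>UNIV. (t *\<^sub>R axis k 1) $ j * partial j g ?y) = partial k g ?y * t" for t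
    using sum_axis[of k "\<lambda>j. partial j g ?y"]
    by (simp add: sum_distrib_left[symmetric] mult.assoc)
  then have "(\<lambda>t. \<Sum>j\<in>UNIV. (t *\<^sub>R axis k 1) $ j * partial j g ?y) = (*) (partial k g ?y)"
    by (simp add: fun_eq_iff)
  with d show ?thesis by (simp only: has_field_derivative_def)
qed

lemma integral_lborel_translate:
  fixes f :: "'a::euclidean_space \<Rightarrow> real"
  assumes "f \<in> borel_measurable borel"
  shows "(\<integral>x. f (c + x) \<partial>lborel) = (\<integral>x. f x \<partial>lborel)"
  using integral_distr[of "(+) c" lborel borel f] assms lborel_distr_plus[of c] by simp

text \<open>Fubini is avoided: every difference quotient has integral zero by translation invariance
  of Lebesgue measure, and dominated convergence passes to the derivative.\<close>

lemma integral_partial_eq_0: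
  fixes f :: "real ^ 'n \<Rightarrow> real"
  assumes S: "open S" and f: "csmooth_on S f"
  shows "(LINT x:S|lborel. partial i f x) = 0"
proof -
  obtain K where K: "compact K" "K \<subseteq> S" "\<forall>x\<in>S - K. f x = 0" using f by (auto simp: csmooth_on_def)
  define a :: "real ^ 'n" where "a = axis i 1"
  \<comment> \<open>Extension by zero is differentiable everywhere: a point outside \<open>S\<close>
    lies in the open complement of \<open>K\<close>, where \<open>F\<close> vanishes
    identically.\<close>
  define F where "F x = indicator S x * f x" for x
  define G where "G x = indicator S x * partial i f x" for x
  have G0: "G x = 0" if "x \<notin> K" for x
  proof (cases "x \<in> S")
    case True
    then have "partial i f x = partial i (\<lambda>x. 0) x"
      using partial_cong[of "S - K" x f "\<lambda>x. 0" i] K that S compact_imp_closed[of K] by blast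
    then show ?thesis by (simp add: G_def partial_const)
  qed (simp add: G_def)
  have F0: "F x = 0" if "x \<notin> K" for x using K that by (auto simp: F_def indicator_def)
  have op: "open (- K)" using K compact_imp_closed by blast
  have d: "(F has_derivative (\<lambda>v. \<Sum>j\<in>UNIV. v $ j * partial j F x)) (at x) \<and> partial i F x = G x" for x
  proof (cases "x \<in> S")
    case True
    have "F differentiable at x"
      using differentiable_cong_open[OF S True, of F f] smooth_on_differentiable[OF csmooth_on_smooth[OF f] True]
      by (simp add: F_def)
    moreover have "partial i F x = G x"
      using partial_cong[OF S True, of F f i] True by (simp add: F_def G_def)
    ultimately show ?thesis using has_derivative_partial by blast
  next
    case False
    then have x: "x \<in> - K" using K by blast
    have "F differentiable at x"
      using differentiable_cong_open[OF op x, of F "\<lambda>x. 0"] F0 by simp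
    moreover have "partial i F x = G x"
      using partial_cong[OF op x, of F "\<lambda>x. 0" i] F0 G0 x by (simp add: partial_const)
    ultimately show ?thesis using has_derivative_partial by blast
  qed
  have dif: "F differentiable at y" for y
    by (rule differentiableI[OF conjunct1[OF d]])
  have dF: "((\<lambda>s. F (x + s *\<^sub>R a)) has_real_derivative G (x + s *\<^sub>R a)) (at s)" for x s
    using has_real_derivative_line[OF dif, of x i s] conjunct2[OF d] by (simp only: a_def)
  have cF: "continuous_on UNIV F"
    by (intro continuous_at_imp_continuous_on ballI differentiable_imp_continuous_within dif)
  have cG: "continuous_on K (\<lambda>x. partial i f x)"
    using K smooth_on_continuous[OF smooth_on_partial[OF csmooth_on_smooth[OF f]]] continuous_on_subset by blast
  obtain B where B: "\<And>x. x \<in> K \<Longrightarrow> \<bar>partial i f x\<bar> \<le> B"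
    using compact_imp_bounded[OF compact_continuous_image[OF cG K(1)]] by (auto simp: bounded_iff)
  define B' where "B' = max B 0"
  have GB: "\<bar>G x\<bar> \<le> B'" for x
    using B[of x] G0[of x] by (cases "x \<in> K") (auto simp: B'_def G_def indicator_def)
  obtain R where R: "\<And>x. x \<in> K \<Longrightarrow> norm x \<le> R" using compact_imp_bounded[OF K(1)] by (auto simp: bounded_iff)
  define h where "h n = 1 / (real n + 1)" for n
  have h: "0 < h n" "h n \<le> 1" for n by (auto simp: h_def)
  have hlim: "h \<longlonglongrightarrow> 0" unfolding h_def using LIMSEQ_inverse_real_of_nat by (simp add: inverse_eq_divide add.commute)
  define q where "q n x = (F (x + h n *\<^sub>R a) - F x) / h n" for n x
  have mF: "F \<in> borel_measurable borel" using cF by (rule borel_measurable_continuous_onI)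
  have q_meas: "q n \<in> borel_measurable lborel" for n
    unfolding q_def using mF by measurable
  have q_lim: "(\<lambda>n. q n x) \<longlonglongrightarrow> G x" for x
  proof -
    have "((\<lambda>s. (F (x + s *\<^sub>R a) - F x) / s) \<longlongrightarrow> G x) (at 0)"
      using dF[of x 0] by (simp add: DERIV_def)
    moreover have "filterlim h (at 0) sequentially"
      using hlim h(1) less_imp_neq[OF h(1)] by (auto simp: filterlim_at)
    ultimately show ?thesis unfolding q_def by (rule filterlim_compose)
  qed
  \<comment> \<open>The mean value theorem bounds the quotient by the supremum of the derivative,
    and steps of length at most 1 keep its support within distance 1 of \<open>K\<close>; hence the
    radius \<open>R + 1\<close>.\<close>
  have q_bound: "\<bar>q n x\<bar> \<le> B' * indicator (cball 0 (R + 1)) x" for n x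
  proof (cases "x \<in> cball 0 (R + 1)")
    case True
    obtain s where "F (x + h n *\<^sub>R a) - F (x + 0 *\<^sub>R a) = (h n - 0) * G (x + s *\<^sub>R a)"
      using MVT2[OF h(1), of n "\<lambda>s. F (x + s *\<^sub>R a)" "\<lambda>s. G (x + s *\<^sub>R a)"] dF by blast
    then show ?thesis using GB[of "x + s *\<^sub>R a"] h(1)[of n] True by (simp add: q_def)
  next
    case False
    then have 1: "norm x > R + 1" by simp
    have "norm (x + h n *\<^sub>R a) \<ge> norm x - norm (h n *\<^sub>R a)"
      by (rule norm_diff_ineq)
    moreover have "norm (h n *\<^sub>R a) \<le> 1" using h[of n] by (simp add: a_def)
    ultimately have "norm (x + h n *\<^sub>R a) > R" using 1 by simp
    then have "x + h n *\<^sub>R a \<notin> K" "x \<notin> K" using R 1 by force+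
    then show ?thesis by (simp add: q_def F0 B'_def)
  qed
  have bnd_int: "integrable lborel (\<lambda>x::real^'n. B' * indicator (cball 0 (R + 1)) x)"
    using emeasure_bounded_finite[OF bounded_cball[of "0 :: real ^ 'n" "R + 1"]]
    by (intro integrable_mult_right integrable_real_indicator) (simp_all add: top.not_eq_extremum)
  have "(\<lambda>n. integral\<^sup>L lborel (q n)) \<longlonglongrightarrow> integral\<^sup>L lborel G"
  proof (rule integral_dominated_convergence[OF _ q_meas bnd_int])
    show "G \<in> borel_measurable lborel"
      by (rule borel_measurable_LIMSEQ_metric[OF q_meas q_lim])
  qed (use q_lim q_bound in auto)
  moreover have "integral\<^sup>L lborel (q n) = 0" for n
  proof -
    have iF: "integrable lborel F"
      using csmooth_on_integrable[OF f] by (simp add: set_integrable_def F_def[abs_def])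
    have iF': "integrable lborel (\<lambda>x. F (h n *\<^sub>R a + x))"
      using integrable_distr_eq[of "(+) (h n *\<^sub>R a)" lborel borel F] mF iF lborel_distr_plus[of "h n *\<^sub>R a"] by simp
    have "integral\<^sup>L lborel (q n) = ((\<integral>x. F (h n *\<^sub>R a + x) \<partial>lborel) - (\<integral>x. F x \<partial>lborel)) / h n"
      unfolding q_def using iF iF' by (simp add: add.commute)
    also have "\<dots> = 0" using integral_lborel_translate[OF mF] by simp
    finally show ?thesis .
  qed
  ultimately have "integral\<^sup>L lborel G = 0" by (simp add: LIMSEQ_const_iff)
  then show ?thesis by (simp add: set_lebesgue_integral_def G_def[abs_def])
qed

text \<open>The mean value theorem is used twice, in direction i for the difference taken in
  direction j, then in direction j for \<open>partial i f\<close>. The resulting value is exact, at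
  an intermediate point, and needs no remainder estimate.\<close>

lemma second_difference_eq:
  fixes f :: "real ^ 'n \<Rightarrow> real"
  assumes f: "smooth_on S f" and h: "h > 0" and S: "cball x (2 * h) \<subseteq> S"
  shows "\<exists>y. dist y x \<le> 2 * h \<and>
    f (x + h *\<^sub>R axis i 1 + h *\<^sub>R axis j 1) - f (x + h *\<^sub>R axis i 1) - f (x + h *\<^sub>R axis j 1) + f x
      = h * h * partial j (partial i f) y"
proof -
  define a :: "real ^ 'n" where "a = axis i 1"
  define b :: "real ^ 'n" where "b = axis j 1"
  have nab: "norm a = 1" "norm b = 1" by (auto simp: a_def b_def)
  have inS: "x + s *\<^sub>R a + t *\<^sub>R b \<in> cball x (2 * h)" if "0 \<le> s" "s \<le> h" "0 \<le> t" "t \<le> h" for s t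
  proof -
    have "dist x (x + s *\<^sub>R a + t *\<^sub>R b) = norm (s *\<^sub>R a + t *\<^sub>R b)"
      unfolding dist_commute[of x] by (simp add: dist_norm algebra_simps)
    then have "dist x (x + s *\<^sub>R a + t *\<^sub>R b) \<le> norm (s *\<^sub>R a) + norm (t *\<^sub>R b)"
      using norm_triangle_ineq[of "s *\<^sub>R a" "t *\<^sub>R b"] by simp
    then show ?thesis using that nab by simp
  qed
  have d: "((\<lambda>s. g (c + s *\<^sub>R axis k 1)) has_real_derivative partial k g (c + s *\<^sub>R axis k 1)) (at s)"
    if "smooth_on S g" "c + s *\<^sub>R axis k 1 \<in> S" for g c s k
    using has_real_derivative_line smooth_on_differentiable[OF that] by blast
  define \<phi> where "\<phi> s = f (x + s *\<^sub>R a + h *\<^sub>R b) - f (x + s *\<^sub>R a)" for s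
  have "(\<phi> has_real_derivative partial i f (x + s *\<^sub>R a + h *\<^sub>R b) - partial i f (x + s *\<^sub>R a)) (at s)"
    if "0 \<le> s" "s \<le> h" for s
    unfolding \<phi>_def
  proof (rule DERIV_diff)
    show "((\<lambda>s. f (x + s *\<^sub>R a + h *\<^sub>R b)) has_real_derivative partial i f (x + s *\<^sub>R a + h *\<^sub>R b)) (at s)"
      using d[OF f, of "x + h *\<^sub>R b" s i] subsetD[OF S inS[of s h]] that h
      by (simp add: a_def ac_simps)
    show "((\<lambda>s. f (x + s *\<^sub>R a)) has_real_derivative partial i f (x + s *\<^sub>R a)) (at s)"
      using d[OF f, of "x" s i] subsetD[OF S inS[of s 0]] that h by (simp add: a_def)
  qed
  from MVT2[OF h this] obtain s where s: "0 < s" "s < h"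
    "\<phi> h - \<phi> 0 = h * (partial i f (x + s *\<^sub>R a + h *\<^sub>R b) - partial i f (x + s *\<^sub>R a))" by auto
  have "((\<lambda>t. partial i f (x + s *\<^sub>R a + t *\<^sub>R b)) has_real_derivative partial j (partial i f) (x + s *\<^sub>R a + t *\<^sub>R b)) (at t)"
    if "0 \<le> t" "t \<le> h" for t
    using d[OF smooth_on_partial[OF f], of "x + s *\<^sub>R a" t j i] subsetD[OF S inS[of s t]] that h s
    by (simp add: b_def)
  from MVT2[OF h this] obtain t where t: "0 < t" "t < h"
    "partial i f (x + s *\<^sub>R a + h *\<^sub>R b) - partial i f (x + s *\<^sub>R a) = h * partial j (partial i f) (x + s *\<^sub>R a + t *\<^sub>R b)"
    by auto
  have "f (x + h *\<^sub>R a + h *\<^sub>R b) - f (x + h *\<^sub>R a) - f (x + h *\<^sub>R b) + f x = \<phi> h - \<phi> 0"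
    by (simp add: \<phi>_def)
  also have "\<dots> = h * h * partial j (partial i f) (x + s *\<^sub>R a + t *\<^sub>R b)"
    using s(3) t(3) by simp
  finally show ?thesis
    using s t inS[of s t] unfolding a_def b_def
    by (intro exI[of _ "x + s *\<^sub>R axis i 1 + t *\<^sub>R axis j 1"]) (auto simp: dist_commute)
qed

text \<open>The second difference is symmetric in i and j, so the two mixed derivatives take a
  common value at points \<open>z\<close> and \<open>y\<close> close to \<open>x\<close>; their
  continuity carries the equality to \<open>x\<close>.\<close>

lemma partial_commute:
  fixes f :: "real ^ 'n \<Rightarrow> real"
  assumes S: "open S" and f: "smooth_on S f" and x: "x \<in> S"
  shows "partial i (partial j f) x = partial j (partial i f) x"
proof (rule ccontr)
  define A where "A = partial i (partial j f)"
  define B where "B = partial j (partial i f)"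
  assume "\<not> ?thesis"
  then have e: "\<bar>A x - B x\<bar> > 0" by (simp add: A_def B_def)
  define e where "e = \<bar>A x - B x\<bar> / 2"
  have e': "e > 0" using e by (simp add: e_def)
  have cA: "isCont A x" "isCont B x"
    unfolding A_def B_def
    by (intro differentiable_imp_continuous_within smooth_on_differentiable[OF _ x] smooth_on_partial f)+
  obtain d1 where d1: "d1 > 0" "\<And>y. dist y x < d1 \<Longrightarrow> dist (A y) (A x) < e"
    using cA(1)[unfolded continuous_at_eps_delta, rule_format, OF e'] by auto
  obtain d2 where d2: "d2 > 0" "\<And>y. dist y x < d2 \<Longrightarrow> dist (B y) (B x) < e"
    using cA(2)[unfolded continuous_at_eps_delta, rule_format, OF e'] by auto
  obtain d3 where d3: "d3 > 0" "cball x d3 \<subseteq> S" using S x open_contains_cball by blast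
  \<comment> \<open>The divisor 4 makes the radius \<open>2 * h\<close> strictly smaller than
    \<open>d1\<close> and \<open>d2\<close>.\<close>
  define h where "h = min (min d1 d2) d3 / 4"
  have h: "h > 0" "2 * h < d1" "2 * h < d2" "2 * h \<le> d3" using d1 d2 d3 by (auto simp: h_def)
  have hS: "cball x (2 * h) \<subseteq> S" using d3 h by force
  obtain y where y: "dist y x \<le> 2 * h"
    "f (x + h *\<^sub>R axis i 1 + h *\<^sub>R axis j 1) - f (x + h *\<^sub>R axis i 1) - f (x + h *\<^sub>R axis j 1) + f x = h * h * B y"
    using second_difference_eq[OF f h(1) hS, of i j] by (auto simp: B_def)
  obtain z where z: "dist z x \<le> 2 * h"
    "f (x + h *\<^sub>R axis j 1 + h *\<^sub>R axis i 1) - f (x + h *\<^sub>R axis j 1) - f (x + h *\<^sub>R axis i 1) + f x = h * h * A z"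
    using second_difference_eq[OF f h(1) hS, of j i] by (auto simp: A_def)
  have eq: "x + h *\<^sub>R axis j 1 + h *\<^sub>R axis i 1 = x + h *\<^sub>R axis i 1 + h *\<^sub>R axis j 1" by (simp add: algebra_simps)
  have "h * h * A z = h * h * B y" using y(2) z(2) unfolding eq by linarith
  then have "A z = B y" using h by simp
  moreover have "dist (B y) (B x) < e" "dist (A z) (A x) < e" using y z h d1 d2 by auto
  ultimately show False using dist_triangle2[of "A x" "B x" "A z"] dist_commute[of "A z"] dist_commute[of "B y"]
    unfolding e_def dist_real_def by simp
qed

section \<open>Conformal change of variables\<close>

text \<open>The change of variables formula of HOL-Analysis requires a well-ordered index type; the
  copy \<open>'a wo\<close> of a finite type \<open>'a\<close> carries such an order.\<close>

typedef 'a wo = "UNIV :: 'a set" ..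

definition wo_index :: "'a::finite wo \<Rightarrow> nat"
  where "wo_index = (SOME f. inj f)"

lemma inj_Rep_wo: "inj Rep_wo"
  by (simp add: inj_on_def Rep_wo_inject)

lemma bij_Rep_wo: "bij Rep_wo"
  using inj_Rep_wo Abs_wo_inverse by (metis UNIV_I bijI surj_def)

instance wo :: (finite) finite
proof
  show "finite (UNIV :: 'a wo set)" by (rule finite_imageD[OF finite inj_Rep_wo])
qed

lemma inj_wo_index: "inj (wo_index :: 'a::finite wo \<Rightarrow> nat)"
proof -
  have "\<exists>f :: 'a wo \<Rightarrow> nat. inj f"
    using finite_imp_inj_to_nat_seg[OF finite[of "UNIV :: 'a wo set"]] by blast
  then show ?thesis unfolding wo_index_def by (rule someI_ex)
qed

instantiation wo :: (finite) wellorder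
begin

definition less_eq_wo :: "'a wo \<Rightarrow> 'a wo \<Rightarrow> bool" where "less_eq_wo x y \<longleftrightarrow> wo_index x \<le> wo_index y"
definition less_wo :: "'a wo \<Rightarrow> 'a wo \<Rightarrow> bool" where "less_wo x y \<longleftrightarrow> wo_index x < wo_index y"

instance
proof
  fix x y :: "'a wo" and P :: "'a wo \<Rightarrow> bool"
  show "x \<le> y \<Longrightarrow> y \<le> x \<Longrightarrow> x = y"
    using inj_wo_index by (auto simp: less_eq_wo_def inj_on_def)
  show "(\<And>x. (\<And>y. y < x \<Longrightarrow> P y) \<Longrightarrow> P x) \<Longrightarrow> P x"
    unfolding less_wo_def by (rule measure_induct_rule[of wo_index P x]) blast
qed (auto simp: less_eq_wo_def less_wo_def)

end

definition to_wo :: "real ^ 'n \<Rightarrow> real ^ 'n wo"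
  where "to_wo x = (\<chi> k. x $ Rep_wo k)"

definition of_wo :: "real ^ 'n wo \<Rightarrow> real ^ 'n"
  where "of_wo z = (\<chi> k. z $ Abs_wo k)"

lemma of_wo_to_wo [simp]: "of_wo (to_wo x) = x"
  by (simp add: of_wo_def to_wo_def vec_eq_iff Abs_wo_inverse)

lemma to_wo_of_wo [simp]: "to_wo (of_wo z) = z"
  by (simp add: of_wo_def to_wo_def vec_eq_iff Rep_wo_inverse)

lemma linear_to_wo: "linear to_wo"
  by (intro linearI) (simp_all add: to_wo_def vec_eq_iff)

lemma linear_of_wo: "linear of_wo"
  by (intro linearI) (simp_all add: of_wo_def vec_eq_iff)

lemma norm_to_wo [simp]: "norm (to_wo x) = norm x"
  unfolding norm_vec_def L2_set_def to_wo_def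
  using sum.reindex_bij_betw[OF bij_Rep_wo, of "\<lambda>k. (norm (x $ k))\<^sup>2"] by simp

lemma norm_of_wo [simp]: "norm (of_wo z) = norm z"
  using norm_to_wo[of "of_wo z"] by simp

lemma card_wo: "CARD('n::finite wo) = CARD('n)"
  using bij_betw_same_card[OF bij_Rep_wo] by simp

lemma continuous_of_wo: "continuous_on UNIV of_wo"
  by (simp add: linear_continuous_on linear_of_wo linear_conv_bounded_linear[symmetric])

text \<open>Lebesgue measure is determined by the volumes of boxes, and relabelling coordinates
  along a bijection of the index types maps boxes to boxes with the same side lengths.\<close>

lemma lborel_distr_of_wo: "distr lborel borel of_wo = (lborel :: (real ^ 'n) measure)"
proof (rule lborel_eqI[symmetric])
  fix l u :: "real ^ 'n"
  assume le: "\<And>b. b \<in> Basis \<Longrightarrow> l \<bullet> b \<le> u \<bullet> b"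
  then have le': "l $ k \<le> u $ k" for k
    using le[of "axis k 1"] by (simp add: inner_axis axis_in_Basis_iff)
  have meas: "of_wo \<in> borel_measurable borel"
    using continuous_of_wo by (rule borel_measurable_continuous_onI)
  have pre: "of_wo -` box l u = box (to_wo l) (to_wo u)"
  proof -
    have "(\<forall>k. l $ k < z $ Abs_wo k \<and> z $ Abs_wo k < u $ k) \<longleftrightarrow>
      (\<forall>k. l $ Rep_wo k < z $ k \<and> z $ k < u $ Rep_wo k)" for z
      by (metis Abs_wo_inverse Rep_wo_inverse UNIV_I)
    then show ?thesis by (auto simp: mem_box_cart of_wo_def to_wo_def)
  qed
  have prod_cart: "(\<Prod>b\<in>Basis. (v :: real ^ 'k) \<bullet> b) = (\<Prod>k\<in>UNIV. v $ k)" for v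
  proof -
    have "(\<Prod>b\<in>Basis. v \<bullet> b) = (\<Prod>b\<in>(\<lambda>k. axis k 1) ` UNIV. v \<bullet> b)"
      by (rule prod.cong) (auto simp: Basis_vec_def)
    also have "\<dots> = (\<Prod>k\<in>UNIV. v $ k)"
      by (subst prod.reindex) (auto simp: inj_on_def axis_eq_axis inner_axis)
    finally show ?thesis .
  qed
  have "emeasure (distr lborel borel of_wo) (box l u) = emeasure lborel (box (to_wo l) (to_wo u))"
    using meas by (subst emeasure_distr) (auto simp: pre)
  also have "\<dots> = (\<Prod>b\<in>Basis. (to_wo u - to_wo l) \<bullet> b)"
    using le' by (intro emeasure_lborel_box) (auto simp: to_wo_def Basis_vec_def inner_axis)
  also have "(\<Prod>b\<in>Basis. (to_wo u - to_wo l) \<bullet> b) = (\<Prod>k\<in>UNIV. (u - l) $ k)"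
    unfolding prod_cart
    using prod.reindex_bij_betw[OF bij_Rep_wo, of "\<lambda>k. (u - l) $ k"] by (simp add: to_wo_def)
  also have "\<dots> = (\<Prod>b\<in>Basis. (u - l) \<bullet> b)"
    unfolding prod_cart ..
  finally show "emeasure (distr lborel borel of_wo) (box l u) = ennreal (\<Prod>b\<in>Basis. (u - l) \<bullet> b)" .
qed simp

lemma set_integral_of_wo:
  fixes f :: "real ^ 'n \<Rightarrow> real"
  assumes "set_integrable lborel T f"
  shows "set_integrable lborel (to_wo ` T) (\<lambda>z. f (of_wo z))"
    and "(LINT z:to_wo ` T|lborel. f (of_wo z)) = (LINT x:T|lborel. f x)"
proof -
  have ind: "indicator (to_wo ` T) z = (indicator T (of_wo z) :: real)" for z
  proof -
    have "z \<in> to_wo ` T \<longleftrightarrow> of_wo z \<in> T" by (metis image_iff of_wo_to_wo to_wo_of_wo)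
    then show ?thesis by (simp add: indicator_def)
  qed
  have meas: "of_wo \<in> borel_measurable lborel"
    using borel_measurable_continuous_onI[OF continuous_of_wo] by simp
  have i: "integrable (distr lborel borel of_wo) (\<lambda>x. indicator T x *\<^sub>R f x)"
    using assms unfolding lborel_distr_of_wo set_integrable_def .
  show "set_integrable lborel (to_wo ` T) (\<lambda>z. f (of_wo z))"
    unfolding set_integrable_def ind by (rule integrable_distr[OF meas i])
  have "(\<integral>x. indicator T x *\<^sub>R f x \<partial>distr lborel borel of_wo) = (\<integral>z. indicator T (of_wo z) *\<^sub>R f (of_wo z) \<partial>lborel)"
  proof (rule integral_distr[OF meas])
    show "(\<lambda>x. indicator T x *\<^sub>R f x) \<in> borel_measurable borel"
      using borel_measurable_integrable[OF i] by simp
  qed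
  then show "(LINT z:to_wo ` T|lborel. f (of_wo z)) = (LINT x:T|lborel. f x)"
    unfolding lborel_distr_of_wo set_lebesgue_integral_def ind by simp
qed

text \<open>Division by \<open>c\<close> leaves a norm-preserving linear map, whose determinant is 1
  or -1.\<close>

lemma abs_det_conformal:
  fixes g :: "real ^ 'n \<Rightarrow> real ^ 'n"
  assumes "linear g" "c > 0" "\<And>v. norm (g v) = c * norm v"
  shows "\<bar>det (matrix g)\<bar> = c ^ CARD('n)"
proof -
  define h where "h v = (1 / c) *\<^sub>R g v" for v
  have h: "orthogonal_transformation h"
    using assms by (simp add: orthogonal_transformation h_def[abs_def] linear_compose_scale_right)
  have "g = (*\<^sub>R) c \<circ> h" using assms(2) by (auto simp: h_def)
  then have "matrix g = matrix ((*\<^sub>R) c :: real ^ 'n \<Rightarrow> _) ** matrix h"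
    using matrix_compose[of h "(*\<^sub>R) c"] h by (simp add: orthogonal_transformation_linear linear_scaleR)
  then show ?thesis
    using h assms(2) by (simp add: det_mul abs_mult)
qed

lemma set_integrable_lborel_imp_absolutely_integrable:
  "set_integrable lborel S f \<Longrightarrow> f absolutely_integrable_on S"
  unfolding set_integrable_def by (simp add: integrable_completion borel_measurable_integrable)

text \<open>For a conformal map the Jacobian is the N-th power of the factor \<open>c\<close>, so
  the determinant of a Moebius derivative is never expanded. Integrability is assumed on both sides
  so that either Lebesgue integral can be read as a gauge integral, for which the formula is
  applied.\<close>

theorem conformal_change_of_variables:
  fixes g h :: "real ^ 'n \<Rightarrow> real ^ 'n" and f :: "real ^ 'n \<Rightarrow> real"
  assumes S: "open S" and T: "open T"
    and g: "\<And>x. x \<in> S \<Longrightarrow> (g has_derivative g' x) (at x)"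
    and h: "\<And>y. y \<in> T \<Longrightarrow> (h has_derivative h' y) (at y)"
    and hg: "\<And>x. x \<in> S \<Longrightarrow> g x \<in> T \<and> h (g x) = x"
    and gh: "\<And>y. y \<in> T \<Longrightarrow> h y \<in> S \<and> g (h y) = y"
    and c: "\<And>x. x \<in> S \<Longrightarrow> c x > 0" "\<And>x v. x \<in> S \<Longrightarrow> norm (g' x v) = c x * norm v"
    and f: "set_integrable lborel T f"
    and fg: "set_integrable lborel S (\<lambda>x. c x ^ CARD('n) * f (g x))"
  shows "(LINT x:S|lborel. c x ^ CARD('n) * f (g x)) = (LINT y:T|lborel. f y)"
proof -
  define G where "G z = to_wo (g (of_wo z))" for z
  define H where "H z = to_wo (h (of_wo z))" for z
  define G' where "G' z v = to_wo (g' (of_wo z) (of_wo v))" for z v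
  define H' where "H' z v = to_wo (h' (of_wo z) (of_wo v))" for z v
  have bl: "bounded_linear to_wo" "bounded_linear of_wo"
    using linear_to_wo linear_of_wo linear_conv_bounded_linear by blast+
  note to_d = bounded_linear_imp_has_derivative[OF bl(1)] and of_d = bounded_linear_imp_has_derivative[OF bl(2)]
  have in_iff: "z \<in> to_wo ` A \<longleftrightarrow> of_wo z \<in> A" for z A by (metis image_iff of_wo_to_wo to_wo_of_wo)
  have G: "(G has_derivative G' z) (at z)" if "of_wo z \<in> S" for z
    unfolding G_def G'_def
    by (rule has_derivative_compose[OF has_derivative_compose[OF of_d g[OF that]] to_d])
  have H: "(H has_derivative H' z) (at z)" if "of_wo z \<in> T" for z
    unfolding H_def H'_def
    by (rule has_derivative_compose[OF has_derivative_compose[OF of_d h[OF that]] to_d])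
  \<comment> \<open>\<open>h\<close> after \<open>g\<close> is the identity on the open set
    \<open>S\<close>, so uniqueness of derivatives makes \<open>h'\<close> a left inverse of
    \<open>g'\<close>.\<close>
  have id: "h' y \<circ> g' (h y) = id" if y: "y \<in> T" for y
  proof -
    have d1: "((\<lambda>x. h (g x)) has_derivative (\<lambda>v. h' y (g' (h y) v))) (at (h y))"
      using has_derivative_compose[OF g[of "h y"], of h "h' y"] h[OF y] gh[OF y] by simp
    have d2: "((\<lambda>x. h (g x)) has_derivative (\<lambda>v. v)) (at (h y))"
      using has_derivative_transform_within_open[OF has_derivative_ident S, of "h y" "\<lambda>x. h (g x)"] hg gh[OF y] by simp
    from has_derivative_unique[OF d1 d2] show ?thesis by (simp add: fun_eq_iff)
  qed
  have det: "\<bar>det (matrix (G' z))\<bar> = c (of_wo z) ^ CARD('n)" if z: "of_wo z \<in> S" for z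
  proof -
    have "linear (G' z)" using G[OF z] has_derivative_linear by blast
    then show ?thesis
      using abs_det_conformal[of "G' z" "c (of_wo z)"] c[OF z] by (simp add: G'_def card_wo)
  qed
  note f1 = set_integrable_lborel_imp_absolutely_integrable[OF set_integral_of_wo(1)[OF f]]
  have A: "set_integrable lborel (to_wo ` T) (\<lambda>z. f (of_wo z))"
    by (rule set_integral_of_wo(1)[OF f])
  have B: "(LINT z:to_wo ` T|lborel. f (of_wo z)) = (LINT y:T|lborel. f y)"
    by (rule set_integral_of_wo(2)[OF f])
  have C: "(LINT z:to_wo ` T|lborel. f (of_wo z)) = integral (to_wo ` T) (\<lambda>z. f (of_wo z))"
    by (rule set_borel_integral_eq_integral(2)[OF A])
  have f2: "(LINT y:T|lborel. f y) = integral (to_wo ` T) (\<lambda>z. f (of_wo z))"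
    unfolding B[symmetric] by (rule C)
  define f' where "f' z = f (of_wo z)" for z
  define b where "b = integral (to_wo ` T) f'"
  have "(\<lambda>z. \<bar>det (matrix (G' z))\<bar> * f' (G z)) absolutely_integrable_on (to_wo ` S) \<and>
      integral (to_wo ` S) (\<lambda>z. \<bar>det (matrix (G' z))\<bar> * f' (G z)) = b \<longleftrightarrow>
      f' absolutely_integrable_on (to_wo ` T) \<and> integral (to_wo ` T) f' = b"
  proof (rule cov_invertible_real)
    show "(G has_derivative G' z) (at z within to_wo ` S)" if "z \<in> to_wo ` S" for z
      by (rule has_derivative_at_withinI[OF G]) (use that in_iff[of z S] in simp)
    show "(H has_derivative H' z) (at z within to_wo ` T)" if "z \<in> to_wo ` T" for z
      by (rule has_derivative_at_withinI[OF H]) (use that in_iff[of z T] in simp)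
    show "G z \<in> to_wo ` T \<and> H (G z) = z" if "z \<in> to_wo ` S" for z
      using hg[of "of_wo z"] that by (simp add: in_iff G_def H_def)
    show "H z \<in> to_wo ` S \<and> G (H z) = z" if "z \<in> to_wo ` T" for z
      using gh[of "of_wo z"] that by (simp add: in_iff G_def H_def)
    show "H' z \<circ> G' (H z) = id" if "z \<in> to_wo ` T" for z
      using id[of "of_wo z"] that in_iff[of z T] by (simp add: G'_def H'_def H_def fun_eq_iff)
  qed
  then have "integral (to_wo ` S) (\<lambda>z. \<bar>det (matrix (G' z))\<bar> * f' (G z)) = b"
    using f1 unfolding f'_def b_def by blast
  then have "integral (to_wo ` S) (\<lambda>z. \<bar>det (matrix (G' z))\<bar> * f (of_wo (G z))) = (LINT y:T|lborel. f y)"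
    unfolding f2 b_def f'_def .
  also have "integral (to_wo ` S) (\<lambda>z. \<bar>det (matrix (G' z))\<bar> * f (of_wo (G z))) =
      integral (to_wo ` S) (\<lambda>z. c (of_wo z) ^ CARD('n) * f (g (of_wo z)))"
    by (rule Henstock_Kurzweil_Integration.integral_cong) (simp add: det G_def in_iff)
  also have "\<dots> = (LINT x:S|lborel. c x ^ CARD('n) * f (g x))"
    by (rule trans[OF set_borel_integral_eq_integral(2)[OF set_integral_of_wo(1)[OF fg], symmetric]
          set_integral_of_wo(2)[OF fg]])
  finally show ?thesis .
qed

section \<open>Polar fields on the punctured ball\<close>

definition dirv :: "real ^ 'n \<Rightarrow> (real ^ 'n \<Rightarrow> real) \<Rightarrow> real ^ 'n \<Rightarrow> real"
  where "dirv v f x = (\<Sum>k\<in>UNIV. v $ k * partial k f x)"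

lemma dirv_eqI: "(f has_derivative F) (at x) \<Longrightarrow> dirv v f x = F v"
proof -
  assume d: "(f has_derivative F) (at x)"
  have "F = (\<lambda>v. \<Sum>k\<in>UNIV. v $ k * partial k f x)"
    by (rule has_derivative_unique[OF d has_derivative_partial[OF differentiableI[OF d]]])
  then show "dirv v f x = F v" by (simp add: dirv_def)
qed

lemma dirv_add: "f differentiable at x \<Longrightarrow> g differentiable at x \<Longrightarrow>
    dirv v (\<lambda>x. f x + g x) x = dirv v f x + dirv v g x"
  by (simp add: dirv_def partial_add algebra_simps sum.distrib)

lemma dirv_mult: "f differentiable at x \<Longrightarrow> g differentiable at x \<Longrightarrow>
    dirv v (\<lambda>x. f x * g x) x = dirv v f x * g x + f x * dirv v g x"
  by (simp add: dirv_def partial_mult algebra_simps sum.distrib sum_distrib_left sum_distrib_right)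

lemma dirv_comp: "f differentiable at x \<Longrightarrow> (h has_real_derivative h') (at (f x)) \<Longrightarrow>
    dirv v (\<lambda>x. h (f x)) x = h' * dirv v f x"
  by (simp add: dirv_def partial_comp algebra_simps sum_distrib_left)

lemma dirv_const: "dirv v (\<lambda>x. c) x = 0"
  by (simp add: dirv_def partial_const)

lemma dirv_cong:
  assumes "open S" "x \<in> S" "\<And>y. y \<in> S \<Longrightarrow> f y = g y"
  shows "dirv v f x = dirv v g x"
  unfolding dirv_def using partial_cong[OF assms] by simp

lemma dirv_coord: "dirv v (\<lambda>x. x $ i) x = v $ i"
  using dirv_eqI[OF bounded_linear_imp_has_derivative[OF bounded_linear_vec_nth[of i]]] by simp

lemma dirv_vec_diff: "dirv (v - w) f x = dirv v f x - dirv w f x"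
  by (simp add: dirv_def algebra_simps sum_subtractf)

lemma dirv_vec_scaleR: "dirv (c *\<^sub>R v) f x = c * dirv v f x"
  by (simp add: dirv_def algebra_simps sum_distrib_left)

lemma dirv_axis: "dirv (axis i 1) f x = partial i f x"
  by (simp add: dirv_def sum_axis)

lemma dirv_norm: "x \<noteq> 0 \<Longrightarrow> dirv v norm x = (x \<bullet> v) / norm x"
  using dirv_eqI[OF has_derivative_norm, of x v]
  by (simp add: sgn_div_norm divide_inverse mult.commute inner_commute)

lemma differentiable_norm_at: "x \<noteq> 0 \<Longrightarrow> norm differentiable at (x :: real ^ 'n)"
  using has_derivative_norm[of x] differentiableI by blast

definition punct :: "(real ^ 'n) set"
  where "punct = hyp_space - {0}"

definition omega :: "'n \<Rightarrow> real ^ 'n \<Rightarrow> real"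
  where "omega i x = x $ i / norm x"

definition eul :: "(real ^ 'n \<Rightarrow> real) \<Rightarrow> real ^ 'n \<Rightarrow> real"
  where "eul f x = dirv x f x"

text \<open>The factor \<open>norm x\<close> makes the field invariant under dilations, so that it
  commutes with \<open>eul\<close>. Using N globally defined fields, tied together by
  \<open>sum_omega_ang\<close>, replaces local frames on the sphere.\<close>

definition ang :: "'n \<Rightarrow> (real ^ 'n \<Rightarrow> real) \<Rightarrow> real ^ 'n \<Rightarrow> real"
  where "ang i f x = dirv (norm x *\<^sub>R axis i 1 - (x $ i / norm x) *\<^sub>R x) f x"

lemma norm_omega: "x \<noteq> 0 \<Longrightarrow> norm x * omega i x = x $ i"
  and norm_omega': "x \<noteq> 0 \<Longrightarrow> norm x * (omega i x * c) = x $ i * c"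
  and norm_omega'': "x \<noteq> 0 \<Longrightarrow> omega i x * (norm x * c) = x $ i * c"
  by (simp_all add: omega_def)

lemma ang_eq: "ang i f x = norm x * partial i f x - omega i x * eul f x"
  by (simp add: ang_def eul_def omega_def dirv_vec_diff dirv_vec_scaleR dirv_axis)

lemma eul_eq: "eul f x = (\<Sum>k\<in>UNIV. x $ k * partial k f x)"
  by (simp add: eul_def dirv_def)

lemma open_punct [simp]: "open punct"
  by (auto simp: punct_def hyp_space_def)

lemma punct_D: "x \<in> punct \<Longrightarrow> x \<noteq> 0" "x \<in> punct \<Longrightarrow> norm x < 1" "x \<in> punct \<Longrightarrow> norm x > 0"
  by (auto simp: punct_def hyp_space_def)

lemma zero_notin_punct [simp]: "0 \<notin> punct"
  by (simp add: punct_def)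

lemma norm_square_less_1: "x \<in> punct \<Longrightarrow> (norm x)\<^sup>2 < 1"
  using punct_D[of x] by (simp add: abs_square_less_1)

abbreviation "sm \<equiv> smooth_on punct"
abbreviation "csm \<equiv> csmooth_on punct"

lemmas sm_add = smooth_on_add[OF open_punct]
  and sm_mult = smooth_on_mult[OF open_punct]
  and sm_diff = smooth_on_diff[OF open_punct]
  and sm_power = smooth_on_power[OF open_punct]
  and sm_divide = smooth_on_divide[OF open_punct]
  and sm_inverse = smooth_on_inverse[OF open_punct]
  and sm_sum = smooth_on_sum[OF open_punct]
  and csm_add = csmooth_on_add[OF open_punct]
  and csm_diff = csmooth_on_diff[OF open_punct]
  and csm_mult_left = csmooth_on_mult_left[OF open_punct]
  and csm_mult_right = csmooth_on_mult_right[OF open_punct]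
  and csm_sum_finite = csmooth_on_sum[OF open_punct]
  and csm_partial = csmooth_on_partial[OF open_punct]
  and csm_power = csmooth_on_power[OF open_punct]
  and csm_divide = csmooth_on_divide[OF open_punct]

lemma sm_differentiable: "sm f \<Longrightarrow> x \<in> punct \<Longrightarrow> f differentiable at x"
  by (rule smooth_on_differentiable)

lemma sm_omega: "sm (omega i)"
  unfolding omega_def[abs_def] by (rule sm_divide[OF smooth_on_coord smooth_on_norm[OF open_punct zero_notin_punct]])
    (auto simp: punct_D)

lemma sm_eul: "sm f \<Longrightarrow> sm (eul f)"
  unfolding eul_eq[abs_def]
  by (rule sm_sum[OF finite], rule sm_mult[OF smooth_on_coord smooth_on_partial])

lemma sm_ang: "sm f \<Longrightarrow> sm (ang i f)"
  unfolding ang_eq[abs_def]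
  by (rule sm_diff[OF sm_mult[OF smooth_on_norm[OF open_punct zero_notin_punct] smooth_on_partial]
        sm_mult[OF sm_omega sm_eul]])

lemma csm_eul: "csm f \<Longrightarrow> csm (eul f)"
  unfolding eul_eq[abs_def]
  by (rule csm_sum_finite[OF finite],
      rule csm_mult_left[OF smooth_on_coord csm_partial])

lemma csm_ang: "csm f \<Longrightarrow> csm (ang i f)"
  unfolding ang_eq[abs_def]
  by (rule csm_diff[OF csm_mult_left[OF smooth_on_norm[OF open_punct zero_notin_punct] csm_partial]
        csm_mult_left[OF sm_omega csm_eul]])

lemma eul_add: "sm f \<Longrightarrow> sm g \<Longrightarrow> x \<in> punct \<Longrightarrow> eul (\<lambda>x. f x + g x) x = eul f x + eul g x"
  by (simp add: eul_def dirv_add sm_differentiable)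

lemma eul_mult: "sm f \<Longrightarrow> sm g \<Longrightarrow> x \<in> punct \<Longrightarrow> eul (\<lambda>x. f x * g x) x = eul f x * g x + f x * eul g x"
  by (simp add: eul_def dirv_mult sm_differentiable)

lemma eul_const: "eul (\<lambda>x. c) x = 0"
  by (simp add: eul_def dirv_const)

lemma eul_comp: "sm f \<Longrightarrow> x \<in> punct \<Longrightarrow> (h has_real_derivative h') (at (f x)) \<Longrightarrow>
    eul (\<lambda>x. h (f x)) x = h' * eul f x"
  by (simp add: eul_def dirv_comp sm_differentiable)

lemma eul_cong: "x \<in> punct \<Longrightarrow> (\<And>y. y \<in> punct \<Longrightarrow> f y = g y) \<Longrightarrow> eul f x = eul g x"
  unfolding eul_def by (rule dirv_cong[OF open_punct])

lemma ang_add: "sm f \<Longrightarrow> sm g \<Longrightarrow> x \<in> punct \<Longrightarrow> ang i (\<lambda>x. f x + g x) x = ang i f x + ang i g x"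
  by (simp add: ang_def dirv_add sm_differentiable)

lemma ang_mult: "sm f \<Longrightarrow> sm g \<Longrightarrow> x \<in> punct \<Longrightarrow> ang i (\<lambda>x. f x * g x) x = ang i f x * g x + f x * ang i g x"
  by (simp add: ang_def dirv_mult sm_differentiable)

lemma ang_const: "ang i (\<lambda>x. c) x = 0"
  by (simp add: ang_def dirv_const)

lemma ang_comp: "sm f \<Longrightarrow> x \<in> punct \<Longrightarrow> (h has_real_derivative h') (at (f x)) \<Longrightarrow>
    ang i (\<lambda>x. h (f x)) x = h' * ang i f x"
  by (simp add: ang_def dirv_comp sm_differentiable)

lemma ang_cong: "x \<in> punct \<Longrightarrow> (\<And>y. y \<in> punct \<Longrightarrow> f y = g y) \<Longrightarrow> ang i f x = ang i g x"
  unfolding ang_def by (rule dirv_cong[OF open_punct])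

lemma ang_sum: "finite I \<Longrightarrow> (\<And>i. i \<in> I \<Longrightarrow> sm (f i)) \<Longrightarrow> x \<in> punct \<Longrightarrow>
    ang j (\<lambda>x. \<Sum>i\<in>I. f i x) x = (\<Sum>i\<in>I. ang j (f i) x)"
  by (induction I rule: finite_induct) (simp_all add: ang_const ang_add smooth_on_sum)

lemma sm_norm: "sm norm"
  by (rule smooth_on_norm[OF open_punct zero_notin_punct])

lemma eul_norm: "x \<in> punct \<Longrightarrow> eul norm x = norm x"
  by (simp add: eul_def dirv_norm punct_D power2_norm_eq_inner[symmetric] power2_eq_square)

lemma ang_norm: "x \<in> punct \<Longrightarrow> ang i norm x = 0"
  by (simp add: ang_def dirv_norm punct_D inner_diff_right inner_axis power2_norm_eq_inner[symmetric]
      power2_eq_square)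

lemma eul_coord: "eul (\<lambda>x. x $ i) x = x $ i"
  by (simp add: eul_def dirv_coord)

lemma ang_coord: "ang i (\<lambda>x. x $ j) x = norm x * (if i = j then 1 else 0) - omega i x * x $ j"
  by (simp add: ang_def omega_def dirv_coord axis_def)

lemma sm_inverse_norm: "sm (\<lambda>x. inverse (norm x))"
  by (rule sm_inverse[OF sm_norm]) (simp add: punct_D)

lemma eul_omega:
  assumes x: "x \<in> punct" shows "eul (omega i) x = 0"
proof -
  have "eul (\<lambda>x. inverse (norm x)) x = - inverse (norm x)"
    using eul_comp[OF sm_norm x DERIV_inverse] x by (simp add: eul_norm punct_D power2_eq_square)
  then show ?thesis
    unfolding omega_def[abs_def] divide_inverse by (simp add: eul_mult[OF smooth_on_coord sm_inverse_norm x] eul_coord)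
qed

lemma ang_omega:
  assumes x: "x \<in> punct"
  shows "ang i (omega j) x = (if i = j then 1 else 0) - omega i x * omega j x"
proof -
  have "ang i (\<lambda>x. inverse (norm x)) x = 0"
    using ang_comp[OF sm_norm x DERIV_inverse] x by (simp add: ang_norm punct_D)
  then show ?thesis
    using punct_D[OF x] unfolding omega_def[abs_def] divide_inverse
    by (simp only: ang_mult[OF smooth_on_coord sm_inverse_norm x] ang_coord) (simp add: algebra_simps omega_def divide_inverse)
qed

lemma sum_omega_sq: "x \<in> punct \<Longrightarrow> (\<Sum>i\<in>UNIV. omega i x * omega i x) = 1"
proof -
  assume x: "x \<in> punct"
  have "(\<Sum>i\<in>UNIV. omega i x * omega i x) = (x \<bullet> x) / (norm x)\<^sup>2"
    by (simp add: omega_def inner_vec_def sum_divide_distrib power2_eq_square)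
  then show ?thesis using x by (simp add: power2_norm_eq_inner[symmetric] punct_D)
qed

lemma sum_omega_partial: "x \<in> punct \<Longrightarrow> (\<Sum>i\<in>UNIV. omega i x * partial i f x) = eul f x / norm x"
  by (simp add: omega_def eul_eq sum_divide_distrib)

lemma sum_omega_ang: "x \<in> punct \<Longrightarrow> (\<Sum>i\<in>UNIV. omega i x * ang i f x) = 0"
proof -
  assume x: "x \<in> punct"
  have "(\<Sum>i\<in>UNIV. omega i x * ang i f x) =
      norm x * (\<Sum>i\<in>UNIV. omega i x * partial i f x) -
      (\<Sum>i\<in>UNIV. omega i x * omega i x) * eul f x"
    unfolding ang_eq sum_distrib_left sum_distrib_right sum_subtractf[symmetric]
    by (rule sum.cong) (simp_all add: algebra_simps)
  also have "\<dots> = 0"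
    using x by (simp add: sum_omega_sq sum_omega_partial punct_D)
  finally show ?thesis .
qed

text \<open>Pythagoras for the splitting of the gradient into radial and tangential parts, polarised
  because the weak form of the Laplacian pairs two different functions.\<close>

lemma sum_ang_ang:
  assumes x: "x \<in> punct"
  shows "(\<Sum>i\<in>UNIV. ang i f x * ang i g x) =
    (norm x)\<^sup>2 * (\<Sum>i\<in>UNIV. partial i f x * partial i g x) - eul f x * eul g x"
proof -
  have "(\<Sum>i\<in>UNIV. ang i f x * ang i g x) = norm x * (\<Sum>i\<in>UNIV. partial i f x * ang i g x)
      - eul f x * (\<Sum>i\<in>UNIV. omega i x * ang i g x)"
    unfolding sum_distrib_left sum_subtractf[symmetric]
    by (rule sum.cong) (simp_all add: ang_eq[of _ f] algebra_simps)
  also have "(\<Sum>i\<in>UNIV. partial i f x * ang i g x) = norm x * (\<Sum>i\<in>UNIV. partial i f x * partial i g x)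
      - (\<Sum>i\<in>UNIV. omega i x * partial i f x) * eul g x"
    unfolding sum_distrib_left sum_distrib_right sum_subtractf[symmetric]
    by (rule sum.cong) (simp_all add: ang_eq[of _ g] algebra_simps)
  finally show ?thesis
    using punct_D[OF x] by (simp add: sum_omega_ang[OF x] sum_omega_partial[OF x] algebra_simps power2_eq_square)
qed

lemma partial_eul:
  assumes f: "sm f" and x: "x \<in> punct"
  shows "partial i (eul f) x = partial i f x + eul (partial i f) x"
proof -
  have "partial i (eul f) x = dirv (axis i 1) (\<lambda>x. \<Sum>k\<in>UNIV. x $ k * partial k f x) x"
    by (simp add: dirv_axis eul_eq[abs_def])
  also have "\<dots> = (\<Sum>k\<in>UNIV. dirv (axis i 1) (\<lambda>x. x $ k * partial k f x) x)"
  proof -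
    have "dirv v (\<lambda>x. \<Sum>k\<in>I. g k x) x = (\<Sum>k\<in>I. dirv v (g k) x)"
      if "finite I" "\<And>k. g k differentiable at x" for I and g :: "'a \<Rightarrow> _" and v
      using that(1) by (induction I rule: finite_induct) (simp_all add: dirv_const dirv_add that(2))
    then show ?thesis
      using sm_differentiable[OF sm_mult[OF smooth_on_coord smooth_on_partial[OF f]] x] by simp
  qed
  also have "\<dots> = (\<Sum>k\<in>UNIV. axis i 1 $ k * partial k f x + x $ k * partial k (partial i f) x)"
  proof (rule sum.cong)
    fix k
    have "dirv (axis i 1) (\<lambda>x. x $ k * partial k f x) x = axis i 1 $ k * partial k f x + x $ k * partial i (partial k f) x"
      using dirv_mult[OF sm_differentiable[OF smooth_on_coord x] sm_differentiable[OF smooth_on_partial[OF f] x], of "axis i 1" k k]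
      by (simp add: dirv_coord dirv_axis)
    then show "dirv (axis i 1) (\<lambda>x. x $ k * partial k f x) x = axis i 1 $ k * partial k f x + x $ k * partial k (partial i f) x"
      using partial_commute[OF open_punct f x, of i k] by simp
  qed simp
  also have "\<dots> = partial i f x + eul (partial i f) x"
    by (simp add: sum.distrib sum_axis eul_eq)
  finally show ?thesis .
qed

text \<open>\<open>eul\<close> generates the dilations, under which the tangential fields are
  invariant. In coordinates, the term \<open>partial i f\<close> from \<open>partial_eul\<close> is
  matched by the one from \<open>eul_norm\<close>.\<close>

lemma eul_ang:
  assumes f: "sm f" and x: "x \<in> punct"
  shows "eul (ang i f) x = ang i (eul f) x"
proof -
  note sp = smooth_on_partial[OF f, of i]
  have "eul (ang i f) x = eul (\<lambda>x. norm x * partial i f x + (- 1) * (omega i x * eul f x)) x"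
    by (rule arg_cong[of _ _ "\<lambda>h. eul h x"]) (simp add: ang_eq fun_eq_iff)
  also have "\<dots> = norm x * partial i f x + norm x * eul (partial i f) x - omega i x * eul (eul f) x"
    using x
    by (simp only: eul_add[OF sm_mult[OF sm_norm sp] sm_mult[OF smooth_on_const
          sm_mult[OF sm_omega sm_eul[OF f]]] x]
        eul_mult[OF smooth_on_const sm_mult[OF sm_omega sm_eul[OF f]] x]
        eul_mult[OF sm_norm sp x] eul_mult[OF sm_omega sm_eul[OF f] x] eul_norm eul_omega eul_const) simp
  also have "\<dots> = ang i (eul f) x"
    by (simp add: ang_eq[of i "eul f"] partial_eul[OF f x] algebra_simps)
  finally show ?thesis .
qed

lemma ang_ang:
  assumes f: "sm f" and x: "x \<in> punct"
  shows "ang i (ang j f) x = (norm x)\<^sup>2 * partial i (partial j f) x - x $ i * eul (partial j f) x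
    - x $ j * eul (partial i f) x - x $ j * partial i f x
    - ((if i = j then 1 else 0) - omega i x * omega j x) * eul f x
    + omega i x * omega j x * eul (eul f) x"
proof -
  note sp = smooth_on_partial[OF f, of j]
  have "ang i (ang j f) x = ang i (\<lambda>x. norm x * partial j f x + (- 1) * (omega j x * eul f x)) x"
    by (rule arg_cong[of _ _ "\<lambda>h. ang i h x"]) (simp add: ang_eq fun_eq_iff)
  also have "\<dots> = norm x * ang i (partial j f) x
     - ((if i = j then 1 else 0) - omega i x * omega j x) * eul f x - omega j x * ang i (eul f) x"
    using x
    by (simp only: ang_add[OF sm_mult[OF sm_norm sp] sm_mult[OF smooth_on_const
          sm_mult[OF sm_omega sm_eul[OF f]]] x]
        ang_mult[OF smooth_on_const sm_mult[OF sm_omega sm_eul[OF f]] x]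
        ang_mult[OF sm_norm sp x] ang_mult[OF sm_omega sm_eul[OF f] x] ang_norm ang_omega ang_const) simp
  also have "norm x * ang i (partial j f) x = (norm x)\<^sup>2 * partial i (partial j f) x - x $ i * eul (partial j f) x"
    using punct_D[OF x] by (simp add: ang_eq right_diff_distrib power2_eq_square norm_omega mult.assoc[symmetric])
  also have "omega j x * ang i (eul f) x =
      x $ j * eul (partial i f) x + x $ j * partial i f x - omega i x * omega j x * eul (eul f) x"
    using punct_D[OF x] by (simp add: ang_eq partial_eul[OF f x] right_diff_distrib distrib_left norm_omega'')
  finally show ?thesis by simp
qed

text \<open>In \<open>ang_ang\<close> only the term \<open>x $ j * partial i f x\<close> is not
  symmetric in i and j. In its antisymmetric part the radial contributions of \<open>ang_eq\<close>
  cancel, and only first-order tangential terms remain.\<close>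

lemma ang_commutator:
  assumes f: "sm f" and x: "x \<in> punct"
  shows "ang i (ang j f) x - ang j (ang i f) x = omega i x * ang j f x - omega j x * ang i f x"
  unfolding ang_ang[OF f x] partial_commute[OF open_punct f x, of j i]
  using punct_D[OF x] by (auto simp: ang_eq algebra_simps norm_omega norm_omega')

text \<open>The measure \<open>|x|\<^sup>-\<^sup>N dx\<close> is invariant under dilations, so \<open>eul\<close> is skew-adjoint for it.\<close>

definition mint :: "(real ^ 'n \<Rightarrow> real) \<Rightarrow> real"
  where "mint f = (LINT x:punct|lborel. f x / norm x ^ CARD('n))"

lemma sm_inverse_norm_power: "sm (\<lambda>x. inverse (norm x ^ n))"
  by (rule sm_inverse[OF sm_power[OF sm_norm]]) (simp add: punct_D)

lemma mint_integrable:
  fixes f :: "real ^ 'n \<Rightarrow> real"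
  assumes "csm f" shows "set_integrable lborel punct (\<lambda>x. f x / norm x ^ CARD('n))"
  unfolding divide_inverse
  by (rule csmooth_on_integrable[OF csm_mult_right[OF assms sm_inverse_norm_power]])

lemma mint_add: "csm f \<Longrightarrow> csm g \<Longrightarrow> mint (\<lambda>x. f x + g x) = mint f + mint g"
  unfolding mint_def add_divide_distrib by (rule set_integral_add(2)[OF mint_integrable mint_integrable])

lemma mint_diff: "csm f \<Longrightarrow> csm g \<Longrightarrow> mint (\<lambda>x. f x - g x) = mint f - mint g"
  unfolding mint_def diff_divide_distrib by (rule set_integral_diff(2)[OF mint_integrable mint_integrable])

lemma mint_cmult: "mint (\<lambda>x. c * f x) = c * mint f"
  unfolding mint_def by (simp flip: times_divide_eq_right)

lemma mint_cong: "(\<And>x. x \<in> punct \<Longrightarrow> f x = g x) \<Longrightarrow> mint f = mint g"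
  unfolding mint_def by (rule set_lebesgue_integral_cong) (auto simp: borel_open)

lemma mint_zero [simp]: "mint (\<lambda>x. 0) = 0"
  by (simp add: mint_def)

lemma mint_sum:
  assumes "finite I" "\<And>i. i \<in> I \<Longrightarrow> csm (f i)"
  shows "mint (\<lambda>x. \<Sum>i\<in>I. f i x) = (\<Sum>i\<in>I. mint (f i))"
  using assms
proof (induction I rule: finite_induct)
  case (insert j I)
  then show ?case
    using mint_add[of "f j" "\<lambda>x. \<Sum>i\<in>I. f i x"] csmooth_on_sum[OF open_punct, of I f] by simp
qed simp

lemma mint_nonneg: "(\<And>x. x \<in> punct \<Longrightarrow> f x \<ge> 0) \<Longrightarrow> mint f \<ge> 0"
  unfolding mint_def set_lebesgue_integral_def
  by (rule Bochner_Integration.integral_nonneg) (auto simp: indicator_def)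

lemma mint_mono:
  assumes "csm f" "csm g" "\<And>x. x \<in> punct \<Longrightarrow> f x \<le> g x" shows "mint f \<le> mint g"
  using mint_nonneg[of "\<lambda>x. g x - f x"] mint_diff[OF assms(2,1)] assms(3) by simp

lemma DERIV_inverse_power:
  fixes t :: real assumes "t \<noteq> 0"
  shows "((\<lambda>t. inverse (t ^ n)) has_real_derivative - (real n * inverse (t ^ n) * inverse t)) (at t)"
proof (cases n)
  case (Suc m)
  show ?thesis
    unfolding Suc
    by (rule DERIV_cong[OF DERIV_inverse_fun[OF DERIV_power[OF DERIV_ident]]])
      (use assms in \<open>simp_all add: field_simps\<close>)
qed simp

text \<open>The vanishing integral is applied to \<open>f\<close> divided by the power N - 1 of the
  norm: differentiating that weight produces both the missing power and the factor N - 1.\<close>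

lemma mint_partial:
  fixes f :: "real ^ 'n \<Rightarrow> real"
  assumes f: "csm f"
  shows "mint (\<lambda>x. norm x * partial i f x) = (real CARD('n) - 1) * mint (\<lambda>x. omega i x * f x)"
proof -
  define n where "n = CARD('n) - 1"
  have n: "CARD('n) = Suc n" by (simp add: n_def)
  have "0 = (LINT x:punct|lborel. partial i (\<lambda>x. f x * inverse (norm x ^ n)) x)"
    using integral_partial_eq_0[OF open_punct csm_mult_right[OF f sm_inverse_norm_power[of n]]] by simp
  also have "\<dots> = (LINT x:punct|lborel. (norm x * partial i f x - real n * (omega i x * f x)) / norm x ^ CARD('n))"
  proof (rule set_lebesgue_integral_cong)
    show "\<forall>x. x \<in> punct \<longrightarrow> partial i (\<lambda>x. f x * inverse (norm x ^ n)) x =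
        (norm x * partial i f x - real n * (omega i x * f x)) / norm x ^ CARD('n)"
    proof (intro allI impI)
      fix x :: "real ^ 'n" assume x: "x \<in> punct"
      note x0 = punct_D(1)[OF x]
      have "partial i norm x = omega i x"
        using dirv_norm[OF x0, of "axis i 1"] by (simp add: dirv_axis inner_axis omega_def)
      then have pn: "partial i (\<lambda>x. inverse (norm x ^ n)) x = - (real n * inverse (norm x ^ n) * inverse (norm x)) * omega i x"
        using partial_comp[OF differentiable_norm_at[OF x0] DERIV_inverse_power[of "norm x" n], of i] x0 by simp
      then show "partial i (\<lambda>x. f x * inverse (norm x ^ n)) x =
          (norm x * partial i f x - real n * (omega i x * f x)) / norm x ^ CARD('n)"
        using partial_mult[OF sm_differentiable[OF csmooth_on_smooth[OF f] x]
            sm_differentiable[OF sm_inverse_norm_power x], of i n] x0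
        unfolding pn by (simp add: n field_simps)
    qed
  qed (simp add: borel_open)
  also have "\<dots> = mint (\<lambda>x. norm x * partial i f x - real n * (omega i x * f x))"
    by (simp add: mint_def)
  also have "\<dots> = mint (\<lambda>x. norm x * partial i f x) - real n * mint (\<lambda>x. omega i x * f x)"
    using mint_diff[OF csm_mult_left[OF sm_norm csm_partial[OF f]]
        csm_mult_left[OF smooth_on_const csm_mult_left[OF sm_omega f]], of i "real n" i]
    by (simp add: mint_cmult)
  finally show ?thesis by (simp add: n_def of_nat_diff)
qed

text \<open>Summing \<open>mint_partial\<close> over the products of \<open>f\<close> with
  \<open>omega k\<close> gives N - 1 times the integral of \<open>f\<close> on one side, and the
  same plus the integral of \<open>eul f\<close> on the other.\<close>

lemma mint_eul:
  fixes f :: "real ^ 'n \<Rightarrow> real"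
  assumes f: "csm f" shows "mint (eul f) = 0"
proof -
  have cf: "csm (\<lambda>x. omega k x * f x)" for k
    by (rule csm_mult_left[OF sm_omega f])
  have "(real CARD('n) - 1) * (\<Sum>k\<in>UNIV. mint (\<lambda>x. omega k x * (omega k x * f x))) =
      (\<Sum>k\<in>UNIV. mint (\<lambda>x. norm x * partial k (\<lambda>x. omega k x * f x) x))"
    unfolding sum_distrib_left by (simp add: mint_partial[OF cf])
  also have "\<dots> = mint (\<lambda>x. \<Sum>k\<in>UNIV. norm x * partial k (\<lambda>x. omega k x * f x) x)"
    by (rule mint_sum[symmetric]) (simp_all add: csm_mult_left[OF sm_norm csm_partial[OF cf]])
  also have "\<dots> = mint (\<lambda>x. eul f x + (real CARD('n) - 1) * f x)"
  proof (rule mint_cong)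
    fix x :: "real ^ 'n" assume x: "x \<in> punct"
    have "norm x * partial k (\<lambda>x. omega k x * f x) x = x $ k * partial k f x + f x - omega k x * omega k x * f x" for k
    proof -
      have "norm x * partial k (omega k) x = 1 - omega k x * omega k x"
        using ang_omega[OF x, of k k] by (simp add: ang_eq[of k "omega k"] eul_omega[OF x])
      moreover have "partial k (\<lambda>x. omega k x * f x) x = partial k (omega k) x * f x + omega k x * partial k f x"
        by (rule partial_mult[OF sm_differentiable[OF sm_omega x] sm_differentiable[OF csmooth_on_smooth[OF f] x]])
      ultimately show ?thesis using punct_D(1)[OF x]
        by (simp add: distrib_left mult.assoc[symmetric] left_diff_distrib norm_omega)
    qed
    then have "(\<Sum>k\<in>UNIV. norm x * partial k (\<lambda>x. omega k x * f x) x) =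
        eul f x + real CARD('n) * f x - (\<Sum>k\<in>UNIV. omega k x * omega k x) * f x"
      by (simp only: sum.distrib sum_subtractf eul_eq sum_distrib_right) simp
    then show "(\<Sum>k\<in>UNIV. norm x * partial k (\<lambda>x. omega k x * f x) x) = eul f x + (real CARD('n) - 1) * f x"
      by (simp only: sum_omega_sq[OF x]) (simp add: algebra_simps)
  qed
  also have "\<dots> = mint (eul f) + (real CARD('n) - 1) * mint f"
    using mint_add[OF csm_eul[OF f] csm_mult_left[OF smooth_on_const f]] by (simp add: mint_cmult)
  also have "(\<Sum>k\<in>UNIV. mint (\<lambda>x. omega k x * (omega k x * f x))) =
      mint (\<lambda>x. \<Sum>k\<in>UNIV. omega k x * (omega k x * f x))"
    by (rule mint_sum[symmetric]) (simp_all only: finite csm_mult_left[OF sm_omega cf])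
  also have "\<dots> = mint f"
    by (rule mint_cong) (simp only: mult.assoc[symmetric] sum_distrib_right[symmetric] sum_omega_sq mult_1)
  finally show ?thesis by simp
qed

text \<open>The right-hand side is a divergence term: on the unit sphere the field is the gradient
  of the coordinate \<open>omega i\<close>, whose spherical Laplacian is -(N - 1) times
  itself.\<close>

lemma mint_ang:
  fixes f :: "real ^ 'n \<Rightarrow> real"
  assumes f: "csm f" shows "mint (ang i f) = (real CARD('n) - 1) * mint (\<lambda>x. omega i x * f x)"
proof -
  have cf: "csm (\<lambda>x. omega i x * f x)"
    by (rule csm_mult_left[OF sm_omega f])
  have "mint (\<lambda>x. omega i x * eul f x) = mint (eul (\<lambda>x. omega i x * f x))"
    by (rule mint_cong) (simp add: eul_mult[OF sm_omega csmooth_on_smooth[OF f]] eul_omega)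
  then have 0: "mint (\<lambda>x. omega i x * eul f x) = 0"
    using mint_eul[OF cf] by simp
  have "mint (ang i f) = mint (\<lambda>x. norm x * partial i f x) - mint (\<lambda>x. omega i x * eul f x)"
    unfolding ang_eq[abs_def]
    by (rule mint_diff[OF csm_mult_left[OF sm_norm csm_partial[OF f]]
          csm_mult_left[OF sm_omega csm_eul[OF f]]])
  then show ?thesis using mint_partial[OF f] 0 by simp
qed

section \<open>The spectral gap of the sphere\<close>

lemma ang_diff: "sm f \<Longrightarrow> sm g \<Longrightarrow> x \<in> punct \<Longrightarrow> ang i (\<lambda>x. f x - g x) x = ang i f x - ang i g x"
  using ang_add[OF _ sm_mult[OF smooth_on_const], of f g x i "-1"]
    ang_mult[OF smooth_on_const, of g x i "-1"] by (simp add: ang_const)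

text \<open>The zero-order terms of \<open>mint_ang\<close> add up over i to a multiple of the sum
  of \<open>omega i x * ang i a x\<close>, which vanishes. A weight annihilated by the tangential
  fields passes through unchanged.\<close>

lemma ang_green:
  fixes a b :: "real ^ 'n \<Rightarrow> real"
  assumes w: "sm w" "\<And>i x. x \<in> punct \<Longrightarrow> ang i w x = 0" and a: "csm a" and b: "sm b"
  shows "mint (\<lambda>x. w x * ((\<Sum>i\<in>UNIV. ang i (ang i a) x) * b x)) =
    - (\<Sum>i\<in>UNIV. mint (\<lambda>x. w x * (ang i a x * ang i b x)))"
proof -
  have sa: "sm a" by (rule csmooth_on_smooth[OF a])
  have cda: "csm (ang i a)" for i by (rule csm_ang[OF a])
  have sda: "sm (ang i a)" for i by (rule sm_ang[OF sa])
  have c1: "csm (\<lambda>x. ang i a x * b x)" for i by (rule csm_mult_right[OF cda b])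
  have c2: "csm (\<lambda>x. w x * (ang i a x * b x))" for i by (rule csm_mult_left[OF w(1) c1])
  have c3: "csm (\<lambda>x. w x * (ang i (ang i a) x * b x))" for i
    by (rule csm_mult_left[OF w(1) csm_mult_right[OF csm_ang[OF cda] b]])
  have c4: "csm (\<lambda>x. w x * (ang i a x * ang i b x))" for i
    by (rule csm_mult_left[OF w(1) csm_mult_right[OF cda sm_ang[OF b]]])
  have c5: "csm (\<lambda>x. omega i x * (w x * (ang i a x * b x)))" for i
    by (rule csm_mult_left[OF sm_omega c2])
  have e: "mint (\<lambda>x. w x * (ang i (ang i a) x * b x)) + mint (\<lambda>x. w x * (ang i a x * ang i b x)) =
      (real CARD('n) - 1) * mint (\<lambda>x. omega i x * (w x * (ang i a x * b x)))" for i
  proof -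
    have "mint (\<lambda>x. w x * (ang i (ang i a) x * b x)) + mint (\<lambda>x. w x * (ang i a x * ang i b x)) =
        mint (\<lambda>x. w x * (ang i (ang i a) x * b x) + w x * (ang i a x * ang i b x))"
      by (rule mint_add[OF c3 c4, symmetric])
    also have "\<dots> = mint (ang i (\<lambda>x. w x * (ang i a x * b x)))"
      by (rule mint_cong)
        (simp add: ang_mult[OF w(1) csmooth_on_smooth[OF c1]] ang_mult[OF sda b] w(2) distrib_left)
    finally show ?thesis using mint_ang[OF c2, of i] by simp
  qed
  have "mint (\<lambda>x. w x * ((\<Sum>i\<in>UNIV. ang i (ang i a) x) * b x)) =
      mint (\<lambda>x. \<Sum>i\<in>UNIV. w x * (ang i (ang i a) x * b x))"
    by (rule mint_cong) (simp add: sum_distrib_left sum_distrib_right)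
  also have "\<dots> = (\<Sum>i\<in>UNIV. mint (\<lambda>x. w x * (ang i (ang i a) x * b x)))"
    by (rule mint_sum[OF finite c3])
  also have "\<dots> = (\<Sum>i\<in>UNIV. (real CARD('n) - 1) * mint (\<lambda>x. omega i x * (w x * (ang i a x * b x)))
      - mint (\<lambda>x. w x * (ang i a x * ang i b x)))"
    by (rule sum.cong) (use e in \<open>auto simp: algebra_simps\<close>)
  also have "\<dots> = (real CARD('n) - 1) * mint (\<lambda>x. \<Sum>i\<in>UNIV. omega i x * (w x * (ang i a x * b x)))
      - (\<Sum>i\<in>UNIV. mint (\<lambda>x. w x * (ang i a x * ang i b x)))"
    unfolding mint_sum[OF finite c5] by (simp add: sum_subtractf sum_distrib_left)
  also have "mint (\<lambda>x. \<Sum>i\<in>UNIV. omega i x * (w x * (ang i a x * b x))) = mint (\<lambda>x :: real ^ 'n. 0)"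
  proof (rule mint_cong)
    fix x :: "real ^ 'n" assume "x \<in> punct"
    have "(\<Sum>i\<in>UNIV. omega i x * (w x * (ang i a x * b x))) = (\<Sum>i\<in>UNIV. omega i x * ang i a x) * (w x * b x)"
      unfolding sum_distrib_right by (rule sum.cong) (simp_all add: algebra_simps)
    then show "(\<Sum>i\<in>UNIV. omega i x * (w x * (ang i a x * b x))) = 0"
      by (simp add: sum_omega_ang[OF \<open>x \<in> punct\<close>])
  qed
  finally show ?thesis by simp
qed

text \<open>Obtained by differentiating the relation \<open>sum_omega_ang\<close> tangentially. It
  says that \<open>ang i (ang j f)\<close> has a normal component in the index j.\<close>

lemma sum_omega_ang_ang:
  assumes f: "sm f" and x: "x \<in> punct"
  shows "(\<Sum>j\<in>UNIV. omega j x * ang i (ang j f) x) = - ang i f x"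
proof -
  have "0 = ang i (\<lambda>x. \<Sum>j\<in>UNIV. omega j x * ang j f x) x"
    using ang_cong[OF x, of "\<lambda>x. \<Sum>j\<in>UNIV. omega j x * ang j f x" "\<lambda>x. 0" i] sum_omega_ang[of _ f]
    by (simp add: ang_const)
  also have "\<dots> = (\<Sum>j\<in>UNIV. ang i (\<lambda>x. omega j x * ang j f x) x)"
    by (rule ang_sum[OF finite sm_mult[OF sm_omega sm_ang[OF f]] x])
  also have "\<dots> = (\<Sum>j\<in>UNIV. (if i = j then ang j f x else 0) - omega i x * (omega j x * ang j f x) + omega j x * ang i (ang j f) x)"
    by (rule sum.cong) (simp_all add: ang_mult[OF sm_omega sm_ang[OF f] x] ang_omega[OF x] left_diff_distrib)
  also have "\<dots> = ang i f x - omega i x * (\<Sum>j\<in>UNIV. omega j x * ang j f x) + (\<Sum>j\<in>UNIV. omega j x * ang i (ang j f) x)"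
    by (simp add: sum.distrib sum_subtractf sum_distrib_left)
  finally show ?thesis by (simp add: sum_omega_ang[OF x])
qed

text \<open>A form of Bochner's formula. The constant is N - 3 and not the Ricci constant N - 2,
  because the squares of all \<open>ang i (ang j f)\<close> exceed the squared spherical Hessian by
  the squared gradient. The last term is normal and disappears when paired with
  \<open>ang i f\<close>.\<close>

lemma ang_laplacian_commutator:
  fixes f :: "real ^ 'n \<Rightarrow> real"
  assumes f: "sm f" and x: "x \<in> punct"
  shows "(\<Sum>j\<in>UNIV. ang j (ang j (ang i f)) x) - ang i (\<lambda>x. \<Sum>j\<in>UNIV. ang j (ang j f) x) x =
    (real CARD('n) - 3) * ang i f x - 2 * omega i x * (\<Sum>j\<in>UNIV. ang j (ang j f) x)"
proof -
  note d = sm_ang[OF f] and dd = sm_ang[OF sm_ang[OF f]]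
  have o: "sm (\<lambda>x. omega i x * ang j f x)" for i j by (rule sm_mult[OF sm_omega d])
  have each: "ang j (ang j (ang i f)) x - ang i (ang j (ang j f)) x =
     omega j x * ang i (ang j f) x - 2 * omega i x * ang j (ang j f) x + ang i f x
     - (omega j x * omega j x) * ang i f x
     + omega j x * ang j (ang i f) x - (if i = j then ang j f x else 0) + omega i x * (omega j x * ang j f x)" for j
  proof -
    \<comment> \<open>\<open>ang i\<close> is moved to the front past the two factors
      \<open>ang j\<close>, one commutator at a time.\<close>
    have "ang j (ang j (ang i f)) x =
        ang j (\<lambda>x. ang i (ang j f) x + (omega j x * ang i f x - omega i x * ang j f x)) x"
      by (rule ang_cong[OF x]) (use ang_commutator[OF f, of _ j i] in \<open>simp add: algebra_simps\<close>)
    also have "\<dots> = ang j (ang i (ang j f)) x + (omega j x * ang j (ang i f) x + (1 - omega j x * omega j x) * ang i f x)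
        - (omega i x * ang j (ang j f) x + ((if i = j then 1 else 0) - omega j x * omega i x) * ang j f x)"
      by (simp add: ang_add[OF dd sm_diff[OF o o] x] ang_diff[OF o o x]
          ang_mult[OF sm_omega d x] ang_omega[OF x] ang_const)
    also have "ang j (ang i (ang j f)) x = ang i (ang j (ang j f)) x + omega j x * ang i (ang j f) x - omega i x * ang j (ang j f) x"
      using ang_commutator[OF d[of j] x, of j i] by simp
    finally show ?thesis by (cases "i = j") (simp_all add: algebra_simps)
  qed
  have "(\<Sum>j\<in>UNIV. ang j (ang j (ang i f)) x) - ang i (\<lambda>x. \<Sum>j\<in>UNIV. ang j (ang j f) x) x =
      (\<Sum>j\<in>UNIV. ang j (ang j (ang i f)) x - ang i (ang j (ang j f)) x)"
    by (simp add: ang_sum[OF finite dd x] sum_subtractf)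
  also have "\<dots> = (\<Sum>j\<in>UNIV. omega j x * ang i (ang j f) x) - 2 * omega i x * (\<Sum>j\<in>UNIV. ang j (ang j f) x)
     + real CARD('n) * ang i f x - (\<Sum>j\<in>UNIV. omega j x * omega j x) * ang i f x
     + (\<Sum>j\<in>UNIV. omega j x * ang j (ang i f) x) - ang i f x + omega i x * (\<Sum>j\<in>UNIV. omega j x * ang j f x)"
    by (simp add: each sum.distrib sum_subtractf sum_distrib_left sum_distrib_right)
  also have "\<dots> = (real CARD('n) - 3) * ang i f x - 2 * omega i x * (\<Sum>j\<in>UNIV. ang j (ang j f) x)"
    by (simp add: sum_omega_ang_ang[OF f x] sum_omega_sq[OF x] sum_omega_ang[OF x] algebra_simps)
  finally show ?thesis .
qed

text \<open>Cauchy--Schwarz for the spherical Hessian against the tangential projection, whose squared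
  norm is \<open>N - 1\<close>.\<close>

lemma ang_laplacian_sq_le:
  fixes f :: "real ^ 'n \<Rightarrow> real"
  assumes f: "sm f" and x: "x \<in> punct"
  shows "(\<Sum>i\<in>UNIV. ang i (ang i f) x)\<^sup>2 \<le>
    (real CARD('n) - 1) * ((\<Sum>i\<in>UNIV. \<Sum>j\<in>UNIV. (ang i (ang j f) x)\<^sup>2) - (\<Sum>i\<in>UNIV. (ang i f x)\<^sup>2))"
proof -
  \<comment> \<open>Adding \<open>omega j x * ang i f x\<close> removes the normal component found
    in \<open>sum_omega_ang_ang\<close>, so \<open>H\<close> is the spherical Hessian and
    \<open>P\<close> the tangential projection.\<close>
  define H where "H i j = ang i (ang j f) x + omega j x * ang i f x" for i j
  define P where "P i j = (if i = j then 1 else 0) - omega i x * omega j x" for i j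
  have PH: "(\<Sum>i\<in>UNIV. \<Sum>j\<in>UNIV. P i j * H i j) = (\<Sum>i\<in>UNIV. ang i (ang i f) x)"
  proof -
    have oH: "(\<Sum>i\<in>UNIV. omega i x * H i j) = 0" for j
    proof -
      have "(\<Sum>i\<in>UNIV. omega i x * H i j) = (\<Sum>i\<in>UNIV. omega i x * ang i (ang j f) x) + omega j x * (\<Sum>i\<in>UNIV. omega i x * ang i f x)"
        by (simp add: H_def sum.distrib sum_distrib_left algebra_simps)
      then show ?thesis by (simp add: sum_omega_ang[OF x])
    qed
    have "(\<Sum>i\<in>UNIV. \<Sum>j\<in>UNIV. P i j * H i j) = (\<Sum>i\<in>UNIV. H i i) - (\<Sum>i\<in>UNIV. \<Sum>j\<in>UNIV. omega j x * (omega i x * H i j))"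
    proof -
      have "(\<Sum>j\<in>UNIV. P i j * H i j) = H i i - (\<Sum>j\<in>UNIV. omega j x * (omega i x * H i j))" for i
      proof -
        have "(\<Sum>j\<in>UNIV. P i j * H i j) = (\<Sum>j\<in>UNIV. (if i = j then H i j else 0) - omega j x * (omega i x * H i j))"
          by (rule sum.cong) (auto simp: P_def algebra_simps)
        then show ?thesis by (simp add: sum_subtractf)
      qed
      then show ?thesis by (simp add: sum_subtractf)
    qed
    also have "(\<Sum>i\<in>UNIV. \<Sum>j\<in>UNIV. omega j x * (omega i x * H i j)) = (\<Sum>j\<in>UNIV. omega j x * (\<Sum>i\<in>UNIV. omega i x * H i j))"
      by (subst sum.swap) (simp add: sum_distrib_left)
    also have "(\<Sum>i\<in>UNIV. H i i) = (\<Sum>i\<in>UNIV. ang i (ang i f) x) + (\<Sum>i\<in>UNIV. omega i x * ang i f x)"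
      by (simp add: H_def sum.distrib)
    finally show ?thesis by (simp add: oH sum_omega_ang[OF x])
  qed
  have PP: "(\<Sum>i\<in>UNIV. \<Sum>j\<in>UNIV. (P i j)\<^sup>2) = real CARD('n) - 1"
  proof -
    have "(\<Sum>j\<in>UNIV. (P i j)\<^sup>2) = 1 - omega i x * omega i x" for i
    proof -
      have "(\<Sum>j\<in>UNIV. (P i j)\<^sup>2) = (\<Sum>j\<in>UNIV. (if i = j then 1 - 2 * omega i x * omega j x else 0) +
          omega i x * omega i x * (omega j x * omega j x))"
        by (rule sum.cong) (auto simp: P_def power2_eq_square algebra_simps)
      also have "\<dots> = 1 - 2 * omega i x * omega i x + omega i x * omega i x * (\<Sum>j\<in>UNIV. omega j x * omega j x)"
        by (simp add: sum.distrib sum_distrib_left)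
      finally show ?thesis by (simp add: sum_omega_sq[OF x])
    qed
    then show ?thesis by (simp add: sum_subtractf sum_omega_sq[OF x])
  qed
  have HH: "(\<Sum>i\<in>UNIV. \<Sum>j\<in>UNIV. (H i j)\<^sup>2) = (\<Sum>i\<in>UNIV. \<Sum>j\<in>UNIV. (ang i (ang j f) x)\<^sup>2) - (\<Sum>i\<in>UNIV. (ang i f x)\<^sup>2)"
  proof -
    have "(\<Sum>j\<in>UNIV. (H i j)\<^sup>2) = (\<Sum>j\<in>UNIV. (ang i (ang j f) x)\<^sup>2) - (ang i f x)\<^sup>2" for i
    proof -
      have "(\<Sum>j\<in>UNIV. (H i j)\<^sup>2) = (\<Sum>j\<in>UNIV. (ang i (ang j f) x)\<^sup>2 + 2 * ang i f x * (omega j x * ang i (ang j f) x) +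
          (omega j x * omega j x) * (ang i f x)\<^sup>2)"
        by (rule sum.cong) (auto simp: H_def power2_eq_square algebra_simps)
      also have "\<dots> = (\<Sum>j\<in>UNIV. (ang i (ang j f) x)\<^sup>2) + 2 * ang i f x * (\<Sum>j\<in>UNIV. omega j x * ang i (ang j f) x) +
          (\<Sum>j\<in>UNIV. omega j x * omega j x) * (ang i f x)\<^sup>2"
        by (simp add: sum.distrib sum_distrib_left sum_distrib_right)
      finally show ?thesis by (simp add: sum_omega_sq[OF x] sum_omega_ang_ang[OF f x] power2_eq_square)
    qed
    then show ?thesis by (simp add: sum_subtractf)
  qed
  have "(\<Sum>(i, j)\<in>UNIV \<times> UNIV. P i j * H i j)\<^sup>2 \<le> (\<Sum>(i, j)\<in>UNIV \<times> UNIV. (P i j)\<^sup>2) * (\<Sum>(i, j)\<in>UNIV \<times> UNIV. (H i j)\<^sup>2)"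
    using Cauchy_Schwarz_ineq_sum[of "case_prod P" "case_prod H" "UNIV \<times> UNIV"] by (simp add: case_prod_beta)
  then show ?thesis
    by (simp only: sum.cartesian_product[symmetric] PH PP HH)
qed

text \<open>Lichnerowicz's argument. For the weighted integrals A of the squared Laplacian, B of the
  squared gradient and D of all squared second derivatives, Bochner gives A = D + (N - 3) B and
  Cauchy-Schwarz gives A <= (N - 1) (D - B). Eliminating D and cancelling N - 2 > 0 leaves the
  gap.\<close>

lemma ang_laplacian_spectral_gap:
  fixes f :: "real ^ 'n \<Rightarrow> real"
  assumes N: "CARD('n) \<ge> 3"
    and w: "sm w" "\<And>i x. x \<in> punct \<Longrightarrow> ang i w x = 0" "\<And>x. x \<in> punct \<Longrightarrow> w x \<ge> 0" and f: "csm f"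
  shows "(real CARD('n) - 1) * mint (\<lambda>x. w x * (\<Sum>i\<in>UNIV. (ang i f x)\<^sup>2)) \<le>
    mint (\<lambda>x. w x * (\<Sum>i\<in>UNIV. ang i (ang i f) x)\<^sup>2)"
proof -
  let ?N = "real CARD('n)"
  define L where "L g x = (\<Sum>i\<in>UNIV. ang i (ang i g) x)" for g and x :: "real ^ 'n"
  have sf: "sm f" by (rule csmooth_on_smooth[OF f])
  note d = csm_ang[OF f] and sd = sm_ang[OF sf]
  have cL: "csm (L g)" if "csm g" for g
    unfolding L_def[abs_def] by (rule csm_sum_finite[OF finite csm_ang[OF csm_ang[OF that]]])
  have sL: "sm (L f)" by (rule csmooth_on_smooth[OF cL[OF f]])
  have cw: "csm (\<lambda>x. w x * g x)" if "csm g" for g by (rule csm_mult_left[OF w(1) that])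
  have cm: "csm (\<lambda>x. g x * h x)" if "csm g" "sm h" for g h by (rule csm_mult_right[OF that])
  have csq: "csm (\<lambda>x. (g x)\<^sup>2)" if "csm g" for g by (rule csm_power[OF that]) simp
  define A where "A = mint (\<lambda>x. w x * (L f x)\<^sup>2)"
  define B where "B = mint (\<lambda>x. w x * (\<Sum>i\<in>UNIV. (ang i f x)\<^sup>2))"
  define D where "D = mint (\<lambda>x. w x * (\<Sum>i\<in>UNIV. \<Sum>j\<in>UNIV. (ang i (ang j f) x)\<^sup>2))"
  have cB: "csm (\<lambda>x. \<Sum>i\<in>UNIV. (ang i f x)\<^sup>2)"
    by (rule csm_sum_finite[OF finite csq[OF d]])
  have cD: "csm (\<lambda>x. \<Sum>i\<in>UNIV. \<Sum>j\<in>UNIV. (ang i (ang j f) x)\<^sup>2)"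
    by (rule csm_sum_finite[OF finite csm_sum_finite[OF finite csq[OF csm_ang[OF d]]]])
  have "A = mint (\<lambda>x. w x * (L f x * L f x))" by (simp add: A_def power2_eq_square)
  also have "\<dots> = - (\<Sum>i\<in>UNIV. mint (\<lambda>x. w x * (ang i f x * ang i (L f) x)))"
    using ang_green[OF w(1,2) f sL] by (simp add: L_def)
  finally have A: "A = - (\<Sum>i\<in>UNIV. mint (\<lambda>x. w x * (ang i f x * ang i (L f) x)))" .
  have D: "D = - (\<Sum>i\<in>UNIV. mint (\<lambda>x. w x * (L (ang i f) x * ang i f x)))"
  proof -
    have "D = mint (\<lambda>x. \<Sum>j\<in>UNIV. \<Sum>i\<in>UNIV. w x * (ang i (ang j f) x * ang i (ang j f) x))"
      unfolding D_def
      by (rule mint_cong) (subst sum.swap, simp add: sum_distrib_left power2_eq_square)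
    also have "\<dots> = (\<Sum>j\<in>UNIV. mint (\<lambda>x. \<Sum>i\<in>UNIV. w x * (ang i (ang j f) x * ang i (ang j f) x)))"
      by (rule mint_sum[OF finite csm_sum_finite[OF finite cw[OF cm[OF csm_ang[OF d] sm_ang[OF sd]]]]])
    also have "\<dots> = (\<Sum>j\<in>UNIV. \<Sum>i\<in>UNIV. mint (\<lambda>x. w x * (ang i (ang j f) x * ang i (ang j f) x)))"
      by (rule sum.cong[OF refl], rule mint_sum[OF finite cw[OF cm[OF csm_ang[OF d] sm_ang[OF sd]]]])
    also have "\<dots> = - (\<Sum>j\<in>UNIV. mint (\<lambda>x. w x * (L (ang j f) x * ang j f x)))"
      unfolding L_def using ang_green[OF w(1,2) d sd] by (simp add: sum_negf)
    finally show ?thesis .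
  qed
  have "A - D = (\<Sum>i\<in>UNIV. mint (\<lambda>x. w x * (L (ang i f) x * ang i f x)) - mint (\<lambda>x. w x * (ang i f x * ang i (L f) x)))"
    unfolding A D by (simp add: sum_subtractf)
  also have "\<dots> = (\<Sum>i\<in>UNIV. mint (\<lambda>x. w x * (L (ang i f) x * ang i f x) - w x * (ang i f x * ang i (L f) x)))"
    by (rule sum.cong[OF refl], rule mint_diff[symmetric, OF cw[OF cm[OF cL[OF d] sd]] cw[OF cm[OF d sm_ang[OF sL]]]])
  also have "\<dots> = mint (\<lambda>x. \<Sum>i\<in>UNIV. w x * (L (ang i f) x * ang i f x) - w x * (ang i f x * ang i (L f) x))"
    by (rule mint_sum[symmetric, OF finite csm_diff[OF cw[OF cm[OF cL[OF d] sd]] cw[OF cm[OF d sm_ang[OF sL]]]]])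
  also have "\<dots> = mint (\<lambda>x. (?N - 3) * (w x * (\<Sum>i\<in>UNIV. (ang i f x)\<^sup>2)))"
  proof (rule mint_cong)
    fix x :: "real ^ 'n" assume x: "x \<in> punct"
    \<comment> \<open>The normal term of the commutator becomes a multiple of
      \<open>omega i x * ang i f x\<close>, whose sum over i is zero.\<close>
    have "w x * (L (ang i f) x * ang i f x) - w x * (ang i f x * ang i (L f) x) =
        (?N - 3) * (w x * (ang i f x)\<^sup>2) - 2 * w x * L f x * (omega i x * ang i f x)" for i
    proof -
      have "L (ang i f) x = ang i (L f) x + (?N - 3) * ang i f x - 2 * omega i x * L f x"
        using ang_laplacian_commutator[OF sf x, of i] by (simp add: L_def[abs_def])
      from this show ?thesis by (simp only:) (simp add: power2_eq_square algebra_simps)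
    qed
    then have "(\<Sum>i\<in>UNIV. w x * (L (ang i f) x * ang i f x) - w x * (ang i f x * ang i (L f) x)) =
        (?N - 3) * (w x * (\<Sum>i\<in>UNIV. (ang i f x)\<^sup>2)) - 2 * w x * L f x * (\<Sum>i\<in>UNIV. omega i x * ang i f x)"
      by (simp only: sum_subtractf sum_distrib_left)
    then show "(\<Sum>i\<in>UNIV. w x * (L (ang i f) x * ang i f x) - w x * (ang i f x * ang i (L f) x)) =
        (?N - 3) * (w x * (\<Sum>i\<in>UNIV. (ang i f x)\<^sup>2))"
      by (simp only: sum_omega_ang[OF x] mult_zero_right diff_0_right)
  qed
  also have "\<dots> = (?N - 3) * B" by (simp only: mint_cmult B_def)
  finally have AD: "A = D + (?N - 3) * B" by simp
  have "A \<le> mint (\<lambda>x. (?N - 1) * (w x * ((\<Sum>i\<in>UNIV. \<Sum>j\<in>UNIV. (ang i (ang j f) x)\<^sup>2) - (\<Sum>i\<in>UNIV. (ang i f x)\<^sup>2))))"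
    unfolding A_def
  proof (rule mint_mono)
    show "csm (\<lambda>x. w x * (L f x)\<^sup>2)" by (rule cw[OF csq[OF cL[OF f]]])
    show "csm (\<lambda>x. (?N - 1) * (w x * ((\<Sum>i\<in>UNIV. \<Sum>j\<in>UNIV. (ang i (ang j f) x)\<^sup>2) - (\<Sum>i\<in>UNIV. (ang i f x)\<^sup>2))))"
      by (rule csm_mult_left[OF smooth_on_const cw[OF csm_diff[OF cD cB]]])
    show "w x * (L f x)\<^sup>2 \<le> (?N - 1) * (w x * ((\<Sum>i\<in>UNIV. \<Sum>j\<in>UNIV. (ang i (ang j f) x)\<^sup>2) - (\<Sum>i\<in>UNIV. (ang i f x)\<^sup>2)))"
      if x: "x \<in> punct" for x
      using mult_left_mono[OF ang_laplacian_sq_le[OF sf x] w(3)[OF x]] by (simp add: L_def algebra_simps)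
  qed
  also have "\<dots> = (?N - 1) * mint (\<lambda>x. w x * (\<Sum>i\<in>UNIV. \<Sum>j\<in>UNIV. (ang i (ang j f) x)\<^sup>2) - w x * (\<Sum>i\<in>UNIV. (ang i f x)\<^sup>2))"
    by (subst mint_cmult) (simp only: right_diff_distrib)
  also have "\<dots> = (?N - 1) * (D - B)"
    unfolding D_def B_def by (rule arg_cong[OF mint_diff[OF cw[OF cD] cw[OF cB]]])
  also have "D - B = A - (?N - 2) * B" using AD by (simp add: left_diff_distrib)
  finally have "A \<le> (?N - 1) * (A - (?N - 2) * B)" .
  then have "(?N - 2) * ((?N - 1) * B) \<le> (?N - 2) * A" by (simp add: algebra_simps)
  then have "(?N - 1) * B \<le> A" using N by (simp add: mult_le_cancel_left)
  then show ?thesis by (simp add: A_def B_def L_def)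
qed

section \<open>Hyperbolic functions and the radial equality\<close>

text \<open>\<open>sinh r\<close>, \<open>cosh r\<close> and \<open>r\<close> for the pole \<open>0\<close>.\<close>

definition sh :: "real ^ 'n \<Rightarrow> real" where "sh x = 2 * norm x / (1 - (norm x)\<^sup>2)"
definition ch :: "real ^ 'n \<Rightarrow> real" where "ch x = (1 + (norm x)\<^sup>2) / (1 - (norm x)\<^sup>2)"
definition rr :: "real ^ 'n \<Rightarrow> real" where "rr x = ln (ch x + sh x)"

lemma sm_one_minus_norm2: "sm (\<lambda>x. 1 - (norm x)\<^sup>2)"
  by (rule sm_diff[OF smooth_on_const smooth_on_norm2[OF open_punct]])

lemma sm_sh: "sm sh"
  unfolding sh_def[abs_def]
  by (rule sm_divide[OF sm_mult[OF smooth_on_const sm_norm] sm_one_minus_norm2])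
    (use norm_square_less_1 in fastforce)

lemma sm_ch: "sm ch"
  unfolding ch_def[abs_def]
  by (rule sm_divide[OF sm_add[OF smooth_on_const smooth_on_norm2[OF open_punct]] sm_one_minus_norm2])
    (use norm_square_less_1 in fastforce)

lemma sh_pos: "x \<in> punct \<Longrightarrow> sh x > 0"
  using norm_square_less_1[of x] punct_D[of x] by (simp add: sh_def)

lemma ch_pos: "x \<in> punct \<Longrightarrow> ch x > 1"
  using norm_square_less_1[of x] punct_D[of x] by (simp add: ch_def)

lemma ch_sq: "x \<in> punct \<Longrightarrow> (ch x)\<^sup>2 = 1 + (sh x)\<^sup>2"
  using norm_square_less_1[of x]
  by (simp add: ch_def sh_def power_divide divide_simps) (simp add: power2_eq_square algebra_simps)

lemma sm_rr: "sm rr"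
  unfolding rr_def[abs_def]
  by (rule smooth_on_ln[OF open_punct sm_add[OF sm_ch sm_sh]]) (use ch_pos sh_pos in fastforce)

lemma rr_pos: "x \<in> punct \<Longrightarrow> rr x > 0"
  using ch_pos[of x] sh_pos[of x] by (simp add: rr_def)

lemma eul_sh: assumes x: "x \<in> punct" shows "eul sh x = sh x * ch x"
proof -
  let ?t = "norm x"
  have n: "1 - ?t * ?t \<noteq> 0" using norm_square_less_1[OF x] by (simp add: power2_eq_square)
  have "((\<lambda>t. 2 * t / (1 - t\<^sup>2)) has_real_derivative (2 * (1 + ?t\<^sup>2)) / (1 - ?t\<^sup>2)\<^sup>2) (at ?t)"
    using n by (auto intro!: derivative_eq_intros simp: power2_eq_square field_simps)
  from eul_comp[OF sm_norm x this] show ?thesis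
    by (simp add: sh_def[abs_def] ch_def eul_norm[OF x] power2_eq_square)
qed

lemma eul_ch: assumes x: "x \<in> punct" shows "eul ch x = (sh x)\<^sup>2"
proof -
  let ?t = "norm x"
  have n: "1 - ?t * ?t \<noteq> 0" using norm_square_less_1[OF x] by (simp add: power2_eq_square)
  have "((\<lambda>t. (1 + t\<^sup>2) / (1 - t\<^sup>2)) has_real_derivative (4 * ?t) / (1 - ?t\<^sup>2)\<^sup>2) (at ?t)"
    using n by (auto intro!: derivative_eq_intros simp: power2_eq_square field_simps)
  from eul_comp[OF sm_norm x this] show ?thesis
    by (simp add: sh_def ch_def[abs_def] eul_norm[OF x] power2_eq_square)
qed

lemma ang_radial:
  assumes x: "x \<in> punct" and h: "(h has_real_derivative h') (at (norm x))"
  shows "ang i (\<lambda>x. h (norm x)) x = 0"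
  by (simp add: ang_comp[OF sm_norm x h] ang_norm[OF x])

lemma ang_sh: assumes x: "x \<in> punct" shows "ang i sh x = 0"
proof -
  let ?t = "norm x"
  have n: "1 - ?t * ?t \<noteq> 0" using norm_square_less_1[OF x] by (simp add: power2_eq_square)
  have "((\<lambda>t. 2 * t / (1 - t\<^sup>2)) has_real_derivative (2 * (1 + ?t\<^sup>2)) / (1 - ?t\<^sup>2)\<^sup>2) (at ?t)"
    using n by (auto intro!: derivative_eq_intros simp: power2_eq_square field_simps)
  from ang_radial[OF x this] show ?thesis by (simp add: sh_def[abs_def])
qed

lemma ang_ch: assumes x: "x \<in> punct" shows "ang i ch x = 0"
proof -
  let ?t = "norm x"
  have n: "1 - ?t * ?t \<noteq> 0" using norm_square_less_1[OF x] by (simp add: power2_eq_square)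
  have "((\<lambda>t. (1 + t\<^sup>2) / (1 - t\<^sup>2)) has_real_derivative (4 * ?t) / (1 - ?t\<^sup>2)\<^sup>2) (at ?t)"
    using n by (auto intro!: derivative_eq_intros simp: power2_eq_square field_simps)
  from ang_radial[OF x this] show ?thesis by (simp add: ch_def[abs_def])
qed

lemma sm_ch_sh: "sm (\<lambda>x. ch x + sh x)"
  by (rule sm_add[OF sm_ch sm_sh])

text \<open>This is dr / d ln |x| = sinh r, the relation that identifies \<open>eul\<close> divided
  by \<open>sh\<close> with the derivative in r.\<close>

lemma eul_rr: assumes x: "x \<in> punct" shows "eul rr x = sh x"
proof -
  have p: "ch x + sh x > 0" using ch_pos[OF x] sh_pos[OF x] by simp
  have "eul rr x = (sh x)\<^sup>2 / (ch x + sh x) + sh x * ch x / (ch x + sh x)"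
    using eul_comp[OF sm_ch_sh x DERIV_ln_divide[OF p]] x
    by (simp add: rr_def[abs_def] eul_add[OF sm_ch sm_sh x] eul_ch eul_sh add_divide_distrib)
  also have "\<dots> = sh x" using p by (simp add: add_divide_distrib[symmetric] power2_eq_square distrib_left[symmetric] add.commute)
  finally show ?thesis .
qed

lemma ang_rr: assumes x: "x \<in> punct" shows "ang i rr x = 0"
proof -
  have p: "ch x + sh x > 0" using ch_pos[OF x] sh_pos[OF x] by simp
  show ?thesis
    using ang_comp[OF sm_ch_sh x DERIV_ln_divide[OF p], of i] x
    by (simp add: rr_def[abs_def] ang_add[OF sm_ch sm_sh x] ang_ch ang_sh)
qed

definition rad :: "(real ^ 'n \<Rightarrow> real) \<Rightarrow> real ^ 'n \<Rightarrow> real"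
  where "rad f x = eul f x / sh x"

lemma sm_rad: "sm f \<Longrightarrow> sm (rad f)"
  unfolding rad_def[abs_def]
  by (rule sm_divide[OF sm_eul sm_sh]) (use sh_pos in fastforce)+

lemma csm_rad: "csm f \<Longrightarrow> csm (rad f)"
  unfolding rad_def[abs_def]
  by (rule csm_divide[OF csm_eul sm_sh]) (use sh_pos in fastforce)+

lemma rad_add: "sm f \<Longrightarrow> sm g \<Longrightarrow> x \<in> punct \<Longrightarrow> rad (\<lambda>x. f x + g x) x = rad f x + rad g x"
  by (simp add: rad_def eul_add add_divide_distrib)

lemma rad_mult: "sm f \<Longrightarrow> sm g \<Longrightarrow> x \<in> punct \<Longrightarrow> rad (\<lambda>x. f x * g x) x = rad f x * g x + f x * rad g x"
  by (simp add: rad_def eul_mult add_divide_distrib)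

lemma rad_const: "rad (\<lambda>x. c) x = 0"
  by (simp add: rad_def eul_const)

lemma rad_cmult: "sm g \<Longrightarrow> x \<in> punct \<Longrightarrow> rad (\<lambda>x. c * g x) x = c * rad g x"
  by (simp add: rad_mult[OF smooth_on_const] rad_const)

lemma rad_comp: "sm f \<Longrightarrow> x \<in> punct \<Longrightarrow> (h has_real_derivative h') (at (f x)) \<Longrightarrow>
    rad (\<lambda>x. h (f x)) x = h' * rad f x"
  by (simp add: rad_def eul_comp)

lemma rad_cong: "x \<in> punct \<Longrightarrow> (\<And>y. y \<in> punct \<Longrightarrow> f y = g y) \<Longrightarrow> rad f x = rad g x"
  by (simp add: rad_def eul_cong[of x f g])

lemma rad_sh: "x \<in> punct \<Longrightarrow> rad sh x = ch x"
  using sh_pos[of x] by (simp add: rad_def eul_sh)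

lemma rad_ch: "x \<in> punct \<Longrightarrow> rad ch x = sh x"
  using sh_pos[of x] by (simp add: rad_def eul_ch power2_eq_square)

lemma rad_rr: "x \<in> punct \<Longrightarrow> rad rr x = 1"
  using sh_pos[of x] by (simp add: rad_def eul_rr)

lemma sm_ish: "sm (\<lambda>x. inverse (sh x))"
  by (rule sm_inverse[OF sm_sh]) (use sh_pos in fastforce)

lemma sm_irr: "sm (\<lambda>x. inverse (rr x))"
  by (rule sm_inverse[OF sm_rr]) (use rr_pos in fastforce)

lemma rad_ish: "x \<in> punct \<Longrightarrow> rad (\<lambda>x. inverse (sh x)) x = - (inverse (sh x) * inverse (sh x) * ch x)"
  using rad_comp[OF sm_sh _ DERIV_inverse, of x] sh_pos[of x] by (simp add: rad_sh power2_eq_square)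

lemma rad_irr: "x \<in> punct \<Longrightarrow> rad (\<lambda>x. inverse (rr x)) x = - (inverse (rr x) * inverse (rr x))"
  using rad_comp[OF sm_rr _ DERIV_inverse, of x] rr_pos[of x] by (simp add: rad_rr power2_eq_square)

lemma rad_sh_power: "x \<in> punct \<Longrightarrow> rad (\<lambda>x. sh x ^ n) x = real n * (sh x ^ n) * (ch x * inverse (sh x))"
proof -
  assume x: "x \<in> punct"
  have "((\<lambda>t. t ^ n) has_real_derivative real n * sh x ^ (n - Suc 0)) (at (sh x))"
    using DERIV_pow[of n "sh x"] by simp
  from rad_comp[OF sm_sh x this] show ?thesis
    using sh_pos[OF x] by (cases n) (simp_all add: rad_sh[OF x])
qed

lemma rad_ang:
  assumes f: "sm f" and x: "x \<in> punct"
  shows "rad (ang i f) x = ang i (rad f) x"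
proof -
  have "ang i (\<lambda>x. inverse (sh x)) x = 0"
    using ang_comp[OF sm_sh x DERIV_inverse, of i] sh_pos[OF x] by (simp add: ang_sh[OF x])
  then show ?thesis
    using ang_mult[OF sm_eul[OF f] sm_ish x, of i]
    by (simp add: rad_def[abs_def] divide_inverse eul_ang[OF f x])
qed

text \<open>In polar coordinates the measure of \<open>mint\<close> is dr dTheta / sinh r. The
  factor \<open>sh\<close> turns it into dr dTheta, for which r-derivatives of test functions
  integrate to zero; it accompanies every total derivative in the pointwise identities
  below.\<close>

lemma mint_rad:
  assumes "csm f" shows "mint (\<lambda>x. sh x * rad f x) = 0"
proof -
  have "mint (\<lambda>x. sh x * rad f x) = mint (eul f)"
    by (rule mint_cong) (simp add: rad_def less_imp_neq[OF sh_pos, symmetric])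
  then show ?thesis using mint_eul[OF assms] by simp
qed

definition coth :: "real ^ 'n \<Rightarrow> real" where "coth x = ch x * inverse (sh x)"

lemma sm_coth: "sm coth"
  unfolding coth_def[abs_def] by (rule sm_mult[OF sm_ch sm_ish])

lemma coth_sq: "x \<in> punct \<Longrightarrow> coth x * coth x = 1 + inverse (sh x) * inverse (sh x)"
  using ch_sq[of x] sh_pos[of x] by (simp add: coth_def field_simps power2_eq_square)

lemma rad_coth: "x \<in> punct \<Longrightarrow> rad coth x = - (inverse (sh x) * inverse (sh x))"
proof -
  assume x: "x \<in> punct"
  have "rad coth x = 1 - coth x * coth x"
    using sh_pos[OF x] by (simp add: coth_def[abs_def] rad_mult[OF sm_ch sm_ish x] rad_ch[OF x] rad_ish[OF x])
  then show ?thesis using coth_sq[OF x] by simp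
qed

lemma rad_sh_power': "x \<in> punct \<Longrightarrow> rad (\<lambda>x. sh x ^ n) x = real n * sh x ^ n * coth x"
  by (simp add: rad_sh_power coth_def)

section \<open>Pointwise identities in the radial variable\<close>

definition rlap :: "(real ^ 'n \<Rightarrow> real) \<Rightarrow> real ^ 'n \<Rightarrow> real"
  where "rlap f x = rad (rad f) x + (real CARD('n) - 1) * coth x * rad f x"

definition slap :: "(real ^ 'n \<Rightarrow> real) \<Rightarrow> real ^ 'n \<Rightarrow> real"
  where "slap f x = (\<Sum>i\<in>UNIV. ang i (ang i f) x)"

definition wgt :: "real ^ 'n \<Rightarrow> real"
  where "wgt x = sh x powr ((real CARD('n) - 1) / 2) / sqrt (rr x)"

lemma wgt_eq: "x \<in> punct \<Longrightarrow> wgt (x :: real ^ 'n) = exp ((real CARD('n) - 1) / 2 * ln (sh x) + (- 1 / 2) * ln (rr x))"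
proof -
  assume x: "x \<in> punct"
  have "sqrt (rr x) = exp (1 / 2 * ln (rr x))"
    using rr_pos[OF x] powr_half_sqrt[of "rr x"] by (simp add: powr_def)
  then show ?thesis using sh_pos[OF x] by (simp add: wgt_def powr_def exp_diff)
qed

lemma sm_ln_sh: "sm (\<lambda>x. ln (sh x))" and sm_ln_rr: "sm (\<lambda>x. ln (rr x))"
  using smooth_on_ln[OF open_punct sm_sh] smooth_on_ln[OF open_punct sm_rr] sh_pos rr_pos by blast+

lemma sm_ln_wgt: "sm (\<lambda>x. a * ln (sh x) + b * ln (rr x))"
  by (rule sm_add[OF sm_mult[OF smooth_on_const sm_ln_sh]
      sm_mult[OF smooth_on_const sm_ln_rr]])

lemma sm_wgt: "sm (wgt :: real ^ 'n \<Rightarrow> real)"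
  by (rule iffD2[OF smooth_on_cong[OF open_punct wgt_eq] smooth_on_exp[OF open_punct sm_ln_wgt]])

lemma rad_wgt:
  fixes x :: "real ^ 'n"
  assumes x: "x \<in> punct"
  shows "rad wgt x = wgt x * ((real CARD('n) - 1) / 2 * coth x - inverse (rr x) / 2)"
proof -
  let ?h = "\<lambda>x :: real ^ 'n. (real CARD('n) - 1) / 2 * ln (sh x) + (- 1 / 2) * ln (rr x)"
  have "rad (\<lambda>x. ln (sh x)) x = coth x" "rad (\<lambda>x. ln (rr x)) x = inverse (rr x)"
    using rad_comp[OF sm_sh x DERIV_ln[OF sh_pos[OF x]]] rad_comp[OF sm_rr x DERIV_ln[OF rr_pos[OF x]]]
    by (simp_all add: rad_sh[OF x] rad_rr[OF x] coth_def)
  then have "rad ?h x = (real CARD('n) - 1) / 2 * coth x - inverse (rr x) / 2"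
    by (simp only: rad_add[OF sm_mult[OF smooth_on_const sm_ln_sh]
          sm_mult[OF smooth_on_const sm_ln_rr] x] rad_cmult[OF sm_ln_sh x] rad_cmult[OF sm_ln_rr x])
  moreover have "rad wgt x = rad (\<lambda>x. exp (?h x)) x"
    by (rule rad_cong[OF x wgt_eq])
  moreover have "rad (\<lambda>x. exp (?h x)) x = exp (?h x) * rad ?h x"
    by (rule rad_comp[OF sm_ln_wgt x DERIV_exp])
  ultimately show ?thesis by (simp only: wgt_eq[OF x])
qed

lemma ang_wgt:
  fixes x :: "real ^ 'n"
  assumes x: "x \<in> punct" shows "ang i wgt x = 0"
proof -
  let ?h = "\<lambda>x :: real ^ 'n. (real CARD('n) - 1) / 2 * ln (sh x) + (- 1 / 2) * ln (rr x)"
  have "ang i (\<lambda>x. ln (sh x)) x = 0" "ang i (\<lambda>x. ln (rr x)) x = 0"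
    using ang_comp[OF sm_sh x DERIV_ln[OF sh_pos[OF x]], of i] ang_comp[OF sm_rr x DERIV_ln[OF rr_pos[OF x]], of i]
    by (simp_all add: ang_sh[OF x] ang_rr[OF x])
  then have "ang i ?h x = 0"
    by (simp only: ang_add[OF sm_mult[OF smooth_on_const sm_ln_sh]
          sm_mult[OF smooth_on_const sm_ln_rr] x] ang_mult[OF smooth_on_const sm_ln_sh x]
        ang_mult[OF smooth_on_const sm_ln_rr x] ang_const)
  moreover have "ang i wgt x = ang i (\<lambda>x. exp (?h x)) x"
    by (rule ang_cong[OF x wgt_eq])
  moreover have "ang i (\<lambda>x. exp (?h x)) x = exp (?h x) * ang i ?h x"
    by (rule ang_comp[OF sm_ln_wgt x DERIV_exp])
  ultimately show ?thesis by simp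
qed

text \<open>This turns the radial remainder into the square of \<open>rad\<close> of
  \<open>wgt\<close> v, divided by \<open>wgt\<close>; that is, of v' + (a coth r - 1/(2r)) v with a
  = (N - 1)/2.\<close>

lemma wgt_sq: "x \<in> punct \<Longrightarrow> rr x / sh x ^ (CARD('n) - 1) * (wgt (x :: real ^ 'n))\<^sup>2 = 1"
proof -
  assume x: "x \<in> punct"
  have "(sh x powr ((real CARD('n) - 1) / 2))\<^sup>2 = sh x powr (real CARD('n) - 1)"
    by (simp add: powr_add[symmetric] power2_eq_square)
  also have "\<dots> = sh x ^ (CARD('n) - 1)"
    using sh_pos[OF x] powr_realpow[of "sh x" "CARD('n) - 1"] by (simp add: of_nat_diff)
  finally show ?thesis
    using sh_pos[OF x] rr_pos[OF x] by (simp add: wgt_def power_divide)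
qed

text \<open>With v = u_r, the square of v' + 2 a coth r v is compared with that of v' + (a coth r -
  1/(2r)) v. Their mixed terms differ by 2 (a coth r + 1/(2r)) v v', which dictates the coefficient
  in the total derivative. What remains is v^2 times 1/(4 r^2) + a^2 coth^2 r + a / sinh^2 r, and
  a^2 + a = (N^2 - 1)/4.\<close>

lemma radial_pointwise_identity:
  fixes f :: "real ^ 'n \<Rightarrow> real" and N a :: real
  defines "N \<equiv> real CARD('n)" and "a \<equiv> (N - 1) / 2"
  assumes f: "sm f" and x: "x \<in> punct"
  shows "sh x ^ CARD('n) * (rlap f x)\<^sup>2 =
    sh x ^ CARD('n) * (a\<^sup>2 * (rad f x)\<^sup>2 + 1 / 4 * ((rad f x)\<^sup>2 / (rr x)\<^sup>2) + (N\<^sup>2 - 1) / 4 * ((rad f x)\<^sup>2 / (sh x)\<^sup>2)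
      + rr x / sh x ^ (CARD('n) - 1) * (rad (\<lambda>y. wgt y * rad f y) x)\<^sup>2)
    + sh x * rad (\<lambda>x. (a * coth x + 1 / 2 * inverse (rr x)) * (sh x ^ (CARD('n) - 1) * (rad f x * rad f x))) x"
proof -
  define m where "m = CARD('n) - 1"
  have m: "CARD('n) = Suc m" "N = real m + 1" by (simp_all add: m_def N_def)
  define v where "v = rad f x"
  define z where "z = rad (rad f) x"
  define C where "C = coth x"
  define si where "si = inverse (sh x)"
  define ri where "ri = inverse (rr x)"
  have C2: "C * C = 1 + si * si" using coth_sq[OF x] by (simp add: C_def si_def)
  note sr = sm_rad[OF f]
  note vv = sm_mult[OF sr sr] and p = sm_power[OF sm_sh, of m]
  note p2 = sm_mult[OF p vv]
  note c1 = sm_mult[OF smooth_on_const sm_coth, of a] and c2 = sm_mult[OF smooth_on_const sm_irr, of "1/2"]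
  have w: "rr x / sh x ^ m * (rad (\<lambda>y. wgt y * rad f y) x)\<^sup>2 = (a * C * v - ri * v / 2 + z)\<^sup>2"
  proof -
    have "rad (\<lambda>y. wgt y * rad f y) x = wgt x * (a * C * v - ri * v / 2 + z)"
      using rad_mult[OF sm_wgt sr x] rad_wgt[OF x]
      by (simp add: v_def z_def C_def ri_def a_def N_def algebra_simps)
    then show ?thesis using wgt_sq[OF x] by (simp add: power_mult_distrib m_def flip: mult.assoc times_divide_eq_left)
  qed
  have G: "rad (\<lambda>x. (a * coth x + 1 / 2 * inverse (rr x)) * (sh x ^ m * (rad f x * rad f x))) x =
      sh x ^ m * ((- a * si * si - ri * ri / 2) * (v * v) + (a * C + ri / 2) * (real m * C * v * v + 2 * v * z))"
    by (simp only: rad_mult[OF sm_add[OF c1 c2] p2 x] rad_add[OF c1 c2 x] rad_cmult[OF sm_coth x]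
        rad_cmult[OF sm_irr x] rad_mult[OF p vv x] rad_mult[OF sr sr x] rad_coth[OF x] rad_irr[OF x] rad_sh_power'[OF x]
        v_def[symmetric] z_def[symmetric] C_def[symmetric] si_def[symmetric] ri_def[symmetric])
      (simp add: algebra_simps)
  have r: "rlap f x = z + 2 * a * C * v"
    by (simp add: rlap_def z_def v_def C_def a_def N_def)
  have am: "real m = 2 * a" "N = 2 * a + 1" by (simp_all add: a_def m)
  have key: "(z + 2 * a * C * v)\<^sup>2 = a\<^sup>2 * v\<^sup>2 + 1 / 4 * (v\<^sup>2 * ri\<^sup>2) + ((2 * a + 1)\<^sup>2 - 1) / 4 * (v\<^sup>2 * si\<^sup>2)
      + (a * C * v - ri * v / 2 + z)\<^sup>2
      + ((- a * si * si - ri * ri / 2) * (v * v) + (a * C + ri / 2) * (2 * a * C * v * v + 2 * v * z))"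
  proof -
    \<comment> \<open>As polynomials the two sides differ only by a multiple of the relation between
      \<open>coth\<close> and 1/sinh.\<close>
    have "(z + 2 * a * C * v)\<^sup>2 - (a\<^sup>2 * v\<^sup>2 + 1 / 4 * (v\<^sup>2 * ri\<^sup>2) + ((2 * a + 1)\<^sup>2 - 1) / 4 * (v\<^sup>2 * si\<^sup>2)
      + (a * C * v - ri * v / 2 + z)\<^sup>2
      + ((- a * si * si - ri * ri / 2) * (v * v) + (a * C + ri / 2) * (2 * a * C * v * v + 2 * v * z)))
      = a\<^sup>2 * v\<^sup>2 * (C * C - (1 + si * si))"
      by (simp add: power2_eq_square algebra_simps)
    then show ?thesis using C2 by simp
  qed
  have "v\<^sup>2 / (rr x)\<^sup>2 = v\<^sup>2 * ri\<^sup>2" "v\<^sup>2 / (sh x)\<^sup>2 = v\<^sup>2 * si\<^sup>2"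
    by (simp_all add: ri_def si_def power_inverse divide_inverse)
  then show ?thesis
    unfolding m_def[symmetric] w G r v_def[symmetric] am(2) key unfolding m(1) am(1)
    by (simp add: algebra_simps)
qed

text \<open>To be applied to \<open>ang i f\<close>. The total derivative collects -2 g g' from
  moving one derivative, -2 coth r g^2 from the resulting -4 coth r g g', and -((N - 3)/2 coth r -
  1/(2r)) g^2 from completing a square; the last two give the coefficient -(N + 1)/2 of
  \<open>coth\<close>. Of the two squares of \<open>rad g\<close> only one is completed, the other
  is kept for the remainder.\<close>

lemma hardy_pointwise_identity:
  fixes g :: "real ^ 'n \<Rightarrow> real" and N :: real
  defines "N \<equiv> real CARD('n)"
  assumes N: "CARD('n) \<ge> 3" and g: "sm g" and x: "x \<in> punct"
  shows "- (2 * sh x ^ (CARD('n) - 2) * (rlap g x * g x)) =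
      sh x ^ (CARD('n) - 2) * ((rad g x)\<^sup>2
        + (((N - 1) / 2)\<^sup>2 * (g x)\<^sup>2 + 1 / 4 * ((g x)\<^sup>2 / (rr x)\<^sup>2) + (N\<^sup>2 - 1) / 4 * ((g x)\<^sup>2 / (sh x)\<^sup>2))
        - 4 * ((g x)\<^sup>2 / (sh x)\<^sup>2) + (N - 4) * (g x)\<^sup>2
        + (rad g x + ((N - 3) / 2 * coth x - inverse (rr x) / 2) * g x)\<^sup>2)
    + sh x * rad (\<lambda>x. sh x ^ (CARD('n) - 3) *
        ((- 2) * (rad g x * g x) + (- ((N + 1) / 2) * coth x + 1 / 2 * inverse (rr x)) * (g x * g x))) x"
proof -
  define m where "m = CARD('n) - 3"
  have m: "CARD('n) - 2 = Suc m" "N = real m + 3" using N by (simp_all add: m_def N_def)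
  define u where "u = g x"
  define z where "z = rad g x"
  define y where "y = rad (rad g) x"
  define C where "C = coth x"
  define si where "si = inverse (sh x)"
  define ri where "ri = inverse (rr x)"
  have C2: "C * C = 1 + si * si" using coth_sq[OF x] by (simp add: C_def si_def)
  note sr = sm_rad[OF g]
  note gg = sm_mult[OF g g] and zg = sm_mult[OF sr g]
    and p = sm_power[OF sm_sh, of m]
  note c1 = sm_mult[OF smooth_on_const sm_coth, of "- ((N + 1) / 2)"]
    and c2 = sm_mult[OF smooth_on_const sm_irr, of "1/2"]
  note c = sm_add[OF c1 c2]
  note q1 = sm_mult[OF smooth_on_const zg, of "-2"] and q2 = sm_mult[OF c gg]
  have G: "rad (\<lambda>x. sh x ^ m * ((- 2) * (rad g x * g x) + (- ((N + 1) / 2) * coth x + 1 / 2 * inverse (rr x)) * (g x * g x))) x =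
      sh x ^ m * (real m * C * ((- 2) * (z * u) + (- ((N + 1) / 2) * C + ri / 2) * (u * u))
       - 2 * (y * u + z * z) + ((N + 1) / 2 * si * si - ri * ri / 2) * (u * u) + (- ((N + 1) / 2) * C + ri / 2) * (2 * z * u))"
    by (simp only: rad_mult[OF p sm_add[OF q1 q2] x] rad_add[OF q1 q2 x] rad_cmult[OF zg x] rad_mult[OF sr g x]
        rad_mult[OF c gg x] rad_mult[OF g g x] rad_add[OF c1 c2 x] rad_cmult[OF sm_coth x]
        rad_cmult[OF sm_irr x] rad_coth[OF x] rad_irr[OF x] rad_sh_power'[OF x]
        u_def[symmetric] y_def[symmetric] z_def[symmetric] C_def[symmetric] si_def[symmetric] ri_def[symmetric])
      (simp add: field_simps)
  have r: "rlap g x = y + (N - 1) * C * z"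
    by (simp add: rlap_def z_def y_def C_def N_def)
  have mN: "real m = N - 3" by (simp add: m)
  have key: "- (2 * ((y + (N - 1) * C * z) * u)) = z\<^sup>2 + (((N - 1) / 2)\<^sup>2 * u\<^sup>2 + 1 / 4 * (u\<^sup>2 * ri\<^sup>2) + (N\<^sup>2 - 1) / 4 * (u\<^sup>2 * si\<^sup>2))
        - 4 * (u\<^sup>2 * si\<^sup>2) + (N - 4) * u\<^sup>2 + (z + ((N - 3) / 2 * C - ri / 2) * u)\<^sup>2
      + ((N - 3) * C * ((- 2) * (z * u) + (- ((N + 1) / 2) * C + ri / 2) * (u * u))
       - 2 * (y * u + z * z) + ((N + 1) / 2 * si * si - ri * ri / 2) * (u * u) + (- ((N + 1) / 2) * C + ri / 2) * (2 * z * u))"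
  proof -
    have "z\<^sup>2 + (((N - 1) / 2)\<^sup>2 * u\<^sup>2 + 1 / 4 * (u\<^sup>2 * ri\<^sup>2) + (N\<^sup>2 - 1) / 4 * (u\<^sup>2 * si\<^sup>2))
        - 4 * (u\<^sup>2 * si\<^sup>2) + (N - 4) * u\<^sup>2 + (z + ((N - 3) / 2 * C - ri / 2) * u)\<^sup>2
      + ((N - 3) * C * ((- 2) * (z * u) + (- ((N + 1) / 2) * C + ri / 2) * (u * u))
       - 2 * (y * u + z * z) + ((N + 1) / 2 * si * si - ri * ri / 2) * (u * u) + (- ((N + 1) / 2) * C + ri / 2) * (2 * z * u))
      + 2 * ((y + (N - 1) * C * z) * u) = ((N - 3)\<^sup>2 / 4 - (N - 3) * (N + 1) / 2) * u\<^sup>2 * (C * C - (1 + si * si))"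
      by (simp add: power2_eq_square field_simps)
    then show ?thesis using C2 by simp
  qed
  have "u\<^sup>2 / (rr x)\<^sup>2 = u\<^sup>2 * ri\<^sup>2" "u\<^sup>2 / (sh x)\<^sup>2 = u\<^sup>2 * si\<^sup>2"
    by (simp_all add: ri_def si_def power_inverse divide_inverse)
  note e = this
  have "- (2 * sh x ^ Suc m * ((y + (N - 1) * C * z) * u)) = sh x ^ Suc m * (- (2 * ((y + (N - 1) * C * z) * u)))"
    by simp
  also note key
  finally show ?thesis
    unfolding m_def[symmetric] m(1) G r u_def[symmetric] z_def[symmetric] C_def[symmetric] ri_def[symmetric] e mN
    by (simp add: distrib_left)
qed

text \<open>The hyperbolic integral: \<open>conf x * norm x = sh x\<close>, and \<open>mint\<close> carries the factor \<open>|x|\<^sup>-\<^sup>N\<close>.\<close>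

definition hint :: "(real ^ 'n \<Rightarrow> real) \<Rightarrow> real"
  where "hint h = mint (\<lambda>x. sh x ^ CARD('n) * h x)"

lemma csm_sh_power: "csm h \<Longrightarrow> csm (\<lambda>x. sh x ^ n * h x)"
  by (rule csm_mult_left[OF sm_power[OF sm_sh]])

lemma csm_sq: "csm f \<Longrightarrow> csm (\<lambda>x. (f x)\<^sup>2)"
  by (rule csm_power) simp_all

lemma csm_div_sh: "csm f \<Longrightarrow> csm (\<lambda>x. f x / (sh x) ^ n)"
  by (rule csm_divide[OF _ sm_power[OF sm_sh]]) (use sh_pos in fastforce)+

lemma csm_div_rr: "csm f \<Longrightarrow> csm (\<lambda>x. f x / (rr x) ^ n)"
  by (rule csm_divide[OF _ sm_power[OF sm_rr]]) (use rr_pos in fastforce)+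

lemma csm_cmult: "csm f \<Longrightarrow> csm (\<lambda>x. c * f x)"
  by (rule csm_mult_left[OF smooth_on_const])

lemma csm_sum: "(\<And>i. csm (f i)) \<Longrightarrow> csm (\<lambda>x. \<Sum>i\<in>(UNIV :: 'i::finite set). f i x)"
  by (rule csm_sum_finite[OF finite])

lemma csm_rem: "csm f \<Longrightarrow> csm (\<lambda>x. rr x / sh x ^ n * f x)"
  by (rule csm_mult_left[OF sm_divide[OF sm_rr sm_power[OF sm_sh]]])
    (use sh_pos in fastforce)+

lemma csm_wgt: "csm f \<Longrightarrow> csm (\<lambda>x. wgt x * f x)"
  by (rule csm_mult_left[OF sm_wgt])

lemma csm_coth: "csm f \<Longrightarrow> csm (\<lambda>x. coth x * f x)"
  by (rule csm_mult_left[OF sm_coth])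

lemmas csm_intros = csm_sq csm_div_sh csm_div_rr csm_cmult csm_sum csm_rem csm_rad csm_ang csm_wgt csm_coth csm_sh_power
  csm_add csm_diff

lemma csm_rlap: "csm f \<Longrightarrow> csm (rlap f)"
  unfolding rlap_def[abs_def] mult.assoc by (intro csm_intros)

lemma csm_slap: "csm f \<Longrightarrow> csm (slap f)"
  unfolding slap_def[abs_def] by (intro csm_intros)

lemma hint_add: "csm f \<Longrightarrow> csm g \<Longrightarrow> hint (\<lambda>x. f x + g x) = hint f + hint g"
  unfolding hint_def distrib_left by (intro mint_add csm_intros)

lemma hint_cmult: "hint (\<lambda>x. c * f x) = c * hint f"
  unfolding hint_def mult.left_commute[of _ c] by (rule mint_cmult)

lemma hint_cong: "(\<And>x. x \<in> punct \<Longrightarrow> f x = g x) \<Longrightarrow> hint f = hint g"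
  unfolding hint_def by (intro mint_cong) simp

lemma hint_nonneg: "(\<And>x. x \<in> punct \<Longrightarrow> f x \<ge> 0) \<Longrightarrow> hint f \<ge> 0"
  unfolding hint_def by (intro mint_nonneg mult_nonneg_nonneg) (simp_all add: less_imp_le[OF sh_pos])

theorem radial_identity:
  fixes f :: "real ^ 'n \<Rightarrow> real" and N :: real
  defines "N \<equiv> real CARD('n)"
  assumes f: "csm f"
  shows "hint (\<lambda>x. (rlap f x)\<^sup>2) = ((N - 1) / 2)\<^sup>2 * hint (\<lambda>x. (rad f x)\<^sup>2)
    + 1 / 4 * hint (\<lambda>x. (rad f x)\<^sup>2 / (rr x)\<^sup>2) + (N\<^sup>2 - 1) / 4 * hint (\<lambda>x. (rad f x)\<^sup>2 / (sh x)\<^sup>2)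
    + hint (\<lambda>x. rr x / sh x ^ (CARD('n) - 1) * (rad (\<lambda>y. wgt y * rad f y) x)\<^sup>2)"
proof -
  let ?G = "\<lambda>x. ((N - 1) / 2 * coth x + 1 / 2 * inverse (rr x)) * (sh x ^ (CARD('n) - 1) * (rad f x * rad f x))"
  let ?R = "\<lambda>x. ((N - 1) / 2)\<^sup>2 * (rad f x)\<^sup>2 + 1 / 4 * ((rad f x)\<^sup>2 / (rr x)\<^sup>2) + (N\<^sup>2 - 1) / 4 * ((rad f x)\<^sup>2 / (sh x)\<^sup>2)
      + rr x / sh x ^ (CARD('n) - 1) * (rad (\<lambda>y. wgt y * rad f y) x)\<^sup>2"
  note sf = csmooth_on_smooth[OF f] and cr = csm_rad[OF f]
  have cG: "csm ?G"
    by (rule csm_mult_left[OF sm_add[OF sm_mult[OF smooth_on_const sm_coth]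
            sm_mult[OF smooth_on_const sm_irr]]
          csm_sh_power[OF csm_mult_right[OF cr csmooth_on_smooth[OF cr]]]])
  have cGr: "csm (\<lambda>x. sh x * rad ?G x)"
    by (rule csm_mult_left[OF sm_sh csm_rad[OF cG]])
  have cR: "csm ?R" by (intro csm_intros f)
  have "hint (\<lambda>x. (rlap f x)\<^sup>2) = mint (\<lambda>x. sh x ^ CARD('n) * ?R x + sh x * rad ?G x)"
    unfolding hint_def by (rule mint_cong) (use radial_pointwise_identity[OF sf] in \<open>simp add: N_def\<close>)
  also have "\<dots> = hint ?R"
    using mint_add[OF csm_sh_power[OF cR] cGr] mint_rad[OF cG] by (simp add: hint_def)
  also have "\<dots> = ((N - 1) / 2)\<^sup>2 * hint (\<lambda>x. (rad f x)\<^sup>2)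
    + 1 / 4 * hint (\<lambda>x. (rad f x)\<^sup>2 / (rr x)\<^sup>2) + (N\<^sup>2 - 1) / 4 * hint (\<lambda>x. (rad f x)\<^sup>2 / (sh x)\<^sup>2)
    + hint (\<lambda>x. rr x / sh x ^ (CARD('n) - 1) * (rad (\<lambda>y. wgt y * rad f y) x)\<^sup>2)"
  proof -
    have 1: "csm (\<lambda>x. ((N - 1) / 2)\<^sup>2 * (rad f x)\<^sup>2)" by (intro csm_intros f)
    have 2: "csm (\<lambda>x. 1 / 4 * ((rad f x)\<^sup>2 / (rr x)\<^sup>2))" by (intro csm_intros f)
    have 3: "csm (\<lambda>x. (N\<^sup>2 - 1) / 4 * ((rad f x)\<^sup>2 / (sh x)\<^sup>2))" by (intro csm_intros f)
    have 4: "csm (\<lambda>x. rr x / sh x ^ (CARD('n) - 1) * (rad (\<lambda>y. wgt y * rad f y) x)\<^sup>2)" by (intro csm_intros f)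
    note c12 = csm_add[OF 1 2]
    show ?thesis
      by (simp only: hint_add[OF csm_add[OF c12 3] 4] hint_add[OF c12 3] hint_add[OF 1 2] hint_cmult)
  qed
  finally show ?thesis .
qed

section \<open>The full inequality\<close>

definition gsq :: "(real ^ 'n \<Rightarrow> real) \<Rightarrow> real ^ 'n \<Rightarrow> real"
  where "gsq f x = (rad f x)\<^sup>2 + (\<Sum>i\<in>UNIV. (ang i f x)\<^sup>2) / (sh x)\<^sup>2"

lemma csm_gsq: "csm f \<Longrightarrow> csm (gsq f)"
  unfolding gsq_def[abs_def] by (intro csm_intros)

text \<open>The coefficients of the radial Laplacian depend on r alone. After one integration by
  parts on the sphere, this leaves a purely radial problem for each \<open>ang i f\<close>.\<close>

lemma rlap_ang:
  assumes f: "sm f" and x: "x \<in> punct"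
  shows "ang i (rlap f) x = rlap (ang i f) x"
proof -
  have "ang i (\<lambda>x. inverse (sh x)) x = 0"
    using ang_comp[OF sm_sh x DERIV_inverse, of i] sh_pos[OF x] by (simp add: ang_sh[OF x])
  then have c: "ang i coth x = 0"
    by (simp add: coth_def[abs_def] ang_mult[OF sm_ch sm_ish x] ang_ch[OF x])
  note sc = sm_mult[OF smooth_on_const sm_coth] and sr = sm_rad[OF f]
  have rr: "rad (rad (ang i f)) x = ang i (rad (rad f)) x"
    using rad_cong[OF x rad_ang[OF f]] rad_ang[OF sr x] by simp
  show ?thesis
    unfolding rlap_def[abs_def] rr
    by (simp add: ang_add[OF sm_rad[OF sr] sm_mult[OF sc sr] x] ang_mult[OF sc sr x]
        ang_mult[OF smooth_on_const sm_coth x] ang_const c rad_ang[OF f x])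
qed

theorem full_inequality:
  fixes f :: "real ^ 'n \<Rightarrow> real" and N :: real
  defines "N \<equiv> real CARD('n)"
  assumes N5: "CARD('n) \<ge> 5" and f: "csm f"
  shows "hint (\<lambda>x. (rlap f x + slap f x / (sh x)\<^sup>2)\<^sup>2) \<ge> ((N - 1) / 2)\<^sup>2 * hint (gsq f)
    + 1 / 4 * hint (\<lambda>x. gsq f x / (rr x)\<^sup>2) + (N\<^sup>2 - 1) / 4 * hint (\<lambda>x. gsq f x / (sh x)\<^sup>2)
    + hint (\<lambda>x. rr x / sh x ^ (CARD('n) - 1) * gsq (\<lambda>y. wgt y * rad f y) x)"
proof -
  note sf = csmooth_on_smooth[OF f]
  have cg: "csm (ang i f)" for i by (rule csm_ang[OF f])
  have sg: "sm (ang i f)" for i by (rule sm_ang[OF sf])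
  define A where "A i x = (rad (ang i f) x)\<^sup>2 + (((N - 1) / 2)\<^sup>2 * (ang i f x)\<^sup>2 + 1 / 4 * ((ang i f x)\<^sup>2 / (rr x)\<^sup>2)
    + (N\<^sup>2 - 1) / 4 * ((ang i f x)\<^sup>2 / (sh x)\<^sup>2))" for i x
  have cA: "csm (A i)" for i unfolding A_def[abs_def] by (intro csm_intros f)
  \<comment> \<open>The unit of loss: with the factor sinh^N of the volume taken out, the weight is
    1/sinh^4 r.\<close>
  define B where "B i = mint (\<lambda>x. sh x ^ (CARD('n) - 4) * (ang i f x)\<^sup>2)" for i
  have e2: "sh x ^ CARD('n) * (c / (sh x)\<^sup>2) = sh x ^ (CARD('n) - 2) * c"
    and e4: "sh x ^ (CARD('n) - 2) * (c / (sh x)\<^sup>2) = sh x ^ (CARD('n) - 4) * c" if "x \<in> punct" for x :: "real ^ 'n" and c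
  proof -
    have n: "CARD('n) - 2 + 2 = CARD('n)" "CARD('n) - 4 + 2 = CARD('n) - 2" using N5 by auto
    have "sh x ^ CARD('n) = sh x ^ (CARD('n) - 2) * (sh x)\<^sup>2" "sh x ^ (CARD('n) - 2) = sh x ^ (CARD('n) - 4) * (sh x)\<^sup>2"
      unfolding power_add[symmetric] n by (rule refl)+
    then show "sh x ^ CARD('n) * (c / (sh x)\<^sup>2) = sh x ^ (CARD('n) - 2) * c"
      "sh x ^ (CARD('n) - 2) * (c / (sh x)\<^sup>2) = sh x ^ (CARD('n) - 4) * c"
      using sh_pos[OF that] by simp_all
  qed
  have ang_pow: "ang i (\<lambda>x. sh x ^ n) x = 0" if "x \<in> punct" for i n and x :: "real ^ 'n"
    using ang_comp[OF sm_sh that DERIV_pow[of n "sh x"], of i] by (simp add: ang_sh[OF that])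
  have sp: "sm (\<lambda>x :: real ^ 'n. sh x ^ n)" for n by (rule sm_power[OF sm_sh])
  have le_gen: "p * q \<ge> 0 \<Longrightarrow> p * b - 4 * (p * c) \<le> p * (b - 4 * c + q)" for p q b c :: real
    by (simp add: algebra_simps)
  \<comment> \<open>Green's formula on the sphere moves one tangential derivative from
    \<open>slap f\<close> onto \<open>rlap f\<close>; commuting it past the radial Laplacian makes
    the Hardy identity available for each i.\<close>
  have cross: "hint (\<lambda>x. 2 * (rlap f x * slap f x / (sh x)\<^sup>2)) \<ge> (\<Sum>i\<in>UNIV. mint (\<lambda>x. sh x ^ (CARD('n) - 2) * A i x) - 4 * B i)"
  proof -
    have "hint (\<lambda>x. 2 * (rlap f x * slap f x / (sh x)\<^sup>2)) = 2 * mint (\<lambda>x. sh x ^ (CARD('n) - 2) * (slap f x * rlap f x))"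
      unfolding hint_cmult unfolding hint_def
      by (rule arg_cong[of _ _ "\<lambda>c. 2 * c"], rule mint_cong) (simp only: e2 mult.commute)
    also have "\<dots> = 2 * (- (\<Sum>i\<in>UNIV. mint (\<lambda>x. sh x ^ (CARD('n) - 2) * (ang i f x * ang i (rlap f) x))))"
      unfolding slap_def by (rule arg_cong[of _ _ "\<lambda>c. 2 * c"], rule ang_green[OF sp ang_pow f csmooth_on_smooth[OF csm_rlap[OF f]]])
    also have "\<dots> = (\<Sum>i\<in>UNIV. mint (\<lambda>x. - (2 * sh x ^ (CARD('n) - 2) * (rlap (ang i f) x * ang i f x))))"
    proof -
      have "- 2 * mint (\<lambda>x. sh x ^ (CARD('n) - 2) * (ang i f x * ang i (rlap f) x)) =
          mint (\<lambda>x. - (2 * sh x ^ (CARD('n) - 2) * (rlap (ang i f) x * ang i f x)))" for i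
        unfolding mint_cmult[symmetric] by (rule mint_cong) (simp add: rlap_ang[OF sf])
      then show ?thesis by (simp add: sum_distrib_left sum_negf[symmetric])
    qed
    also have "\<dots> \<ge> (\<Sum>i\<in>UNIV. mint (\<lambda>x. sh x ^ (CARD('n) - 2) * A i x) - 4 * B i)"
    proof (rule sum_mono)
      fix i :: 'n
      let ?g = "ang i f"
      let ?G = "\<lambda>x. sh x ^ (CARD('n) - 3) *
        ((- 2) * (rad ?g x * ?g x) + (- ((N + 1) / 2) * coth x + 1 / 2 * inverse (rr x)) * (?g x * ?g x))"
      \<comment> \<open>The completed square and the surplus (N - 4) g^2; both are nonnegative in
        these dimensions and are discarded.\<close>
      let ?Q = "\<lambda>x. (N - 4) * (?g x)\<^sup>2 + (rad ?g x + ((N - 3) / 2 * coth x - inverse (rr x) / 2) * ?g x)\<^sup>2"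
      have cgg: "csm (\<lambda>x. ?g x * ?g x)" by (rule csm_mult_right[OF cg sg])
      have czg: "csm (\<lambda>x. rad ?g x * ?g x)" by (rule csm_mult_right[OF csm_rad[OF cg] sg])
      have cG: "csm ?G"
        by (rule csm_sh_power[OF csm_add[OF csm_cmult[OF czg] csm_mult_left[OF sm_add[OF sm_mult[OF smooth_on_const sm_coth]
                sm_mult[OF smooth_on_const sm_irr]] cgg]]])
      have cGr: "csm (\<lambda>x. sh x * rad ?G x)"
        by (rule csm_mult_left[OF sm_sh csm_rad[OF cG]])
      have sc: "sm (\<lambda>x. (N - 3) / 2 * coth x - inverse (rr x) / 2)"
        by (rule sm_diff[OF sm_mult[OF smooth_on_const sm_coth]
              sm_divide[OF sm_irr smooth_on_const]]) simp
      have cQ: "csm ?Q"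
        by (intro csm_intros cg csm_mult_left[OF sc])
      have cP: "csm (\<lambda>x. sh x ^ (CARD('n) - 2) * (A i x - 4 * ((?g x)\<^sup>2 / (sh x)\<^sup>2) + ?Q x))"
        by (intro csm_intros cg cA csm_mult_left[OF sc])
      have "mint (\<lambda>x. - (2 * sh x ^ (CARD('n) - 2) * (rlap ?g x * ?g x))) =
          mint (\<lambda>x. sh x ^ (CARD('n) - 2) * (A i x - 4 * ((?g x)\<^sup>2 / (sh x)\<^sup>2) + ?Q x) + sh x * rad ?G x)"
      proof (rule mint_cong)
        fix x :: "real ^ 'n" assume x: "x \<in> punct"
        have "CARD('n) \<ge> 3" using N5 by simp
        from hardy_pointwise_identity[OF this sg x, of i]
        show "- (2 * sh x ^ (CARD('n) - 2) * (rlap ?g x * ?g x)) =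
          sh x ^ (CARD('n) - 2) * (A i x - 4 * ((?g x)\<^sup>2 / (sh x)\<^sup>2) + ?Q x) + sh x * rad ?G x"
          unfolding A_def N_def by (simp only: add.assoc)
      qed
      also have "\<dots> = mint (\<lambda>x. sh x ^ (CARD('n) - 2) * (A i x - 4 * ((?g x)\<^sup>2 / (sh x)\<^sup>2) + ?Q x))"
        using mint_add[OF cP cGr] mint_rad[OF cG] by simp
      also have "\<dots> \<ge> mint (\<lambda>x. sh x ^ (CARD('n) - 2) * A i x - 4 * (sh x ^ (CARD('n) - 4) * (?g x)\<^sup>2))"
      proof (rule mint_mono[OF _ cP])
        show "csm (\<lambda>x. sh x ^ (CARD('n) - 2) * A i x - 4 * (sh x ^ (CARD('n) - 4) * (?g x)\<^sup>2))"
          by (intro csm_intros cA cg)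
        fix x :: "real ^ 'n" assume x: "x \<in> punct"
        have "?Q x \<ge> 0" using N5 by (simp add: N_def)
        then have "sh x ^ (CARD('n) - 2) * ?Q x \<ge> 0" using sh_pos[OF x] by simp
        then show "sh x ^ (CARD('n) - 2) * A i x - 4 * (sh x ^ (CARD('n) - 4) * (?g x)\<^sup>2) \<le>
            sh x ^ (CARD('n) - 2) * (A i x - 4 * ((?g x)\<^sup>2 / (sh x)\<^sup>2) + ?Q x)"
          unfolding e4[OF x, symmetric] by (simp only: le_gen)
      qed
      also have "mint (\<lambda>x. sh x ^ (CARD('n) - 2) * A i x - 4 * (sh x ^ (CARD('n) - 4) * (?g x)\<^sup>2)) =
          mint (\<lambda>x. sh x ^ (CARD('n) - 2) * A i x) - 4 * B i"
        unfolding B_def mint_cmult[symmetric] by (rule mint_diff) (intro csm_intros cA cg)+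
      finally show "mint (\<lambda>x. sh x ^ (CARD('n) - 2) * A i x) - 4 * B i \<le>
          mint (\<lambda>x. - (2 * sh x ^ (CARD('n) - 2) * (rlap ?g x * ?g x)))" .
    qed
    finally show ?thesis .
  qed
  \<comment> \<open>The spectral gap with radial weight sinh^(N-4) supplies N - 1 copies of the sum
    of the \<open>B i\<close>; dimension at least 5 makes these enough for the four that the cross
    term loses.\<close>
  have sphere: "hint (\<lambda>x. (slap f x / (sh x)\<^sup>2)\<^sup>2) \<ge> 4 * (\<Sum>i\<in>UNIV. B i)"
  proof -
    have "hint (\<lambda>x. (slap f x / (sh x)\<^sup>2)\<^sup>2) = mint (\<lambda>x. sh x ^ (CARD('n) - 4) * (slap f x)\<^sup>2)"
      unfolding hint_def
    proof (rule mint_cong)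
      fix x :: "real ^ 'n" assume x: "x \<in> punct"
      have "(slap f x / (sh x)\<^sup>2)\<^sup>2 = (slap f x)\<^sup>2 / (sh x)\<^sup>2 / (sh x)\<^sup>2"
        by (simp add: power2_eq_square)
      then show "sh x ^ CARD('n) * (slap f x / (sh x)\<^sup>2)\<^sup>2 = sh x ^ (CARD('n) - 4) * (slap f x)\<^sup>2"
        by (simp only: e2[OF x] e4[OF x])
    qed
    also have "\<dots> \<ge> (real CARD('n) - 1) * mint (\<lambda>x. sh x ^ (CARD('n) - 4) * (\<Sum>i\<in>UNIV. (ang i f x)\<^sup>2))"
      unfolding slap_def
      by (rule ang_laplacian_spectral_gap[OF _ sp ang_pow _ f]) (use N5 in \<open>auto simp: less_imp_le[OF sh_pos]\<close>)
    also have "mint (\<lambda>x. sh x ^ (CARD('n) - 4) * (\<Sum>i\<in>UNIV. (ang i f x)\<^sup>2)) = (\<Sum>i\<in>UNIV. B i)"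
      unfolding B_def sum_distrib_left by (rule mint_sum[OF finite]) (intro csm_intros cg)
    finally have 1: "(real CARD('n) - 1) * (\<Sum>i\<in>UNIV. B i) \<le> hint (\<lambda>x. (slap f x / (sh x)\<^sup>2)\<^sup>2)" .
    have "B i \<ge> 0" for i unfolding B_def by (rule mint_nonneg) (simp add: less_imp_le[OF sh_pos])
    then have "4 * (\<Sum>i\<in>UNIV. B i) \<le> (real CARD('n) - 1) * (\<Sum>i\<in>UNIV. B i)"
      using N5 by (intro mult_right_mono sum_nonneg) auto
    with 1 show ?thesis by linarith
  qed
  have c1: "csm (\<lambda>x. (rlap f x)\<^sup>2)" by (intro csm_intros csm_rlap f)
  have c2: "csm (\<lambda>x. 2 * (rlap f x * slap f x / (sh x)\<^sup>2))"
    by (intro csm_intros csm_mult_right[OF csm_rlap[OF f] csmooth_on_smooth[OF csm_slap[OF f]]])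
  have c3: "csm (\<lambda>x. (slap f x / (sh x)\<^sup>2)\<^sup>2)" by (intro csm_intros csm_slap f)
  have "hint (\<lambda>x. (rlap f x + slap f x / (sh x)\<^sup>2)\<^sup>2) =
      hint (\<lambda>x. (rlap f x)\<^sup>2 + 2 * (rlap f x * slap f x / (sh x)\<^sup>2) + (slap f x / (sh x)\<^sup>2)\<^sup>2)"
    by (rule hint_cong) (simp add: power2_sum)
  also have "\<dots> = hint (\<lambda>x. (rlap f x)\<^sup>2) + hint (\<lambda>x. 2 * (rlap f x * slap f x / (sh x)\<^sup>2)) + hint (\<lambda>x. (slap f x / (sh x)\<^sup>2)\<^sup>2)"
    by (simp only: hint_add[OF csm_add[OF c1 c2] c3] hint_add[OF c1 c2])
  \<comment> \<open>The loss in \<open>cross\<close> and the gain in \<open>sphere\<close> cancel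
    exactly.\<close>
  also have "\<dots> \<ge> hint (\<lambda>x. (rlap f x)\<^sup>2) + (\<Sum>i\<in>UNIV. mint (\<lambda>x. sh x ^ (CARD('n) - 2) * A i x))"
    using cross sphere by (simp add: sum_subtractf sum_distrib_left)
  also have "hint (\<lambda>x. (rlap f x)\<^sup>2) + (\<Sum>i\<in>UNIV. mint (\<lambda>x. sh x ^ (CARD('n) - 2) * A i x)) =
    ((N - 1) / 2)\<^sup>2 * hint (gsq f)
    + 1 / 4 * hint (\<lambda>x. gsq f x / (rr x)\<^sup>2) + (N\<^sup>2 - 1) / 4 * hint (\<lambda>x. gsq f x / (sh x)\<^sup>2)
    + hint (\<lambda>x. rr x / sh x ^ (CARD('n) - 1) * gsq (\<lambda>y. wgt y * rad f y) x)"
  proof -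
    define T where "T x = (\<Sum>i\<in>UNIV. (ang i f x)\<^sup>2) / (sh x)\<^sup>2" for x
    define U where "U x = (\<Sum>i\<in>UNIV. (rad (ang i f) x)\<^sup>2) / (sh x)\<^sup>2" for x
    have cT: "csm T" unfolding T_def[abs_def] by (intro csm_intros f)
    have cU: "csm U" unfolding U_def[abs_def] by (intro csm_intros f)
    have cr: "csm (\<lambda>x. (rad f x)\<^sup>2)" by (intro csm_intros f)
    have cw: "csm (\<lambda>x. rr x / sh x ^ (CARD('n) - 1) * (rad (\<lambda>y. wgt y * rad f y) x)\<^sup>2)"
      by (intro csm_intros f)
    have "(\<Sum>i\<in>UNIV. mint (\<lambda>x. sh x ^ (CARD('n) - 2) * A i x)) = mint (\<lambda>x. \<Sum>i\<in>UNIV. sh x ^ (CARD('n) - 2) * A i x)"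
      by (rule mint_sum[symmetric, OF finite csm_sh_power[OF cA]])
    also have "\<dots> = hint (\<lambda>x. U x + ((N - 1) / 2)\<^sup>2 * T x + 1 / 4 * (T x / (rr x)\<^sup>2) + (N\<^sup>2 - 1) / 4 * (T x / (sh x)\<^sup>2))"
      unfolding hint_def
    proof (rule mint_cong)
      fix x :: "real ^ 'n" assume x: "x \<in> punct"
      have "(\<Sum>i\<in>UNIV. A i x) = (sh x)\<^sup>2 * (U x + ((N - 1) / 2)\<^sup>2 * T x + 1 / 4 * (T x / (rr x)\<^sup>2) + (N\<^sup>2 - 1) / 4 * (T x / (sh x)\<^sup>2))"
        using sh_pos[OF x] rr_pos[OF x]
        unfolding A_def T_def U_def sum.distrib sum_distrib_left[symmetric] sum_divide_distrib[symmetric]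
        by (simp add: field_simps)
      then have "(\<Sum>i\<in>UNIV. A i x) / (sh x)\<^sup>2 = U x + ((N - 1) / 2)\<^sup>2 * T x + 1 / 4 * (T x / (rr x)\<^sup>2) + (N\<^sup>2 - 1) / 4 * (T x / (sh x)\<^sup>2)"
        using sh_pos[OF x] by simp
      then show "(\<Sum>i\<in>UNIV. sh x ^ (CARD('n) - 2) * A i x) = sh x ^ CARD('n) *
          (U x + ((N - 1) / 2)\<^sup>2 * T x + 1 / 4 * (T x / (rr x)\<^sup>2) + (N\<^sup>2 - 1) / 4 * (T x / (sh x)\<^sup>2))"
        using e2[OF x, of "\<Sum>i\<in>UNIV. A i x"] by (simp only: sum_distrib_left)
    qed
    also have "\<dots> = hint U + ((N - 1) / 2)\<^sup>2 * hint T + 1 / 4 * hint (\<lambda>x. T x / (rr x)\<^sup>2) + (N\<^sup>2 - 1) / 4 * hint (\<lambda>x. T x / (sh x)\<^sup>2)"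
    proof -
      have 1: "csm (\<lambda>x. ((N - 1) / 2)\<^sup>2 * T x)" by (intro csm_intros cT)
      have 2: "csm (\<lambda>x. 1 / 4 * (T x / (rr x)\<^sup>2))" by (intro csm_intros cT)
      have 3: "csm (\<lambda>x. (N\<^sup>2 - 1) / 4 * (T x / (sh x)\<^sup>2))" by (intro csm_intros cT)
      note c01 = csm_add[OF cU 1]
      show ?thesis
        by (simp only: hint_add[OF csm_add[OF c01 2] 3] hint_add[OF c01 2] hint_add[OF cU 1] hint_cmult)
    qed
    finally have S: "(\<Sum>i\<in>UNIV. mint (\<lambda>x. sh x ^ (CARD('n) - 2) * A i x)) =
      hint U + ((N - 1) / 2)\<^sup>2 * hint T + 1 / 4 * hint (\<lambda>x. T x / (rr x)\<^sup>2) + (N\<^sup>2 - 1) / 4 * hint (\<lambda>x. T x / (sh x)\<^sup>2)" .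
    have g1: "hint (gsq f) = hint (\<lambda>x. (rad f x)\<^sup>2) + hint T"
      using hint_add[OF cr cT] by (simp add: gsq_def[abs_def] T_def[abs_def])
    have g2: "hint (\<lambda>x. gsq f x / (rr x)\<^sup>2) = hint (\<lambda>x. (rad f x)\<^sup>2 / (rr x)\<^sup>2) + hint (\<lambda>x. T x / (rr x)\<^sup>2)"
      using hint_add[OF csm_div_rr[OF cr] csm_div_rr[OF cT], of 2 2] by (simp add: gsq_def[abs_def] T_def[abs_def] add_divide_distrib)
    have g3: "hint (\<lambda>x. gsq f x / (sh x)\<^sup>2) = hint (\<lambda>x. (rad f x)\<^sup>2 / (sh x)\<^sup>2) + hint (\<lambda>x. T x / (sh x)\<^sup>2)"
      using hint_add[OF csm_div_sh[OF cr] csm_div_sh[OF cT], of 2 2] by (simp add: gsq_def[abs_def] T_def[abs_def] add_divide_distrib)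
    \<comment> \<open>\<open>wgt\<close> is radial and \<open>rad\<close> commutes with
      \<open>ang i\<close>, so the tangential part of the remainder is the
      \<open>rad (ang i f)\<close> squares that the Hardy identity kept aside; that is
      \<open>U\<close>.\<close>
    have g4: "hint (\<lambda>x. rr x / sh x ^ (CARD('n) - 1) * gsq (\<lambda>y. wgt y * rad f y) x) =
        hint (\<lambda>x. rr x / sh x ^ (CARD('n) - 1) * (rad (\<lambda>y. wgt y * rad f y) x)\<^sup>2) + hint U"
      unfolding hint_add[OF cw cU, symmetric]
    proof (rule hint_cong)
      fix x :: "real ^ 'n" assume x: "x \<in> punct"
      have "ang i (\<lambda>y. wgt y * rad f y) x = wgt x * rad (ang i f) x" for i
        using ang_mult[OF sm_wgt sm_rad[OF sf] x, of i] by (simp add: ang_wgt[OF x] rad_ang[OF sf x])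
      then have "rr x / sh x ^ (CARD('n) - 1) * ((\<Sum>i\<in>UNIV. (ang i (\<lambda>y. wgt y * rad f y) x)\<^sup>2) / (sh x)\<^sup>2) =
          (rr x / sh x ^ (CARD('n) - 1) * (wgt x)\<^sup>2) * U x"
        by (simp add: U_def power_mult_distrib sum_distrib_left[symmetric])
      then show "rr x / sh x ^ (CARD('n) - 1) * gsq (\<lambda>y. wgt y * rad f y) x =
          rr x / sh x ^ (CARD('n) - 1) * (rad (\<lambda>y. wgt y * rad f y) x)\<^sup>2 + U x"
        unfolding gsq_def wgt_sq[OF x] distrib_left by simp
    qed
    show ?thesis
      unfolding S g1 g2 g3 g4 radial_identity[OF f] N_def by (simp add: algebra_simps)
  qed
  finally show ?thesis .
qed

section \<open>Transport by Moebius translations\<close>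

lemma open_hyp_space [simp]: "open hyp_space"
  by (simp add: hyp_space_def)

lemma hyp_space_minus: "p \<in> hyp_space \<Longrightarrow> - p \<in> hyp_space"
  by (simp add: hyp_space_def)

lemma hyp_space_norm2: "x \<in> hyp_space \<Longrightarrow> (norm x)\<^sup>2 < 1"
  by (simp add: hyp_space_def abs_square_less_1)

lemma mobius_add_cancel': "p \<in> hyp_space \<Longrightarrow> x \<in> hyp_space \<Longrightarrow> mobius_add (- p) (mobius_add p x) = x"
  using mobius_add_cancel[of "- p" x] by (simp add: hyp_space_minus)

definition mdiv :: "real ^ 'n \<Rightarrow> real ^ 'n \<Rightarrow> real"
  where "mdiv p x = 1 + 2 * (p \<bullet> x) + (norm p)\<^sup>2 * (norm x)\<^sup>2"

lemma mdiv_pos: "p \<in> hyp_space \<Longrightarrow> x \<in> hyp_space \<Longrightarrow> mdiv p x > 0"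
  unfolding mdiv_def by (rule mobius_denom_pos)

lemma smooth_on_mdiv: "smooth_on hyp_space (mdiv p)"
  unfolding mdiv_def[abs_def]
  by (rule smooth_on_add[OF open_hyp_space smooth_on_add[OF open_hyp_space smooth_on_const
        smooth_on_mult[OF open_hyp_space smooth_on_const smooth_on_vec[OF open_hyp_space]]]
      smooth_on_mult[OF open_hyp_space smooth_on_const smooth_on_norm2[OF open_hyp_space]]])

lemma smooth_on_mobius:
  assumes "p \<in> hyp_space"
  shows "smooth_on hyp_space (\<lambda>x. mobius_add p x $ k)"
proof -
  have "smooth_on hyp_space (\<lambda>x. ((1 + 2 * (p \<bullet> x) + (norm x)\<^sup>2) * p $ k + (1 - (norm p)\<^sup>2) * x $ k) / mdiv p x)"
    by (rule smooth_on_divide[OF open_hyp_space smooth_on_add[OF open_hyp_space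
          smooth_on_mult[OF open_hyp_space smooth_on_add[OF open_hyp_space smooth_on_add[OF open_hyp_space smooth_on_const
              smooth_on_mult[OF open_hyp_space smooth_on_const smooth_on_vec[OF open_hyp_space]]] smooth_on_norm2[OF open_hyp_space]]
            smooth_on_const]
          smooth_on_mult[OF open_hyp_space smooth_on_const smooth_on_coord]] smooth_on_mdiv])
      (use mdiv_pos[OF assms] in fastforce)
  then show ?thesis by (simp add: mobius_add_def mdiv_def divide_inverse mult.commute)
qed

lemma mobius_add_eq_iff:
  "p \<in> hyp_space \<Longrightarrow> x \<in> hyp_space \<Longrightarrow> mobius_add p x = p \<longleftrightarrow> x = 0"
proof -
  assume a: "p \<in> hyp_space" "x \<in> hyp_space"
  have "mobius_add p 0 = p" by (simp add: mobius_add_def)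
  then show ?thesis using mobius_add_cancel'[OF a] mobius_add_cancel'[OF a(1), of 0]
    by (auto simp: hyp_space_def)
qed

lemma mobius_maps:
  assumes p: "p \<in> hyp_space"
  shows "x \<in> punct \<Longrightarrow> mobius_add p x \<in> hyp_space - {p} \<and> mobius_add (- p) (mobius_add p x) = x"
    and "y \<in> hyp_space - {p} \<Longrightarrow> mobius_add (- p) y \<in> punct \<and> mobius_add p (mobius_add (- p) y) = y"
proof -
  show "x \<in> punct \<Longrightarrow> mobius_add p x \<in> hyp_space - {p} \<and> mobius_add (- p) (mobius_add p x) = x"
    using mobius_add_in[OF p] mobius_add_cancel'[OF p] mobius_add_eq_iff[OF p, of x] by (auto simp: punct_def)
  assume y: "y \<in> hyp_space - {p}"
  have c: "mobius_add p (mobius_add (- p) y) = y" using mobius_add_cancel[OF p] y by blast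
  have "mobius_add (- p) y \<in> hyp_space" using mobius_add_in[OF hyp_space_minus[OF p]] y by blast
  moreover have "mobius_add (- p) y \<noteq> 0" using c y by (auto simp: mobius_add_def)
  ultimately show "mobius_add (- p) y \<in> punct \<and> mobius_add p (mobius_add (- p) y) = y"
    using c by (simp add: punct_def)
qed

definition mfac :: "real ^ 'n \<Rightarrow> real ^ 'n \<Rightarrow> real"
  where "mfac p x = (1 - (norm p)\<^sup>2) / mdiv p x"

lemma mfac_pos: "p \<in> hyp_space \<Longrightarrow> x \<in> hyp_space \<Longrightarrow> mfac p x > 0"
  using mdiv_pos[of p x] hyp_space_norm2[of p] by (simp add: mfac_def)

text \<open>Together with \<open>norm_mder\<close> this is the isometry property of the translation:
  the conformal factor of the map compensates the change of \<open>conf\<close>.\<close>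

lemma conf_mobius:
  assumes "p \<in> hyp_space" "x \<in> hyp_space"
  shows "mfac p x * conf (mobius_add p x) = conf x"
proof -
  have "q / D * (2 / (q * X / D)) = 2 / X" if "D > 0" "q > 0" for q D X :: real
    using that by simp
  from this[OF mdiv_pos[OF assms], of "1 - (norm p)\<^sup>2" "1 - (norm x)\<^sup>2"] hyp_space_norm2[OF assms(1)]
  show ?thesis
    unfolding conf_def norm_mobius_add[OF assms] mfac_def mdiv_def by simp
qed

lemma conf_pos: "x \<in> hyp_space \<Longrightarrow> conf x > 0"
  using hyp_space_norm2[of x] by (simp add: conf_def)

definition mder :: "real ^ 'n \<Rightarrow> real ^ 'n \<Rightarrow> real ^ 'n \<Rightarrow> real ^ 'n"
  where "mder p x v = (\<chi> k. \<Sum>i\<in>UNIV. v $ i * partial i (\<lambda>x. mobius_add p x $ k) x)"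

lemma mobius_has_derivative:
  "p \<in> hyp_space \<Longrightarrow> x \<in> hyp_space \<Longrightarrow> (mobius_add p has_derivative mder p x) (at x)"
  using has_derivative_vec_partial[of hyp_space "mobius_add p" x] smooth_on_mobius[of p]
  by (simp add: mder_def[abs_def])

text \<open>The quotient rule makes the derivative explicit, and the claim becomes a polynomial
  identity in the six scalar products of \<open>p\<close>, \<open>x\<close> and
  \<open>v\<close>.\<close>

lemma norm_mder:
  assumes p: "p \<in> hyp_space" and x: "x \<in> hyp_space"
  shows "norm (mder p x v) = mfac p x * norm v"
proof -
  define A where "A = 1 + 2 * (p \<bullet> x) + (norm x)\<^sup>2"
  define b where "b = 1 - (norm p)\<^sup>2"
  define D where "D = mdiv p x"
  define A' where "A' = 2 * (p \<bullet> v) + 2 * (x \<bullet> v)"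
  define D' where "D' = 2 * (p \<bullet> v) + (norm p)\<^sup>2 * (2 * (x \<bullet> v))"
  define w where "w = (D * A' - D' * A) *\<^sub>R p + (D * b) *\<^sub>R v - (D' * b) *\<^sub>R x"
  have D: "D > 0" using mdiv_pos[OF p x] by (simp add: D_def)
  have b: "b > 0" using hyp_space_norm2[OF p] by (simp add: b_def)
  have n2: "((\<lambda>x. (norm x)\<^sup>2) has_derivative (\<lambda>v. 2 * (x \<bullet> v))) (at x)"
    unfolding power2_norm_eq_inner
    by (auto intro!: derivative_eq_intros simp: inner_commute)
  have num: "((\<lambda>x. (1 + 2 * (p \<bullet> x) + (norm x)\<^sup>2) *\<^sub>R p + (1 - (norm p)\<^sup>2) *\<^sub>R x) has_derivative
      (\<lambda>v. (2 * (p \<bullet> v) + 2 * (x \<bullet> v)) *\<^sub>R p + (1 - (norm p)\<^sup>2) *\<^sub>R v)) (at x)"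
    by (auto intro!: derivative_eq_intros n2)
  have den: "(mdiv p has_derivative (\<lambda>v. 2 * (p \<bullet> v) + (norm p)\<^sup>2 * (2 * (x \<bullet> v)))) (at x)"
    unfolding mdiv_def[abs_def] by (auto intro!: derivative_eq_intros n2)
  have inv: "((\<lambda>x. inverse (mdiv p x)) has_derivative
      (\<lambda>v. - (inverse D * (2 * (p \<bullet> v) + (norm p)\<^sup>2 * (2 * (x \<bullet> v))) * inverse D))) (at x)"
    using Deriv.has_derivative_inverse[OF _ den] D by (simp add: D_def)
  have "(mobius_add p has_derivative (\<lambda>v. inverse D *\<^sub>R ((2 * (p \<bullet> v) + 2 * (x \<bullet> v)) *\<^sub>R p + (1 - (norm p)\<^sup>2) *\<^sub>R v)
      + (- (inverse D * (2 * (p \<bullet> v) + (norm p)\<^sup>2 * (2 * (x \<bullet> v))) * inverse D)) *\<^sub>R (A *\<^sub>R p + b *\<^sub>R x))) (at x)"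
    using has_derivative_scaleR[OF inv num] by (simp add: mobius_add_def[abs_def] mdiv_def[symmetric] A_def b_def D_def)
  from has_derivative_unique[OF mobius_has_derivative[OF p x] this]
  have m: "mder p x v = inverse D *\<^sub>R (A' *\<^sub>R p + b *\<^sub>R v) + (- (inverse D * D' * inverse D)) *\<^sub>R (A *\<^sub>R p + b *\<^sub>R x)"
    by (simp add: A'_def D'_def b_def)
  also have "\<dots> = inverse (D * D) *\<^sub>R w"
    unfolding vec_eq_iff using D by (simp add: w_def field_simps)
  finally have m: "norm (mder p x v) = norm w / (D * D)" using D by (simp add: divide_inverse mult.commute)
  define s where "s = p \<bullet> x"
  define X where "X = x \<bullet> x"
  define P where "P = p \<bullet> p"
  define \<alpha> where "\<alpha> = p \<bullet> v"
  define \<beta> where "\<beta> = x \<bullet> v"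
  define V where "V = v \<bullet> v"
  have e: "A = 1 + 2 * s + X" "b = 1 - P" "D = 1 + 2 * s + P * X" "A' = 2 * \<alpha> + 2 * \<beta>" "D' = 2 * \<alpha> + P * (2 * \<beta>)"
    by (simp_all add: A_def b_def D_def mdiv_def A'_def D'_def s_def X_def P_def \<alpha>_def \<beta>_def power2_norm_eq_inner)
  \<comment> \<open>What is left of the coefficient of \<open>p\<close> in \<open>w\<close> once
    \<open>2 * b\<close> is split off. All three coefficients of \<open>w\<close> then contain
    \<open>b\<close>, and the bracket that remains in its squared norm collapses to D^2 V.\<close>
  define E where "E = \<beta> * (1 + 2 * s) - \<alpha> * X"
  have E: "D * A' - D' * A = 2 * b * E"
    unfolding e E_def by (simp add: algebra_simps)
  have "(norm w)\<^sup>2 = (D * A' - D' * A)\<^sup>2 * P + (D * b)\<^sup>2 * V + (D' * b)\<^sup>2 * X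
      + 2 * (D * A' - D' * A) * (D * b) * \<alpha> - 2 * (D * A' - D' * A) * (D' * b) * s - 2 * (D * b) * (D' * b) * \<beta>"
    unfolding power2_norm_eq_inner w_def P_def V_def X_def \<alpha>_def s_def \<beta>_def
    by (simp add: inner_add_left inner_add_right inner_diff_left inner_diff_right inner_commute[of x p] inner_commute[of v p]
        inner_commute[of v x] power2_eq_square) (simp add: algebra_simps)
  also have "\<dots> = b\<^sup>2 * (4 * E\<^sup>2 * P + D\<^sup>2 * V + D'\<^sup>2 * X + 4 * E * D * \<alpha> - 4 * E * D' * s - 2 * D * D' * \<beta>)"
    unfolding E by (simp add: power2_eq_square algebra_simps)
  also have "4 * E\<^sup>2 * P + D\<^sup>2 * V + D'\<^sup>2 * X + 4 * E * D * \<alpha> - 4 * E * D' * s - 2 * D * D' * \<beta> = D\<^sup>2 * V"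
    unfolding e E_def by (simp add: power2_eq_square algebra_simps)
  also have "b\<^sup>2 * (D\<^sup>2 * V) = (b * D * norm v)\<^sup>2"
    by (simp add: V_def power_mult_distrib power2_norm_eq_inner)
  finally have "norm w = b * D * norm v"
    using b D by (simp add: power2_eq_iff_nonneg)
  then show ?thesis using D by (simp add: m mfac_def b_def D_def)
qed

text \<open>By the chain rule gradients are pulled back by the transposed derivative. After division
  by \<open>c\<close> the map is orthogonal, and so is its transpose.\<close>

lemma conformal_transpose:
  fixes L :: "real ^ 'n \<Rightarrow> real ^ 'n"
  assumes L: "linear L" "c > 0" "\<And>v. norm (L v) = c * norm v"
  shows "(\<Sum>i\<in>UNIV. (\<Sum>k\<in>UNIV. L (axis i 1) $ k * a $ k) * (\<Sum>k\<in>UNIV. L (axis i 1) $ k * b $ k)) = c\<^sup>2 * (a \<bullet> b)"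
proof -
  define h where "h v = (1 / c) *\<^sub>R L v" for v
  have "orthogonal_transformation h"
    using assms by (simp add: orthogonal_transformation h_def[abs_def] linear_compose_scale_right)
  then have "orthogonal_matrix (matrix h)" by (simp add: orthogonal_transformation_matrix)
  then have "orthogonal_matrix (transpose (matrix h))" by simp
  then have o: "orthogonal_transformation ((*v) (transpose (matrix h)))"
    by (simp add: orthogonal_transformation_matrix)
  have comp: "(\<Sum>k\<in>UNIV. L (axis i 1) $ k * z $ k) = c * (transpose (matrix h) *v z) $ i" for i z
    using L(2) by (simp add: matrix_vector_mult_def transpose_def matrix_def h_def sum_distrib_left)
  have "(transpose (matrix h) *v a) \<bullet> (transpose (matrix h) *v b) = a \<bullet> b"
    using o by (simp add: orthogonal_transformation_def)
  then have "c\<^sup>2 * (a \<bullet> b) = c\<^sup>2 * ((transpose (matrix h) *v a) \<bullet> (transpose (matrix h) *v b))" by simp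
  also have "\<dots> = (\<Sum>i\<in>UNIV. (c * (transpose (matrix h) *v a) $ i) * (c * (transpose (matrix h) *v b) $ i))"
    by (simp add: inner_vec_def sum_distrib_left power2_eq_square algebra_simps)
  finally show ?thesis by (simp only: comp)
qed

lemma gradient_mobius:
  fixes u v :: "real ^ 'n \<Rightarrow> real"
  assumes p: "p \<in> hyp_space" and y: "y \<in> punct"
    and u: "smooth_on (hyp_space - {p}) u" and v: "smooth_on (hyp_space - {p}) v"
  shows "(\<Sum>i\<in>UNIV. partial i (\<lambda>y. u (mobius_add p y)) y * partial i (\<lambda>y. v (mobius_add p y)) y) =
    (mfac p y)\<^sup>2 * (\<Sum>i\<in>UNIV. partial i u (mobius_add p y) * partial i v (mobius_add p y))"
proof -
  have yh: "y \<in> hyp_space" using y by (simp add: punct_def)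
  have in': "mobius_add p y \<in> hyp_space - {p}" using mobius_maps(1)[OF p y] by blast
  have a: "mder p y (axis i 1) $ k = partial i (\<lambda>x. mobius_add p x $ k) y" for i k
    by (simp add: mder_def sum_axis)
  have pc: "partial i (\<lambda>y. g (mobius_add p y)) y =
      (\<Sum>k\<in>UNIV. mder p y (axis i 1) $ k * (\<chi> k. partial k g (mobius_add p y)) $ k)"
    if "smooth_on (hyp_space - {p}) g" for g i
    unfolding a using partial_vcomp(2)[OF that in' smooth_on_mobius[OF p] yh] by simp
  show ?thesis
    unfolding pc[OF u] pc[OF v]
    using conformal_transpose[OF has_derivative_linear[OF mobius_has_derivative[OF p yh]] mfac_pos[OF p yh] norm_mder[OF p yh],
        of "\<chi> k. partial k u (mobius_add p y)" "\<chi> k. partial k v (mobius_add p y)"]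
    by (simp add: inner_vec_def)
qed

text \<open>A relation on \<open>punct\<close> instead of a composition: values at the pole and
  outside the ball stay unconstrained, and an operator applied to a related pair gives a related
  pair to which the next operator applies.\<close>

definition pullback :: "real ^ 'n \<Rightarrow> (real ^ 'n \<Rightarrow> real) \<Rightarrow> (real ^ 'n \<Rightarrow> real) \<Rightarrow> bool"
  where "pullback p u w \<longleftrightarrow> (\<forall>y\<in>punct. u (mobius_add p y) = w y)"

lemma csmooth_on_vcomp:
  fixes S S' :: "(real ^ 'n) set"
  assumes S: "open S" and u: "csmooth_on S' u" and \<phi>: "\<And>x. x \<in> S \<Longrightarrow> \<phi> x \<in> S' \<and> \<psi> (\<phi> x) = x"
    "\<And>k. smooth_on S (\<lambda>x. \<phi> x $ k)" and \<psi>: "\<And>y. y \<in> S' \<Longrightarrow> \<psi> y \<in> S" "continuous_on S' \<psi>"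
  shows "csmooth_on S (\<lambda>x. u (\<phi> x))"
proof -
  obtain K where K: "compact K" "K \<subseteq> S'" "\<forall>x\<in>S' - K. u x = 0" using u by (auto simp: csmooth_on_def)
  show ?thesis
  proof (rule csmooth_onI)
    show "smooth_on S (\<lambda>x. u (\<phi> x))"
      by (rule smooth_on_vcomp[OF S csmooth_on_smooth[OF u] _ \<phi>(2)]) (use \<phi>(1) in blast)
    show "compact (\<psi> ` K)" using K \<psi>(2) continuous_on_subset compact_continuous_image by blast
    show "\<psi> ` K \<subseteq> S" using K \<psi>(1) by blast
    fix x assume "x \<in> S" "x \<notin> \<psi> ` K"
    then have "\<phi> x \<in> S' - K" using \<phi>(1)[of x] by force
    then show "u (\<phi> x) = 0" using K by blast
  qed
qed

lemma continuous_on_mobius: "p \<in> hyp_space \<Longrightarrow> continuous_on hyp_space (mobius_add p)"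
  by (intro continuous_at_imp_continuous_on ballI has_derivative_continuous[OF mobius_has_derivative])

lemma open_hyp_minus [simp]: "open (hyp_space - {p})"
  by auto

lemma smooth_on_conf: "smooth_on hyp_space conf"
  unfolding conf_def[abs_def]
  by (rule smooth_on_divide[OF open_hyp_space smooth_on_const
        smooth_on_diff[OF open_hyp_space smooth_on_const smooth_on_norm2[OF open_hyp_space]]])
    (use hyp_space_norm2 in fastforce)

lemma sh_conf: "sh x = norm x * conf x"
  by (simp add: sh_def conf_def)

section \<open>Functions and integrals about an arbitrary pole\<close>

context
  fixes p :: "real ^ 'n"
  assumes p: "p \<in> hyp_space"
begin

lemma mobius_vcomp:
  shows "csmooth_on (hyp_space - {p}) u \<Longrightarrow> csm (\<lambda>y. u (mobius_add p y))"
    and "csm w \<Longrightarrow> csmooth_on (hyp_space - {p}) (\<lambda>x. w (mobius_add (- p) x))"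
    and "smooth_on (hyp_space - {p}) u \<Longrightarrow> sm (\<lambda>y. u (mobius_add p y))"
    and "sm w \<Longrightarrow> smooth_on (hyp_space - {p}) (\<lambda>x. w (mobius_add (- p) x))"
proof -
  note p' = hyp_space_minus[OF p]
  have s: "smooth_on punct (\<lambda>x. mobius_add p x $ k)" "smooth_on (hyp_space - {p}) (\<lambda>x. mobius_add (- p) x $ k)" for k
    by (rule smooth_on_subset[OF smooth_on_mobius[OF p]], force simp: punct_def)
      (rule smooth_on_subset[OF smooth_on_mobius[OF p']], blast)
  have c: "continuous_on punct (mobius_add p)" "continuous_on (hyp_space - {p}) (mobius_add (- p))"
    by (rule continuous_on_subset[OF continuous_on_mobius[OF p]], force simp: punct_def)
      (rule continuous_on_subset[OF continuous_on_mobius[OF p']], blast)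
  show "csmooth_on (hyp_space - {p}) u \<Longrightarrow> csm (\<lambda>y. u (mobius_add p y))"
    by (rule csmooth_on_vcomp[OF open_punct _ mobius_maps(1)[OF p] s(1) _ c(2)]) (use mobius_maps(2)[OF p] in blast)+
  show "csm w \<Longrightarrow> csmooth_on (hyp_space - {p}) (\<lambda>x. w (mobius_add (- p) x))"
    by (rule csmooth_on_vcomp[OF open_hyp_minus _ mobius_maps(2)[OF p] s(2) _ c(1)]) (use mobius_maps(1)[OF p] in blast)+
  show "smooth_on (hyp_space - {p}) u \<Longrightarrow> sm (\<lambda>y. u (mobius_add p y))"
    by (rule smooth_on_vcomp[OF open_punct _ _ s(1)]) (use mobius_maps(1)[OF p] in blast)+
  show "sm w \<Longrightarrow> smooth_on (hyp_space - {p}) (\<lambda>x. w (mobius_add (- p) x))"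
    by (rule smooth_on_vcomp[OF open_hyp_minus _ _ s(2)]) (use mobius_maps(2)[OF p] in blast)+
qed

lemma pullback_inverse:
  "pullback p u w \<Longrightarrow> x \<in> hyp_space - {p} \<Longrightarrow> u x = w (mobius_add (- p) x)"
  using mobius_maps(2)[OF p, of x] unfolding pullback_def by metis

lemma pullback_smooth: "pullback p u w \<Longrightarrow> sm w \<Longrightarrow> smooth_on (hyp_space - {p}) u"
  by (rule iffD2[OF smooth_on_cong[OF open_hyp_minus pullback_inverse] mobius_vcomp(4)])

lemma pullback_csmooth: "pullback p u w \<Longrightarrow> csm w \<Longrightarrow> csmooth_on (hyp_space - {p}) u"
  by (rule iffD2[OF csmooth_on_cong[OF open_hyp_minus pullback_inverse] mobius_vcomp(2)])

lemma smooth_on_conf_power: "smooth_on (hyp_space - {p}) (\<lambda>x. conf x ^ n)"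
  by (rule smooth_on_power[OF open_hyp_minus smooth_on_subset[OF smooth_on_conf]]) blast

text \<open>The Jacobian \<open>mfac\<close> to the power N turns the density at the image point
  into \<open>conf y ^ CARD('n)\<close> by \<open>conf_mobius\<close>, and \<open>sh_conf\<close>
  rewrites \<open>conf y\<close> as \<open>sh y\<close> over \<open>norm y\<close>.\<close>

lemma hint_eq_integral:
  assumes w: "csm w" and u: "pullback p u w"
  shows "(LINT x:hyp_space - {p}|lborel. conf x ^ CARD('n) * u x) = hint w"
proof -
  note p' = hyp_space_minus[OF p]
  have f: "csmooth_on (hyp_space - {p}) (\<lambda>x. conf x ^ CARD('n) * u x)"
    by (rule csmooth_on_mult_left[OF open_hyp_minus smooth_on_conf_power pullback_csmooth[OF u w]])
  have eq: "mfac p y ^ CARD('n) * (conf (mobius_add p y) ^ CARD('n) * u (mobius_add p y)) = sh y ^ CARD('n) * w y / norm y ^ CARD('n)"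
    if y: "y \<in> punct" for y
  proof -
    have yh: "y \<in> hyp_space" using y by (simp add: punct_def)
    have "mfac p y ^ CARD('n) * (conf (mobius_add p y) ^ CARD('n) * u (mobius_add p y)) = (mfac p y * conf (mobius_add p y)) ^ CARD('n) * w y"
      using u y by (simp add: pullback_def power_mult_distrib)
    then show ?thesis
      using punct_D[OF y] by (simp add: conf_mobius[OF p yh] sh_conf power_mult_distrib)
  qed
  have "(LINT y:punct|lborel. mfac p y ^ CARD('n) * (conf (mobius_add p y) ^ CARD('n) * u (mobius_add p y))) =
      (LINT x:hyp_space - {p}|lborel. conf x ^ CARD('n) * u x)"
  proof (rule conformal_change_of_variables)
    show "(mobius_add p has_derivative mder p y) (at y)" if "y \<in> punct" for y
      using mobius_has_derivative[OF p] that by (simp add: punct_def)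
    show "(mobius_add (- p) has_derivative mder (- p) x) (at x)" if "x \<in> hyp_space - {p}" for x
      using mobius_has_derivative[OF p'] that by simp
    show "mfac p y > 0" "norm (mder p y v) = mfac p y * norm v" if "y \<in> punct" for y v
      using mfac_pos[OF p] norm_mder[OF p] that by (simp_all add: punct_def)
    show "set_integrable lborel (hyp_space - {p}) (\<lambda>x. conf x ^ CARD('n) * u x)"
      by (rule csmooth_on_integrable[OF f])
    have "set_integrable lborel punct (\<lambda>y. sh y ^ CARD('n) * w y / norm y ^ CARD('n))"
      by (rule mint_integrable[OF csm_sh_power[OF w]])
    then show "set_integrable lborel punct (\<lambda>y. mfac p y ^ CARD('n) * (conf (mobius_add p y) ^ CARD('n) * u (mobius_add p y)))"
      by (subst set_integrable_cong[OF refl refl eq]) auto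
  qed (use mobius_maps[OF p] in \<open>auto simp only: open_punct open_hyp_minus\<close>)
  moreover have "(LINT y:punct|lborel. mfac p y ^ CARD('n) * (conf (mobius_add p y) ^ CARD('n) * u (mobius_add p y))) = hint w"
    unfolding hint_def mint_def by (rule set_lebesgue_integral_cong) (auto simp: borel_open eq)
  ultimately show ?thesis by simp
qed

text \<open>The pole is a null set, so passing from the ball to the punctured ball costs nothing;
  only measurability at the pole needs care.\<close>

lemma hvol_integral:
  assumes w: "csm w" and u: "pullback p u w"
  shows "(\<integral>x. u x \<partial>hvol) = hint w"
proof -
  let ?T = "hyp_space - {p}" and ?R = "restrict_space lborel (hyp_space :: (real ^ 'n) set)"
  have bT: "?T \<in> sets borel" and bH: "(hyp_space :: (real ^ 'n) set) \<in> sets borel"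
    using open_hyp_minus open_hyp_space borel_open by blast+
  have "set_integrable lborel ?T u"
    by (rule csmooth_on_integrable[OF pullback_csmooth[OF u w]])
  then have m: "(\<lambda>x. indicator ?T x * u x) \<in> borel_measurable lborel"
    unfolding set_integrable_def by (simp add: borel_measurable_integrable)
  have mu: "u \<in> borel_measurable ?R"
  proof -
    \<comment> \<open>The value of \<open>u\<close> at the pole is arbitrary, so measurability on
      the ball is obtained from the punctured ball by putting that single value back.\<close>
    have "(\<lambda>x. if x = p then u p else indicator ?T x * u x) \<in> borel_measurable lborel"
      using m by (intro measurable_If) auto
    then have "(\<lambda>x. if x = p then u p else indicator ?T x * u x) \<in> borel_measurable ?R"
      by (rule measurable_restrict_space1)
    then show ?thesis
      by (rule measurable_cong[THEN iffD1, rotated]) (auto simp: space_restrict_space)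
  qed
  have mc: "(\<lambda>x. conf x ^ CARD('n)) \<in> borel_measurable ?R"
    unfolding conf_def by (intro measurable_restrict_space1) measurable
  have "(\<integral>x. u x \<partial>hvol) = (\<integral>x. conf x ^ CARD('n) *\<^sub>R u x \<partial>?R)"
    unfolding hvol_def
    by (rule integral_density[OF mu mc]) (auto simp: AE_restrict_space_iff bH less_imp_le[OF conf_pos] intro!: AE_I2)
  also have "\<dots> = (\<integral>x. indicator hyp_space x *\<^sub>R (conf x ^ CARD('n) *\<^sub>R u x) \<partial>lborel)"
    by (rule integral_restrict_space) (simp add: bH)
  also have "\<dots> = (\<integral>x. indicator ?T x *\<^sub>R (conf x ^ CARD('n) * u x) \<partial>lborel)"
  proof (rule integral_cong_AE)
    have "(\<lambda>x. conf x ^ CARD('n) *\<^sub>R u x) \<in> borel_measurable ?R"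
      using mu mc by measurable
    then show "(\<lambda>x. indicator hyp_space x *\<^sub>R (conf x ^ CARD('n) *\<^sub>R u x)) \<in> borel_measurable lborel"
      by (subst (asm) borel_measurable_restrict_space_iff) (simp_all add: bH)
    show "(\<lambda>x. indicator ?T x *\<^sub>R (conf x ^ CARD('n) * u x)) \<in> borel_measurable lborel"
      using csmooth_on_integrable[OF csmooth_on_mult_left[OF open_hyp_minus smooth_on_conf_power pullback_csmooth[OF u w]]]
      unfolding set_integrable_def by (rule borel_measurable_integrable)
    show "AE x in lborel. indicator hyp_space x *\<^sub>R (conf x ^ CARD('n) *\<^sub>R u x) = indicator ?T x *\<^sub>R (conf x ^ CARD('n) * u x)"
      using AE_lborel_singleton[of p] by eventually_elim (auto simp: indicator_def)
  qed
  also have "\<dots> = hint w"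
    using hint_eq_integral[OF w u] by (simp add: set_lebesgue_integral_def)
  finally show ?thesis .
qed

end

section \<open>Geodesic rays and the weak Laplacian for the pole 0\<close>

lemma mobius_add_0 [simp]: "mobius_add 0 x = x"
  by (simp add: mobius_add_def)

lemma punct_hyp: "y \<in> punct \<Longrightarrow> y \<in> hyp_space"
  by (simp add: punct_def)

text \<open>\<open>arcosh\<close> of c is the logarithm of c + sqrt (c^2 - 1), which is the form in
  which \<open>rr\<close> is defined.\<close>

lemma hdist_0: "y \<in> punct \<Longrightarrow> hdist 0 y = rr y"
proof -
  assume y: "y \<in> punct"
  have "1 + 2 * (norm (0 - y))\<^sup>2 / ((1 - (norm (0 :: real ^ 'a))\<^sup>2) * (1 - (norm y)\<^sup>2)) = ch y"
    using norm_square_less_1[OF y] by (simp add: ch_def field_simps)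
  moreover have "sqrt ((ch y)\<^sup>2 - 1) = sh y"
    using ch_sq[OF y] sh_pos[OF y] by simp
  ultimately show ?thesis
    using ch_pos[OF y] by (simp add: hdist_def arcosh_real_def rr_def)
qed

lemma cosh_rr: "y \<in> punct \<Longrightarrow> cosh (rr y) = ch y" and sinh_rr: "y \<in> punct \<Longrightarrow> sinh (rr y) = sh y"
proof -
  assume y: "y \<in> punct"
  have p: "ch y + sh y > 0" using ch_pos[OF y] sh_pos[OF y] by simp
  have e: "exp (rr y) = ch y + sh y" using p by (simp add: rr_def)
  have "(ch y + sh y) * (ch y - sh y) = 1" using ch_sq[OF y] by (simp add: algebra_simps power2_eq_square)
  then have e': "exp (- rr y) = ch y - sh y"
    using p by (simp add: exp_minus e field_simps)
  show "cosh (rr y) = ch y" "sinh (rr y) = sh y"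
    by (simp_all add: cosh_def sinh_def e e')
qed

lemma tanh_rr: assumes y: "y \<in> punct" shows "tanh (rr y / 2) *\<^sub>R sgn y = y"
  using hpolar_hdist_hdir[of 0 y] y hdist_0[OF y]
  by (simp add: punct_hyp punct_D hpolar_def hdir_def) (simp add: hyp_space_def)

text \<open>Along the ray |x| = tanh (r/2), so d|x|/dr = (1 - |x|^2)/2. The function
  \<open>v\<close> will be a composition with the translation, known only on \<open>punct\<close>;
  hence the separate \<open>w\<close>.\<close>

lemma deriv_ray:
  assumes y: "y \<in> punct" and w: "sm w" and v: "\<And>z. z \<in> punct \<Longrightarrow> v z = w z"
  shows "deriv (\<lambda>t. v (tanh (t / 2) *\<^sub>R sgn y)) (rr y) = rad w y"
proof -
  have "v differentiable at y"
    by (rule iffD2[OF differentiable_cong_open[OF open_punct y v] sm_differentiable[OF w y]])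
  from has_derivative_partial[OF this] have dv: "(v has_derivative (\<lambda>h. dirv h v y)) (at y)"
    by (simp add: dirv_def)
  have th: "tanh (rr y / 2) = norm y"
  proof -
    have "norm (tanh (rr y / 2) *\<^sub>R sgn y) = norm y" using tanh_rr[OF y] by simp
    then show ?thesis using y rr_pos[OF y] by (simp add: norm_sgn punct_D)
  qed
  have "((\<lambda>t. tanh (t / 2)) has_real_derivative (1 - (norm y)\<^sup>2) / 2) (at (rr y))"
    using cosh_real_nonzero by (auto intro!: derivative_eq_intros simp: th)
  then have "((\<lambda>t. tanh (t / 2)) has_derivative (\<lambda>h. (1 - (norm y)\<^sup>2) / 2 * h)) (at (rr y))"
    by (simp only: has_field_derivative_def)
  note c = has_derivative_scaleR_left[OF this, of "sgn y"]
  have "(v has_derivative (\<lambda>h. dirv h v y)) (at (tanh (rr y / 2) *\<^sub>R sgn y))"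
    using dv by (simp only: tanh_rr[OF y])
  note d = has_derivative_compose[OF c this]
  have "(\<lambda>h. dirv (((1 - (norm y)\<^sup>2) / 2 * h) *\<^sub>R sgn y) v y) = (*) (rad w y)"
  proof
    fix h
    have "dirv (((1 - (norm y)\<^sup>2) / 2 * h) *\<^sub>R sgn y) v y = (1 - (norm y)\<^sup>2) / 2 * h * (inverse (norm y) * eul v y)"
      unfolding eul_def sgn_div_norm by (simp only: dirv_vec_scaleR)
    also have "eul v y = eul w y" by (rule eul_cong[OF y v])
    also have "(1 - (norm y)\<^sup>2) / 2 * h * (inverse (norm y) * eul w y) = rad w y * h"
      using norm_square_less_1[OF y] punct_D[OF y] by (simp add: rad_def sh_def field_simps)
    finally show "dirv (((1 - (norm y)\<^sup>2) / 2 * h) *\<^sub>R sgn y) v y = rad w y * h" .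
  qed
  with d have "((\<lambda>t. v (tanh (t / 2) *\<^sub>R sgn y)) has_real_derivative rad w y) (at (rr y))"
    by (simp only: has_field_derivative_def)
  then show ?thesis by (rule DERIV_imp_deriv)
qed

lemma hgrad_sq_eq:
  assumes "x \<in> hyp_space"
  shows "hgrad_sq u x = (\<Sum>i\<in>UNIV. partial i u x * partial i u x) / (conf x)\<^sup>2"
proof -
  have "hgrad_sq u x = (conf x)\<^sup>2 * (\<Sum>i\<in>UNIV. partial i u x * partial i u x / ((conf x)\<^sup>2 * (conf x)\<^sup>2))"
    by (simp add: hgrad_sq_def hmetric_def hgrad_def inner_vec_def)
  also have "\<dots> = (\<Sum>i\<in>UNIV. partial i u x * partial i u x) / (conf x)\<^sup>2"
  proof -
    have gen: "k * (s / (k * k)) = s / k" if "k > 0" for k s :: real using that by simp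
    show ?thesis
      unfolding sum_divide_distrib[symmetric] by (rule gen) (use conf_pos[OF assms] in simp)
  qed
  finally show ?thesis .
qed

lemma integral_sum_csmooth:
  assumes "\<And>i. csmooth_on S (f i)"
  shows "(LINT x:S|lborel. \<Sum>i\<in>(UNIV :: 'i::finite set). f i x) = (\<Sum>i\<in>UNIV. LINT x:S|lborel. f i x)"
proof -
  have "(LINT x:S|lborel. \<Sum>i\<in>(UNIV :: 'i::finite set). f i x) = (\<integral>x. (\<Sum>i\<in>UNIV. indicator S x *\<^sub>R f i x) \<partial>lborel)"
    by (simp add: set_lebesgue_integral_def sum_distrib_left)
  also have "\<dots> = (\<Sum>i\<in>UNIV. \<integral>x. indicator S x *\<^sub>R f i x \<partial>lborel)"
    using csmooth_on_integrable[OF assms] by (intro Bochner_Integration.integral_sum) (simp add: set_integrable_def)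
  finally show ?thesis by (simp add: set_lebesgue_integral_def)
qed

text \<open>The polar expression is shown to satisfy the weak form of the Laplace-Beltrami equation:
  the radial part by a total r-derivative, the tangential part by \<open>ang_green\<close>.\<close>

lemma hint_gradient:
  fixes w z :: "real ^ 'n \<Rightarrow> real"
  assumes w: "csm w" and z: "csm z"
  shows "hint (\<lambda>y. (rlap w y + slap w y / (sh y)\<^sup>2) * z y) =
    - hint (\<lambda>y. rad w y * rad z y + (\<Sum>i\<in>UNIV. ang i w y * ang i z y) / (sh y)\<^sup>2)"
proof -
  let ?k = "CARD('n) - 1" and ?m = "CARD('n) - 2"
  note sw = csmooth_on_smooth[OF w] and sz = csmooth_on_smooth[OF z]
  have cm: "csm (\<lambda>x. g x * h x)" if "csm g" "sm h" for g h by (rule csm_mult_right[OF that])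
  have c1: "csm (\<lambda>y. rlap w y * z y)" by (rule cm[OF csm_rlap[OF w] sz])
  have c2: "csm (\<lambda>y. rad w y * rad z y)" by (rule cm[OF csm_rad[OF w] sm_rad[OF sz]])
  have c3: "csm (\<lambda>y. slap w y * z y / (sh y)\<^sup>2)" by (rule csm_div_sh[OF cm[OF csm_slap[OF w] sz]])
  have c4: "csm (\<lambda>y. (\<Sum>i\<in>UNIV. ang i w y * ang i z y) / (sh y)\<^sup>2)"
    by (rule csm_div_sh[OF csm_sum[OF cm[OF csm_ang[OF w] sm_ang[OF sz]]]])
  have "hint (\<lambda>y. rlap w y * z y) + hint (\<lambda>y. rad w y * rad z y) = hint (\<lambda>y. rlap w y * z y + rad w y * rad z y)"
    by (rule hint_add[OF c1 c2, symmetric])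
  also have "\<dots> = mint (\<lambda>y. sh y * rad (\<lambda>y. sh y ^ ?k * (rad w y * z y)) y)"
    unfolding hint_def
  proof (rule mint_cong)
    fix y :: "real ^ 'n" assume y: "y \<in> punct"
    have k: "sh y ^ CARD('n) = sh y * sh y ^ ?k" by (simp add: power_eq_if)
    have "rad (\<lambda>y. sh y ^ ?k * (rad w y * z y)) y = sh y ^ ?k * (rlap w y * z y + rad w y * rad z y)"
      by (simp only: rad_mult[OF sm_power[OF sm_sh] sm_mult[OF sm_rad[OF sw] sz] y]
          rad_mult[OF sm_rad[OF sw] sz y] rad_sh_power'[OF y] rlap_def) (simp add: of_nat_diff algebra_simps)
    then show "sh y ^ CARD('n) * (rlap w y * z y + rad w y * rad z y) = sh y * rad (\<lambda>y. sh y ^ ?k * (rad w y * z y)) y"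
      unfolding k by (simp only: mult.assoc)
  qed
  also have "\<dots> = 0"
    by (rule mint_rad[OF csm_sh_power[OF cm[OF csm_rad[OF w] sz]]])
  finally have 1: "hint (\<lambda>y. rlap w y * z y) = - hint (\<lambda>y. rad w y * rad z y)" by simp
  \<comment> \<open>The weight sinh^(N-2), written with an inverse because
    \<open>CARD('n) - 2\<close> truncates in dimension one.\<close>
  define g where "g y = sh y ^ CARD('n) * inverse ((sh y)\<^sup>2)" for y :: "real ^ 'n"
  have sg: "sm g"
    unfolding g_def[abs_def]
    by (rule sm_mult[OF sm_power[OF sm_sh]
          sm_inverse[OF sm_power[OF sm_sh]]]) (use sh_pos in fastforce)
  have ag: "ang i g y = 0" if y: "y \<in> punct" for i y
  proof -
    have "((\<lambda>t. t ^ CARD('n) * inverse (t\<^sup>2)) has_real_derivative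
        real CARD('n) * sh y ^ ?k * inverse ((sh y)\<^sup>2) + - (inverse ((sh y)\<^sup>2) * (2 * sh y) * inverse ((sh y)\<^sup>2)) * sh y ^ CARD('n)) (at (sh y))"
      using sh_pos[OF y] by (auto intro!: derivative_eq_intros simp: algebra_simps)
    from ang_comp[OF sm_sh y this] show ?thesis by (simp add: g_def[abs_def] ang_sh[OF y])
  qed
  have "hint (\<lambda>y. slap w y * z y / (sh y)\<^sup>2) = mint (\<lambda>y. g y * ((\<Sum>i\<in>UNIV. ang i (ang i w) y) * z y))"
    unfolding hint_def slap_def g_def by (simp add: divide_inverse algebra_simps)
  also have "\<dots> = - (\<Sum>i\<in>UNIV. mint (\<lambda>y. g y * (ang i w y * ang i z y)))"
    by (rule ang_green[OF sg ag w sz])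
  also have "(\<Sum>i\<in>UNIV. mint (\<lambda>y. g y * (ang i w y * ang i z y))) = mint (\<lambda>y. \<Sum>i\<in>UNIV. g y * (ang i w y * ang i z y))"
    by (rule mint_sum[symmetric, OF finite csm_mult_left[OF sg cm[OF csm_ang[OF w] sm_ang[OF sz]]]])
  also have "\<dots> = hint (\<lambda>y. (\<Sum>i\<in>UNIV. ang i w y * ang i z y) / (sh y)\<^sup>2)"
    unfolding hint_def g_def sum_distrib_left[symmetric] by (simp add: divide_inverse algebra_simps)
  finally have 2: "hint (\<lambda>y. slap w y * z y / (sh y)\<^sup>2) = - hint (\<lambda>y. (\<Sum>i\<in>UNIV. ang i w y * ang i z y) / (sh y)\<^sup>2)" .
  have "hint (\<lambda>y. (rlap w y + slap w y / (sh y)\<^sup>2) * z y) = hint (\<lambda>y. rlap w y * z y + slap w y * z y / (sh y)\<^sup>2)"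
    by (simp add: distrib_right)
  then show ?thesis using 1 2 hint_add[OF c1 c3] hint_add[OF c2 c4] by simp
qed

section \<open>Differential operators about an arbitrary pole\<close>

context
  fixes p :: "real ^ 'n"
  assumes p: "p \<in> hyp_space"
begin

lemma hdist_mobius: "y \<in> punct \<Longrightarrow> hdist p (mobius_add p y) = rr y"
  using hdist_translate[OF p mobius_add_in[OF p]] mobius_add_cancel'[OF p] hdist_0 punct_hyp by metis

text \<open>The translation takes the straight ray through \<open>y\<close> to the geodesic ray from
  \<open>p\<close> through the image of \<open>y\<close>. The conclusion is again a
  \<open>pullback\<close>, so the lemma can be iterated for the second radial derivative.\<close>

lemma pullback_hrad:
  assumes "pullback p u w" "sm w"
  shows "pullback p (hrad p u) (rad w)"
  unfolding pullback_def
proof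
  fix y :: "real ^ 'n" assume y: "y \<in> punct"
  have "hdir p (mobius_add p y) = sgn y"
    by (simp add: hdir_def mobius_add_cancel'[OF p punct_hyp[OF y]])
  then show "hrad p u (mobius_add p y) = rad w y"
    using deriv_ray[OF y assms(2), of "\<lambda>z. u (mobius_add p z)"] assms(1)
    by (simp add: hrad_def hpolar_def hdist_mobius[OF y] pullback_def)
qed

lemma pullback_hrlap:
  assumes u: "pullback p u w" and w: "sm w"
  shows "pullback p (hrlap p u) (rlap w)"
  using pullback_hrad[OF u w] pullback_hrad[OF pullback_hrad[OF u w] sm_rad[OF w]]
  by (simp add: pullback_def hrlap_def rlap_def hdist_mobius cosh_rr sinh_rr coth_def divide_inverse)

lemma partial_pullback:
  assumes u: "pullback p u w" and y: "y \<in> punct"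
  shows "partial i (\<lambda>y. u (mobius_add p y)) y = partial i w y"
  by (rule partial_cong[OF open_punct y]) (use u in \<open>simp add: pullback_def\<close>)

lemma pullback_gradient:
  assumes u: "pullback p u w" and w: "sm w" and v: "pullback p v z" and z: "sm z"
  shows "pullback p (\<lambda>x. (\<Sum>i\<in>UNIV. partial i u x * partial i v x) / (conf x)\<^sup>2)
    (\<lambda>y. rad w y * rad z y + (\<Sum>i\<in>UNIV. ang i w y * ang i z y) / (sh y)\<^sup>2)"
  unfolding pullback_def
proof
  fix y :: "real ^ 'n" assume y: "y \<in> punct"
  note yh = punct_hyp[OF y]
  have c: "conf y > 0" by (rule conf_pos[OF yh])
  have "(\<Sum>i\<in>UNIV. partial i w y * partial i z y) =
      (mfac p y)\<^sup>2 * (\<Sum>i\<in>UNIV. partial i u (mobius_add p y) * partial i v (mobius_add p y))"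
    using gradient_mobius[OF p y pullback_smooth[OF p u w] pullback_smooth[OF p v z]]
    by (simp add: partial_pullback[OF u y] partial_pullback[OF v y])
  then have 1: "(\<Sum>i\<in>UNIV. partial i u (mobius_add p y) * partial i v (mobius_add p y)) / (conf (mobius_add p y))\<^sup>2 =
      (\<Sum>i\<in>UNIV. partial i w y * partial i z y) / (conf y)\<^sup>2"
    using mfac_pos[OF p yh] conf_mobius[OF p yh, symmetric] by (simp add: power_mult_distrib)
  have "rad w y * rad z y + (\<Sum>i\<in>UNIV. ang i w y * ang i z y) / (sh y)\<^sup>2 =
      (norm y)\<^sup>2 * (\<Sum>i\<in>UNIV. partial i w y * partial i z y) / (sh y)\<^sup>2"
    unfolding sum_ang_ang[OF y] by (simp add: rad_def power2_eq_square diff_divide_distrib)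
  also have "\<dots> = (\<Sum>i\<in>UNIV. partial i w y * partial i z y) / (conf y)\<^sup>2"
    using punct_D[OF y] by (simp add: sh_conf power_mult_distrib)
  finally show "(\<Sum>i\<in>UNIV. partial i u (mobius_add p y) * partial i v (mobius_add p y)) / (conf (mobius_add p y))\<^sup>2 =
      rad w y * rad z y + (\<Sum>i\<in>UNIV. ang i w y * ang i z y) / (sh y)\<^sup>2" using 1 by simp
qed

lemma pullback_hgrad_sq:
  assumes "pullback p u w" "sm w"
  shows "pullback p (hgrad_sq u) (gsq w)"
  using pullback_gradient[OF assms assms] mobius_maps(1)[OF p]
  by (simp add: pullback_def hgrad_sq_eq gsq_def power2_eq_square)

text \<open>Both sides of the weak form of the equation are compared on all test functions, so the
  second derivatives of the Moebius map never enter.\<close>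

lemma hlap_weak:
  assumes u: "pullback p u w" and w: "csm w" and z: "csm z"
  shows "csm (\<lambda>y. hlap u (mobius_add p y))"
    and "hint (\<lambda>y. hlap u (mobius_add p y) * z y) = hint (\<lambda>y. (rlap w y + slap w y / (sh y)\<^sup>2) * z y)"
proof -
  let ?T = "hyp_space - {p}"
  define h where "h i x = conf x ^ CARD('n) * (partial i u x / (conf x)\<^sup>2)" for i x
  have sc: "smooth_on ?T (\<lambda>x. (conf x) ^ n)" for n by (rule smooth_on_conf_power[OF p])
  have c0: "conf x ^ n \<noteq> 0" if "x \<in> ?T" for x :: "real ^ 'n" and n using conf_pos[of x] that by simp
  have ch: "csmooth_on ?T (h i)" for i
    unfolding h_def[abs_def]
    by (rule csmooth_on_mult_left[OF open_hyp_minus sc csmooth_on_divide[OF open_hyp_minus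
            csmooth_on_partial[OF open_hyp_minus pullback_csmooth[OF p u w]] sc c0]])
  have hl: "hlap u = (\<lambda>x. (\<Sum>i\<in>UNIV. partial i (h i) x) / conf x ^ CARD('n))"
    by (simp add: hlap_def[abs_def] h_def[abs_def] hgrad_def)
  have chl: "csmooth_on ?T (hlap u)"
    unfolding hl
    by (rule csmooth_on_divide[OF open_hyp_minus csmooth_on_sum[OF open_hyp_minus finite csmooth_on_partial[OF open_hyp_minus ch]] sc c0])
  show cA: "csm (\<lambda>y. hlap u (mobius_add p y))" by (rule mobius_vcomp(1)[OF p chl])
  \<comment> \<open>The test function is carried to the coordinates in which \<open>hlap\<close> is
    defined. There the integration by parts involves plain partial derivatives, and
    \<open>pullback_gradient\<close> compares the first-order expressions.\<close>
  define \<eta> where "\<eta> x = z (mobius_add (- p) x)" for x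
  have \<eta>: "pullback p \<eta> z" using mobius_maps(1)[OF p] by (simp add: pullback_def \<eta>_def)
  have c\<eta>: "csmooth_on ?T \<eta>" by (rule pullback_csmooth[OF p \<eta> z])
  note sh = csmooth_on_smooth[OF ch] and s\<eta> = csmooth_on_smooth[OF c\<eta>]
  have ca: "csmooth_on ?T (\<lambda>x. partial i (h i) x * \<eta> x)" for i
    by (rule csmooth_on_mult_right[OF open_hyp_minus csmooth_on_partial[OF open_hyp_minus ch] s\<eta>])
  have cb: "csmooth_on ?T (\<lambda>x. h i x * partial i \<eta> x)" for i
    by (rule csmooth_on_mult_right[OF open_hyp_minus ch smooth_on_partial[OF s\<eta>]])
  have "pullback p (\<lambda>x. hlap u x * \<eta> x) (\<lambda>y. hlap u (mobius_add p y) * z y)"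
    using \<eta> by (simp add: pullback_def)
  from hint_eq_integral[OF p csm_mult_right[OF cA csmooth_on_smooth[OF z]] this]
  have "hint (\<lambda>y. hlap u (mobius_add p y) * z y) = (LINT x:?T|lborel. conf x ^ CARD('n) * (hlap u x * \<eta> x))" by simp
  also have "\<dots> = (LINT x:?T|lborel. \<Sum>i\<in>UNIV. partial i (h i) x * \<eta> x)"
    by (rule set_lebesgue_integral_cong) (use c0 in \<open>auto simp: hl sum_distrib_right borel_open\<close>)
  also have "\<dots> = (\<Sum>i\<in>UNIV. LINT x:?T|lborel. partial i (h i) x * \<eta> x)"
    by (rule integral_sum_csmooth[OF ca])
  also have "\<dots> = (\<Sum>i\<in>UNIV. - (LINT x:?T|lborel. h i x * partial i \<eta> x))"
  proof (rule sum.cong[OF refl])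
    fix i
    have "0 = (LINT x:?T|lborel. partial i (\<lambda>x. h i x * \<eta> x) x)"
      by (rule integral_partial_eq_0[symmetric, OF open_hyp_minus csmooth_on_mult_right[OF open_hyp_minus ch s\<eta>]])
    also have "\<dots> = (LINT x:?T|lborel. partial i (h i) x * \<eta> x + h i x * partial i \<eta> x)"
      by (rule set_lebesgue_integral_cong)
        (auto simp: borel_open intro!: partial_mult smooth_on_differentiable[OF sh] smooth_on_differentiable[OF s\<eta>])
    also have "\<dots> = (LINT x:?T|lborel. partial i (h i) x * \<eta> x) + (LINT x:?T|lborel. h i x * partial i \<eta> x)"
      by (rule set_integral_add(2)[OF csmooth_on_integrable[OF ca] csmooth_on_integrable[OF cb]])
    finally show "(LINT x:?T|lborel. partial i (h i) x * \<eta> x) = - (LINT x:?T|lborel. h i x * partial i \<eta> x)" by simp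
  qed
  also have "\<dots> = - (LINT x:?T|lborel. \<Sum>i\<in>UNIV. h i x * partial i \<eta> x)"
    unfolding integral_sum_csmooth[OF cb] by (simp add: sum_negf)
  also have "(LINT x:?T|lborel. \<Sum>i\<in>UNIV. h i x * partial i \<eta> x) =
      (LINT x:?T|lborel. conf x ^ CARD('n) * ((\<Sum>i\<in>UNIV. partial i u x * partial i \<eta> x) / (conf x)\<^sup>2))"
    by (rule set_lebesgue_integral_cong)
      (auto simp: borel_open h_def sum_distrib_left sum_divide_distrib intro!: sum.cong)
  also have "\<dots> = hint (\<lambda>y. rad w y * rad z y + (\<Sum>i\<in>UNIV. ang i w y * ang i z y) / (sh y)\<^sup>2)"
  proof (rule hint_eq_integral[OF p _ pullback_gradient[OF u csmooth_on_smooth[OF w] \<eta> csmooth_on_smooth[OF z]]])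
    show "csm (\<lambda>y. rad w y * rad z y + (\<Sum>i\<in>UNIV. ang i w y * ang i z y) / (sh y)\<^sup>2)"
      by (rule csm_add[OF csm_mult_right[OF csm_rad[OF w] sm_rad[OF csmooth_on_smooth[OF z]]]
            csm_div_sh[OF csm_sum[OF csm_mult_right[OF csm_ang[OF w] sm_ang[OF csmooth_on_smooth[OF z]]]]]])
  qed
  finally show "hint (\<lambda>y. hlap u (mobius_add p y) * z y) = hint (\<lambda>y. (rlap w y + slap w y / (sh y)\<^sup>2) * z y)"
    unfolding hint_gradient[OF w z] .
qed

lemma hlap_integral:
  assumes u: "pullback p u w" and w: "csm w"
  shows "(\<integral>x. (hlap u x)\<^sup>2 \<partial>hvol) = hint (\<lambda>y. (rlap w y + slap w y / (sh y)\<^sup>2)\<^sup>2)"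
proof -
  let ?A = "\<lambda>y. hlap u (mobius_add p y)" and ?B = "\<lambda>y. rlap w y + slap w y / (sh y)\<^sup>2"
  have A: "csm ?A" by (rule hlap_weak(1)[OF u w w])
  have B: "csm ?B" by (intro csm_intros csm_rlap csm_slap w)
  have "(\<integral>x. (hlap u x)\<^sup>2 \<partial>hvol) = hint (\<lambda>y. (?A y)\<^sup>2)"
    by (rule hvol_integral[OF p csm_sq[OF A]]) (simp add: pullback_def)
  also have "\<dots> = hint (\<lambda>y. ?B y * ?A y)"
    using hlap_weak(2)[OF u w A] by (simp add: power2_eq_square)
  also have "\<dots> = hint (\<lambda>y. (?B y)\<^sup>2)"
    using hlap_weak(2)[OF u w B] by (simp add: power2_eq_square mult.commute)
  finally show ?thesis .
qed

lemma test_fun_pullback: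
  assumes "u \<in> test_fun p"
  obtains w where "csm w" "pullback p u w"
proof
  have "csmooth_on (hyp_space - {p}) u"
    using assms closure_subset[of "{x. u x \<noteq> 0}"] unfolding test_fun_def
    by (intro csmooth_onI[where K="closure {x. u x \<noteq> 0}"]) auto
  then show "csm (\<lambda>y. u (mobius_add p y))" by (rule mobius_vcomp(1)[OF p])
qed (simp add: pullback_def)

text \<open>The function is extended by zero beyond the punctured ball, since
  \<open>test_fun\<close> takes the closure of the nonzero set in the whole space.\<close>

lemma pullback_test_fun:
  assumes w: "csm w"
  obtains u where "u \<in> test_fun p" "pullback p u w"
proof
  define u where "u x = (if x \<in> hyp_space - {p} then w (mobius_add (- p) x) else 0)" for x
  show pu: "pullback p u w" using mobius_maps(1)[OF p] by (simp add: pullback_def u_def)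
  from pullback_csmooth[OF p pu w] obtain K where K: "compact K" "K \<subseteq> hyp_space - {p}" "\<forall>x\<in>hyp_space - {p} - K. u x = 0"
    by (auto simp: csmooth_on_def)
  then have "{x. u x \<noteq> 0} \<subseteq> K" by (auto simp: u_def)
  then have sub: "closure {x. u x \<noteq> 0} \<subseteq> K" using K(1) by (simp add: closure_minimal compact_imp_closed)
  then have "compact (closure {x. u x \<noteq> 0})"
    using K(1) by (meson closed_closure closed_Int_compact compact_closure bounded_subset compact_imp_bounded closure_subset subset_trans)
  then show "u \<in> test_fun p"
    using sub K csmooth_on_smooth[OF pullback_csmooth[OF p pu w]] by (auto simp: test_fun_def)
qed

end

section \<open>Radial test functions and sharpness\<close>

text \<open>One-variable smoothness is read off on \<open>real ^ 1\<close>, so that the closure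
  rules of \<open>smooth_on\<close> apply directly.\<close>

definition sm1 :: "(real \<Rightarrow> real) \<Rightarrow> bool"
  where "sm1 h \<longleftrightarrow> smooth_on (UNIV :: (real ^ 1) set) (\<lambda>x. h (x $ 1))"

lemma axis_one: "(x :: real ^ 1) $ 1 *\<^sub>R axis 1 1 = x"
  by (simp add: vec_eq_iff axis_def)

lemma partial_one:
  fixes h :: "real \<Rightarrow> real" and x :: "real ^ 1"
  assumes "(h has_real_derivative d) (at (x $ 1))"
  shows "(\<lambda>x. h (x $ 1)) differentiable at x" "partial i (\<lambda>x. h (x $ 1)) x = d"
proof -
  have "(h has_derivative (*) d) (at (x $ 1))" using assms by (simp add: has_field_derivative_def)
  note c = has_derivative_compose[OF bounded_linear_imp_has_derivative[OF bounded_linear_vec_nth] this]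
  show "(\<lambda>x. h (x $ 1)) differentiable at x" using c by (rule differentiableI)
  show "partial i (\<lambda>x. h (x $ 1)) x = d" using partial_eqI[OF c, of i] by (simp add: axis_def)
qed

lemma sm1_deriv:
  assumes "sm1 h"
  shows "(h has_real_derivative deriv h t) (at t)" "sm1 (deriv h)"
proof -
  have D: "(h has_real_derivative partial 1 (\<lambda>x :: real ^ 1. h (x $ 1)) (t *\<^sub>R axis 1 1)) (at t)" for t
    using has_real_derivative_line[of "\<lambda>x :: real ^ 1. h (x $ 1)" 0 t 1] assms
    by (simp add: sm1_def smooth_on_differentiable)
  then show d: "(h has_real_derivative deriv h t) (at t)" for t
    using DERIV_deriv_iff_real_differentiable real_differentiable_def by blast
  have "partial 1 (\<lambda>x :: real ^ 1. h (x $ 1)) x = deriv h (x $ 1)" for x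
    using DERIV_imp_deriv[OF D[of "x $ 1"]] by (simp add: axis_one)
  then have "partial 1 (\<lambda>x :: real ^ 1. h (x $ 1)) = (\<lambda>x. deriv h (x $ 1))" by blast
  with smooth_on_partial[OF assms[unfolded sm1_def], of 1] show "sm1 (deriv h)" by (simp add: sm1_def)
qed

lemma sm1_antiderivative:
  assumes F: "\<And>t. (F has_real_derivative h t) (at t)" and h: "sm1 h"
  shows "sm1 F"
  unfolding sm1_def smooth_on_def
proof (intro allI ballI)
  fix "is" :: "1 list" and x :: "real ^ 1"
  show "foldr partial is (\<lambda>x. F (x $ 1)) differentiable at x"
  proof (cases "is" rule: rev_exhaust)
    case Nil
    then show ?thesis using partial_one(1)[OF F] by simp
  next
    case (snoc js i)
    have "partial i (\<lambda>x. F (x $ 1)) = (\<lambda>x. h (x $ 1))" using partial_one(2)[OF F] by blast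
    then show ?thesis using h snoc by (simp add: sm1_def smooth_on_def)
  qed
qed

lemma sm1_compose_smooth:
  assumes S: "open S" and h: "sm1 h" and f: "smooth_on S f"
  shows "smooth_on S (\<lambda>x. h (f x))"
proof -
  have s: "sm1 ((deriv ^^ n) h)" for n by (induction n) (use h sm1_deriv(2) in auto)
  from smooth_on_comp[OF S f, of UNIV "\<lambda>n. (deriv ^^ n) h" 0] show ?thesis
    using sm1_deriv(1)[OF s] by simp
qed

lemma sm1_compose: "sm1 h \<Longrightarrow> sm1 f \<Longrightarrow> sm1 (\<lambda>t. h (f t))"
  unfolding sm1_def[of f] sm1_def[of "\<lambda>t. h (f t)"] by (rule sm1_compose_smooth[OF open_UNIV])

lemma sm1_add: "sm1 f \<Longrightarrow> sm1 g \<Longrightarrow> sm1 (\<lambda>t. f t + g t)"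
  and sm1_diff: "sm1 f \<Longrightarrow> sm1 g \<Longrightarrow> sm1 (\<lambda>t. f t - g t)"
  and sm1_mult: "sm1 f \<Longrightarrow> sm1 g \<Longrightarrow> sm1 (\<lambda>t. f t * g t)"
  and sm1_const: "sm1 (\<lambda>t. c)"
  and sm1_exp: "sm1 f \<Longrightarrow> sm1 (\<lambda>t. exp (f t))"
  and sm1_id: "sm1 (\<lambda>t. t)"
  unfolding sm1_def
  by (simp_all add: smooth_on_add smooth_on_diff smooth_on_mult smooth_on_const smooth_on_exp smooth_on_coord)

lemma sm1_ln: "sm1 f \<Longrightarrow> (\<And>t. f t > 0) \<Longrightarrow> sm1 (\<lambda>t. ln (f t))"
  unfolding sm1_def by (simp add: smooth_on_ln)

lemma sm1_continuous: "sm1 h \<Longrightarrow> isCont h t"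
  using sm1_deriv(1) DERIV_isCont by blast

section \<open>A smooth function that is flat at zero\<close>

definition flat :: "nat \<Rightarrow> real \<Rightarrow> real"
  where "flat k t = (if t > 0 then inverse t ^ k * exp (- inverse t) else 0)"

text \<open>This quotient is the difference quotient at 0. From the right it is a power of 1/t
  against exp (1/t).\<close>

lemma flat_over_tendsto: "((\<lambda>t. flat k t / t) \<longlongrightarrow> 0) (at 0)"
proof (rule filterlim_split_at)
  show "((\<lambda>t. flat k t / t) \<longlongrightarrow> 0) (at_left 0)"
    by (rule tendsto_eventually) (auto simp: flat_def eventually_at_filter)
  have "((\<lambda>t. inverse t ^ Suc k / exp (inverse t)) \<longlongrightarrow> 0) (at_right (0 :: real))"
    by (rule filterlim_compose[OF tendsto_power_div_exp_0 filterlim_inverse_at_top_right])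
  moreover have "eventually (\<lambda>t. inverse t ^ Suc k / exp (inverse t) = flat k t / t) (at_right (0 :: real))"
    by (auto simp: flat_def eventually_at_filter exp_minus divide_inverse)
  ultimately show "((\<lambda>t. flat k t / t) \<longlongrightarrow> 0) (at_right 0)"
    by (rule Lim_transform_eventually)
qed

lemma DERIV_flat: "(flat k has_real_derivative flat (k + 2) t - real k * flat (k + 1) t) (at t)"
proof -
  consider "t > 0" | "t < 0" | "t = 0" by linarith
  then show ?thesis
  proof cases
    case 1
    have "((\<lambda>t. inverse t ^ k * exp (- inverse t)) has_real_derivative flat (k + 2) t - real k * flat (k + 1) t) (at t)"
    proof -
      have a: "((\<lambda>t. inverse t ^ k) has_real_derivative - (real k * inverse t ^ k * inverse t)) (at t)"
        using DERIV_inverse_power[of t k] 1 by (simp add: power_inverse)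
      have b: "((\<lambda>t. exp (- inverse t)) has_real_derivative exp (- inverse t) * (inverse t * inverse t)) (at t)"
        using 1 by (auto intro!: derivative_eq_intros simp: power2_eq_square)
      show ?thesis
        by (rule DERIV_cong[OF DERIV_mult[OF a b]]) (use 1 in \<open>simp add: flat_def algebra_simps\<close>)
    qed
    then show ?thesis
      by (rule has_field_derivative_transform_within_open[where S="{0<..}"]) (use 1 in \<open>auto simp: flat_def\<close>)
  next
    case 2
    then have "((\<lambda>t. 0) has_real_derivative flat (k + 2) t - real k * flat (k + 1) t) (at t)"
      by (simp add: flat_def)
    then show ?thesis
      by (rule has_field_derivative_transform_within_open[where S="{..<0}"]) (use 2 in \<open>auto simp: flat_def\<close>)
  next
    case 3
    then show ?thesis
      using flat_over_tendsto[of k] by (simp add: has_field_derivative_iff flat_def)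
  qed
qed

text \<open>By \<open>DERIV_flat\<close> the derivative of a single \<open>flat k\<close> combines
  two others; closing under such combinations gives a class stable under derivatives, as
  \<open>smooth_on_coinduct\<close> requires.\<close>

inductive flat_span :: "(real \<Rightarrow> real) \<Rightarrow> bool" where
  gen: "flat_span (flat k)"
| comb: "flat_span f \<Longrightarrow> flat_span g \<Longrightarrow> flat_span (\<lambda>t. f t - c * g t)"

lemma flat_span_deriv: "flat_span f \<Longrightarrow> \<exists>g. flat_span g \<and> (\<forall>t. (f has_real_derivative g t) (at t))"
proof (induction rule: flat_span.induct)
  case (gen k)
  have "flat_span (\<lambda>t. flat (k + 2) t - real k * flat (k + 1) t)"
    by (intro flat_span.intros)
  then show ?case using DERIV_flat by blast
next
  case (comb f g c)
  then obtain f' g' where *: "flat_span f'" "\<forall>t. (f has_real_derivative f' t) (at t)"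
    "flat_span g'" "\<forall>t. (g has_real_derivative g' t) (at t)" by blast
  then have "((\<lambda>t. f t - c * g t) has_real_derivative f' t - c * g' t) (at t)" for t
    by (auto intro!: derivative_eq_intros)
  then show ?case using flat_span.comb[OF *(1,3), of c] by blast
qed

lemma sm1_flat: "sm1 (flat k)"
  unfolding sm1_def
proof (rule smooth_on_coinduct[where P="\<lambda>f. \<exists>h. flat_span h \<and> f = (\<lambda>x. h (x $ 1))"])
  show "\<exists>h. flat_span h \<and> (\<lambda>x :: real ^ 1. flat k (x $ 1)) = (\<lambda>x. h (x $ 1))"
    using flat_span.gen by blast
next
  fix f :: "real ^ 1 \<Rightarrow> real" and x :: "real ^ 1"
  assume "\<exists>h. flat_span h \<and> f = (\<lambda>x. h (x $ 1))"
  then show "f differentiable at x" using flat_span_deriv partial_one(1) by blast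
next
  fix f :: "real ^ 1 \<Rightarrow> real" and i
  assume "\<exists>h. flat_span h \<and> f = (\<lambda>x. h (x $ 1))"
  then obtain h g where "f = (\<lambda>x. h (x $ 1))" "flat_span g" "\<forall>t. (h has_real_derivative g t) (at t)"
    using flat_span_deriv by blast
  then show "\<exists>g. (\<exists>h. flat_span h \<and> g = (\<lambda>x. h (x $ 1))) \<and> (\<forall>x\<in>UNIV. partial i f x = g x)"
    using partial_one(2) by blast
qed simp

section \<open>Compactly supported smooth functions of one variable\<close>

definition cs1 :: "(real \<Rightarrow> real) \<Rightarrow> bool"
  where "cs1 h \<longleftrightarrow> sm1 h \<and> (\<exists>a b. a < b \<and> (\<forall>t. t \<notin> {a..b} \<longrightarrow> h t = 0))"

lemma cs1_I: "sm1 h \<Longrightarrow> a < b \<Longrightarrow> (\<And>t. t \<notin> {a..b} \<Longrightarrow> h t = 0) \<Longrightarrow> cs1 h"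
  unfolding cs1_def by blast

lemma cs1_sm1: "cs1 h \<Longrightarrow> sm1 h"
  by (simp add: cs1_def)

lemma cs1_bounds2:
  assumes "cs1 f" "cs1 g"
  obtains a b where "a < b" "\<And>t. t \<notin> {a..b} \<Longrightarrow> f t = 0" "\<And>t. t \<notin> {a..b} \<Longrightarrow> g t = 0"
proof -
  obtain a b c d where "a < b" "\<forall>t. t \<notin> {a..b} \<longrightarrow> f t = 0" "c < d" "\<forall>t. t \<notin> {c..d} \<longrightarrow> g t = 0"
    using assms unfolding cs1_def by blast
  then show ?thesis by (intro that[of "min a c" "max b d"]) (auto simp: min_le_iff_disj le_max_iff_disj)
qed

lemma cs1_mult:
  assumes "sm1 f" "cs1 g" shows "cs1 (\<lambda>t. f t * g t)"
proof -
  obtain a b where ab: "a < b" "\<And>t. t \<notin> {a..b} \<Longrightarrow> g t = 0" using assms(2) unfolding cs1_def by blast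
  show ?thesis
    by (rule cs1_I[OF sm1_mult[OF assms(1) cs1_sm1[OF assms(2)]] ab(1)]) (use ab(2) in simp)
qed

lemma cs1_cmult: "cs1 g \<Longrightarrow> cs1 (\<lambda>t. c * g t)"
  by (rule cs1_mult[OF sm1_const])

lemma cs1_sq: "cs1 g \<Longrightarrow> cs1 (\<lambda>t. (g t)\<^sup>2)"
  unfolding power2_eq_square by (rule cs1_mult[OF cs1_sm1])

lemma cs1_add:
  assumes "cs1 f" "cs1 g" shows "cs1 (\<lambda>t. f t + g t)"
proof -
  obtain a b where ab: "a < b" "\<And>t. t \<notin> {a..b} \<Longrightarrow> f t = 0" "\<And>t. t \<notin> {a..b} \<Longrightarrow> g t = 0"
    using cs1_bounds2[OF assms] by blast
  show ?thesis
    by (rule cs1_I[OF sm1_add[OF cs1_sm1[OF assms(1)] cs1_sm1[OF assms(2)]] ab(1)]) (use ab(2,3) in simp)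
qed

lemma cs1_diff: "cs1 f \<Longrightarrow> cs1 g \<Longrightarrow> cs1 (\<lambda>t. f t - g t)"
  using cs1_add[of f "\<lambda>t. (-1) * g t", OF _ cs1_cmult] by simp

lemma deriv_zero_outside:
  fixes h :: "real \<Rightarrow> real"
  assumes "\<And>t. t \<notin> {a..b} \<Longrightarrow> h t = 0" "t \<notin> {a..b}"
  shows "deriv h t = 0"
proof -
  have "(h has_real_derivative 0) (at t)"
    by (rule has_field_derivative_transform_within_open[where f="\<lambda>t. 0" and S="- {a..b}"]) (use assms in auto)
  then show ?thesis by (rule DERIV_imp_deriv)
qed

lemma cs1_deriv:
  assumes "cs1 h" shows "cs1 (deriv h)"
proof -
  obtain a b where ab: "a < b" "\<And>t. t \<notin> {a..b} \<Longrightarrow> h t = 0" using assms unfolding cs1_def by blast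
  show ?thesis by (rule cs1_I[OF sm1_deriv(2)[OF cs1_sm1[OF assms]] ab(1) deriv_zero_outside[OF ab(2)]])
qed

definition J :: "(real \<Rightarrow> real) \<Rightarrow> real" where "J h = integral UNIV h"

lemma has_integral_cs1:
  assumes F: "\<And>t. (F has_real_derivative h t) (at t)" and ab: "a < b" "\<And>t. t \<notin> {a..b} \<Longrightarrow> h t = 0"
  shows "(h has_integral (F b - F a)) UNIV" "(h has_integral (F b - F a)) {a..b}"
proof -
  show i: "(h has_integral (F b - F a)) {a..b}"
    by (rule fundamental_theorem_of_calculus[OF less_imp_le[OF ab(1)]
          has_vector_derivative_at_within[OF F[unfolded has_real_derivative_iff_has_vector_derivative]]])
  show "(h has_integral (F b - F a)) UNIV"
    by (rule has_integral_on_superset[OF i]) (use ab in auto)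
qed

lemma sm1_has_antiderivative:
  assumes "sm1 h" shows "\<exists>F. \<forall>t. (F has_real_derivative h t) (at t)"
  using einterval_antiderivative[of "-\<infinity>" "\<infinity>" h] sm1_continuous[OF assms]
  by (simp add: has_real_derivative_iff_has_vector_derivative)

lemma cs1_integral:
  assumes "cs1 h"
  obtains F a b where "\<And>t. (F has_real_derivative h t) (at t)" "a < b" "\<And>t. t \<notin> {a..b} \<Longrightarrow> h t = 0"
    "(h has_integral (F b - F a)) UNIV" "(h has_integral (F b - F a)) {a..b}"
proof -
  obtain a b where ab: "a < b" "\<And>t. t \<notin> {a..b} \<Longrightarrow> h t = 0" using assms unfolding cs1_def by blast
  obtain F where F: "\<forall>t. (F has_real_derivative h t) (at t)"
    using sm1_has_antiderivative[OF cs1_sm1[OF assms]] by blast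
  from F have F': "(F has_real_derivative h t) (at t)" for t by blast
  show ?thesis by (rule that[OF F' ab has_integral_cs1[OF F' ab]])
qed

lemma cs1_integrable: "cs1 h \<Longrightarrow> h integrable_on UNIV"
  by (rule cs1_integral) (auto intro: has_integral_integrable)

lemma J_add: "cs1 f \<Longrightarrow> cs1 g \<Longrightarrow> J (\<lambda>t. f t + g t) = J f + J g"
  unfolding J_def by (intro integral_add cs1_integrable)

lemma J_diff: "cs1 f \<Longrightarrow> cs1 g \<Longrightarrow> J (\<lambda>t. f t - g t) = J f - J g"
  unfolding J_def by (intro integral_diff cs1_integrable)

lemma J_cmult: "J (\<lambda>t. c * f t) = c * J f"
  unfolding J_def by simp

lemma J_nonneg: "cs1 f \<Longrightarrow> (\<And>t. f t \<ge> 0) \<Longrightarrow> J f \<ge> 0"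
  unfolding J_def by (rule integral_nonneg[OF cs1_integrable]) auto

lemma J_pos:
  assumes h: "cs1 h" and nn: "\<And>t. h t \<ge> 0" and t0: "h t0 > 0"
  shows "J h > 0"
proof -
  obtain F a b where ab: "a < b" "\<And>t. t \<notin> {a..b} \<Longrightarrow> h t = 0"
    and i: "(h has_integral (F b - F a)) UNIV" "(h has_integral (F b - F a)) {a..b}"
    using cs1_integral[OF h] by metis
  have c: "continuous_on {a..b} h"
    using sm1_continuous[OF cs1_sm1[OF h]] by (intro continuous_at_imp_continuous_on) blast
  have "J h = integral {a..b} h"
    unfolding J_def integral_unique[OF i(1)] integral_unique[OF i(2)] ..
  moreover have "integral {a..b} h \<noteq> 0"
    using integral_eq_0_iff[OF c ab(1) nn] t0 ab(2)[of t0] by force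
  ultimately show ?thesis using J_nonneg[OF h nn] by simp
qed

lemma sm1_affine: "sm1 h \<Longrightarrow> sm1 (\<lambda>s. h ((s - T) / L))"
proof -
  have "sm1 (\<lambda>s. (s - T) * (1 / L))" by (intro sm1_mult sm1_diff sm1_id sm1_const)
  then show "sm1 h \<Longrightarrow> sm1 (\<lambda>s. h ((s - T) / L))" using sm1_compose[of h "\<lambda>s. (s - T) * (1 / L)"] by simp
qed

lemma J_affine:
  assumes h: "cs1 h" and L: "L > 0"
  shows "cs1 (\<lambda>s. h ((s - T) / L))" "J (\<lambda>s. h ((s - T) / L)) = L * J h"
proof -
  obtain F a b where F: "\<And>t. (F has_real_derivative h t) (at t)"
    and ab: "a < b" "\<And>t. t \<notin> {a..b} \<Longrightarrow> h t = 0" and i: "(h has_integral (F b - F a)) UNIV"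
    using cs1_integral[OF h] by metis
  have ab': "T + L * a < T + L * b" "\<And>s. s \<notin> {T + L * a..T + L * b} \<Longrightarrow> h ((s - T) / L) = 0"
    using ab L by (auto simp: field_simps)
  show "cs1 (\<lambda>s. h ((s - T) / L))" by (rule cs1_I[OF sm1_affine[OF cs1_sm1[OF h]] ab'])
  have "((\<lambda>s. L * F ((s - T) / L)) has_real_derivative h ((s - T) / L)) (at s)" for s
  proof -
    have "((\<lambda>s. (s - T) / L) has_real_derivative 1 / L) (at s)"
      using L by (auto intro!: derivative_eq_intros)
    from DERIV_chain2[OF F this] show ?thesis
      using L DERIV_cmult[of "\<lambda>s. F ((s - T) / L)" "h ((s - T) / L) * (1 / L)" s UNIV L] by simp
  qed
  from has_integral_cs1(1)[OF this ab'] have "J (\<lambda>s. h ((s - T) / L)) = L * F b - L * F a"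
    using L unfolding J_def by (simp add: integral_unique)
  moreover have "J h = F b - F a" unfolding J_def by (rule integral_unique[OF i])
  ultimately show "J (\<lambda>s. h ((s - T) / L)) = L * J h" by (simp add: right_diff_distrib)
qed

lemma deriv_affine:
  assumes "sm1 h" "L > 0" shows "deriv (\<lambda>s. h ((s - T) / L)) s = deriv h ((s - T) / L) / L"
proof -
  have "((\<lambda>s. (s - T) / L) has_real_derivative 1 / L) (at s)"
    using assms by (auto intro!: derivative_eq_intros)
  from DERIV_imp_deriv[OF DERIV_chain2[OF sm1_deriv(1)[OF assms(1)] this]] show ?thesis by simp
qed

text \<open>A primitive is constant on both sides of the support, and integral zero makes the two
  constants equal; subtracting them gives compact support.\<close>

lemma cs1_primitive:
  assumes h: "cs1 h" and J: "J h = 0"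
  obtains H where "cs1 H" "\<And>t. (H has_real_derivative h t) (at t)"
proof -
  obtain F a b where F: "\<And>t. (F has_real_derivative h t) (at t)"
    and ab: "a < b" "\<And>t. t \<notin> {a..b} \<Longrightarrow> h t = 0" and i: "(h has_integral (F b - F a)) UNIV"
    using cs1_integral[OF h] by metis
  have Fab: "F b = F a" using integral_unique[OF i] J unfolding J_def by simp
  have cF: "continuous_on A F" for A
    by (intro continuous_at_imp_continuous_on ballI DERIV_isCont[OF F])
  have l: "F a = F t" if t: "t < a" for t
  proof (rule DERIV_isconst_end[OF t cF])
    show "(F has_real_derivative 0) (at x)" if "t < x" "x < a" for x using F[of x] ab(2)[of x] that by simp
  qed
  have r: "F t = F b" if t: "b < t" for t
  proof (rule DERIV_isconst_end[OF t cF])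
    show "(F has_real_derivative 0) (at x)" if "b < x" "x < t" for x using F[of x] ab(2)[of x] that by simp
  qed
  have 0: "F t - F a = 0" if t: "t \<notin> {a..b}" for t
  proof (cases "t < a")
    case True
    then show ?thesis using l[OF True] by simp
  next
    case False
    then have "b < t" using t by auto
    from r[OF this] Fab show ?thesis by simp
  qed
  have d: "((\<lambda>t. F t - F a) has_real_derivative h t) (at t)" for t
    using DERIV_diff[OF F DERIV_const[of "F a"], of t] by simp
  show ?thesis
    by (rule that[OF cs1_I[OF sm1_antiderivative[OF d cs1_sm1[OF h]] ab(1) 0] d])
qed

lemma bump_exists:
  obtains \<eta> where "cs1 \<eta>" "\<And>t. \<eta> t \<ge> 0" "\<eta> 0 > 0" "\<And>t. t \<notin> {-1..1} \<Longrightarrow> \<eta> t = 0"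
proof
  let ?\<eta> = "\<lambda>t :: real. flat 0 (1 - t * t)"
  show z: "?\<eta> t = 0" if "t \<notin> {-1..1}" for t
  proof -
    have "\<bar>t\<bar> > 1" using that by auto
    then have "1 < t * t" using one_less_power[of "\<bar>t\<bar>" 2] by (simp add: power2_eq_square)
    then show ?thesis by (simp add: flat_def)
  qed
  show "cs1 ?\<eta>"
    by (rule cs1_I[of _ "-1" 1]) (use z in \<open>auto intro!: sm1_compose[OF sm1_flat] sm1_diff sm1_const sm1_mult sm1_id\<close>)
qed (auto simp: flat_def)

section \<open>Functions of ln r and their integrals\<close>

definition tau :: "real ^ 'n \<Rightarrow> real" where "tau x = ln (rr x)"

lemma sm_tau: "sm tau"
  unfolding tau_def[abs_def] by (rule sm_ln_rr)

lemma exp_tau: "x \<in> punct \<Longrightarrow> exp (tau x) = rr x"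
  using rr_pos by (simp add: tau_def)

lemma norm_eq_tanh: "x \<in> punct \<Longrightarrow> norm x = tanh (rr x / 2)"
proof -
  assume x: "x \<in> punct"
  have "norm (tanh (rr x / 2) *\<^sub>R sgn x) = norm x" using tanh_rr[OF x] by simp
  then show ?thesis using x rr_pos[OF x] by (simp add: norm_sgn punct_D)
qed

lemma tau_surj: "\<exists>x \<in> (punct :: (real ^ 'n) set). tau x = s"
proof -
  define t where "t = exp s"
  define x :: "real ^ 'n" where "x = tanh (t / 2) *\<^sub>R axis undefined 1"
  have t: "t > 0" by (simp add: t_def)
  have "norm x = tanh (t / 2)" using t by (simp add: x_def)
  then have x: "x \<in> punct"
    using t tanh_real_lt_1[of "t / 2"] by (auto simp: punct_def hyp_space_def)
  have "rr x = t"
    using hdist_0[OF x] hdist_0_ray[of t "axis undefined 1 :: real ^ 'n"] t by (simp add: x_def)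
  then show ?thesis using x by (intro bexI[of _ x]) (simp_all add: tau_def t_def)
qed

lemma sm_tau_comp: "sm1 h \<Longrightarrow> sm (\<lambda>x. h (tau x))"
  by (rule sm1_compose_smooth[OF open_punct _ sm_tau])

lemma csm_tau:
  assumes h: "cs1 h" shows "csm (\<lambda>x :: real ^ 'n. h (tau x))"
proof -
  obtain a b where ab: "a < b" "\<And>t. t \<notin> {a..b} \<Longrightarrow> h t = 0" using h unfolding cs1_def by blast
  let ?K = "cball 0 (tanh (exp b / 2)) - ball (0 :: real ^ 'n) (tanh (exp a / 2))"
  show ?thesis
  proof (rule csmooth_onI[OF sm_tau_comp[OF cs1_sm1[OF h]]])
    show "compact ?K" by (intro compact_diff) auto
    have "0 < tanh (exp a / 2)" by simp
    then show "?K \<subseteq> punct"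
      using tanh_real_lt_1[of "exp b / 2"] by (auto simp: punct_def hyp_space_def)
    fix x :: "real ^ 'n" assume x: "x \<in> punct" "x \<notin> ?K"
    have "tau x \<notin> {a..b}"
    proof
      assume "tau x \<in> {a..b}"
      then have "exp a \<le> rr x" "rr x \<le> exp b" unfolding exp_tau[OF x(1), symmetric] by auto
      then show False using x by (simp add: norm_eq_tanh)
    qed
    then show "h (tau x) = 0" by (rule ab(2))
  qed
qed

lemma rad_tau_comp:
  assumes "sm1 h" "x \<in> punct" shows "rad (\<lambda>x. h (tau x)) x = deriv h (tau x) / rr x"
proof -
  have "rad tau x = 1 / rr x"
    using rad_comp[OF sm_rr assms(2) DERIV_ln[OF rr_pos[OF assms(2)]]]
    by (simp add: tau_def[abs_def] rad_rr[OF assms(2)] inverse_eq_divide)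
  then show ?thesis
    using rad_comp[OF sm_tau assms(2) sm1_deriv(1)[OF assms(1)]] by simp
qed

lemma ang_tau_comp:
  assumes "sm1 h" "x \<in> punct" shows "ang i (\<lambda>x. h (tau x)) x = 0"
proof -
  have "ang i tau x = 0"
    using ang_comp[OF sm_rr assms(2) DERIV_ln[OF rr_pos[OF assms(2)]], of i]
    by (simp add: tau_def[abs_def] ang_rr[OF assms(2)])
  then show ?thesis using ang_comp[OF sm_tau assms(2) sm1_deriv(1)[OF assms(1)], of i] by simp
qed

text \<open>The phantom argument keeps track of the dimension. The functional is positive and kills
  derivatives, hence is a multiple of the Lebesgue integral: polar coordinates for radial
  functions.\<close>

definition gam :: "'n::finite itself \<Rightarrow> (real \<Rightarrow> real) \<Rightarrow> real"
  where "gam _ h = mint (\<lambda>x :: real ^ 'n. sh x * (h (tau x) / rr x))"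

lemma csm_gam: "cs1 h \<Longrightarrow> csm (\<lambda>x. sh x * (h (tau x) / rr x))"
  using csm_sh_power[OF csm_div_rr[OF csm_tau], of h 1 1] by simp

lemma gam_eq:
  assumes "\<And>x :: real ^ 'n. x \<in> punct \<Longrightarrow> f x = sh x * (h (tau x) / rr x)"
  shows "mint f = gam TYPE('n) h"
  unfolding gam_def by (rule mint_cong[OF assms])

lemma gam_diff: "cs1 f \<Longrightarrow> cs1 g \<Longrightarrow> gam TYPE('n::finite) (\<lambda>t. f t - g t) = gam TYPE('n) f - gam TYPE('n) g"
  unfolding gam_def diff_divide_distrib right_diff_distrib by (rule mint_diff[OF csm_gam csm_gam])

lemma gam_cmult: "gam TYPE('n::finite) (\<lambda>t. c * f t) = c * gam TYPE('n) f"
  unfolding gam_def mint_cmult[symmetric] by (simp add: algebra_simps)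

lemma gam_deriv:
  assumes "cs1 H" "\<And>t. (H has_real_derivative h t) (at t)" shows "gam TYPE('n::finite) h = 0"
proof -
  have "deriv H = h" using DERIV_imp_deriv[OF assms(2)] by blast
  then have "gam TYPE('n) h = mint (\<lambda>x :: real ^ 'n. sh x * rad (\<lambda>x. H (tau x)) x)"
    unfolding gam_def by (intro mint_cong) (simp add: rad_tau_comp[OF cs1_sm1[OF assms(1)]])
  then show ?thesis using mint_rad[OF csm_tau[OF assms(1)]] by simp
qed

text \<open>The integrand is nonnegative and positive on an open set, which is nonempty since
  \<open>tau\<close> takes every real value. If the integral were zero, that set would be
  negligible.\<close>

lemma gam_pos:
  assumes h: "cs1 h" and nn: "\<And>t. h t \<ge> 0" and t0: "h t0 > 0"
  shows "gam TYPE('n::finite) h > 0"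
proof -
  let ?f = "\<lambda>x :: real ^ 'n. sh x * (h (tau x) / rr x) / norm x ^ CARD('n)"
  have ge: "indicator punct x *\<^sub>R ?f x \<ge> 0" for x
    using sh_pos[of x] rr_pos[of x] nn[of "tau x"] by (cases "x \<in> punct") (auto simp: indicator_def)
  have int: "integrable lborel (\<lambda>x. indicator punct x *\<^sub>R ?f x)"
    using mint_integrable[OF csm_gam[OF h]] by (simp add: set_integrable_def)
  define U where "U = {x \<in> punct. h (tau (x :: real ^ 'n)) > 0}"
  have "open U"
    unfolding U_def
    using continuous_open_preimage[OF smooth_on_continuous[OF sm_tau_comp[OF cs1_sm1[OF h]]] open_punct, of "{0<..}"]
    by (simp add: vimage_def Int_def conj_commute)
  moreover obtain x0 :: "real ^ 'n" where "x0 \<in> punct" "tau x0 = t0" using tau_surj by blast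
  then have "U \<noteq> {}" using t0 by (auto simp: U_def)
  ultimately have nU: "\<not> negligible U" by (rule open_not_negligible)
  have "gam TYPE('n) h \<noteq> 0"
  proof
    assume "gam TYPE('n) h = 0"
    then have "(\<integral>x. indicator punct x *\<^sub>R ?f x \<partial>lborel) = 0"
      by (simp add: gam_def mint_def set_lebesgue_integral_def)
    then have "AE x in lborel. indicator punct x *\<^sub>R ?f x = 0"
      using integral_nonneg_eq_0_iff_AE[OF int] ge by simp
    then obtain Z where Z: "Z \<in> null_sets lborel" "{x \<in> space lborel. \<not> indicator punct x *\<^sub>R ?f x = 0} \<subseteq> Z"
      by (auto simp: eventually_ae_filter)
    have "indicator punct x *\<^sub>R ?f x \<noteq> 0" if "x \<in> U" for x
      using that sh_pos[of x] rr_pos[of x] punct_D[of x] by (auto simp: U_def)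
    then have "U \<subseteq> Z" using Z(2) by auto
    moreover have "negligible Z" using Z(1) by (simp add: negligible_iff_null_sets null_sets_completionI)
    ultimately show False using nU negligible_subset by blast
  qed
  moreover have "gam TYPE('n) h \<ge> 0"
    unfolding gam_def
    by (intro mint_nonneg mult_nonneg_nonneg divide_nonneg_nonneg nn less_imp_le[OF sh_pos] less_imp_le[OF rr_pos])
  ultimately show ?thesis by simp
qed

text \<open>For a fixed bump \<eta>, the function \<open>h\<close> minus the multiple of \<eta> with
  the same integral has a compactly supported primitive, so \<open>gam\<close> vanishes on it. The
  constant is the area of the unit sphere, of which only positivity is used.\<close>

lemma gam_multiple_of_integral:
  "\<exists>c > 0. \<forall>h. cs1 h \<longrightarrow> gam TYPE('n::finite) h = c * J h"
proof -
  obtain \<eta> where \<eta>: "cs1 \<eta>" "\<And>t. \<eta> t \<ge> 0" "\<eta> 0 > 0" using bump_exists by metis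
  have J: "J \<eta> > 0" by (rule J_pos[OF \<eta>])
  have "gam TYPE('n) h = gam TYPE('n) \<eta> / J \<eta> * J h" if h: "cs1 h" for h
  proof -
    have c: "cs1 (\<lambda>t. J h / J \<eta> * \<eta> t)" by (rule cs1_cmult[OF \<eta>(1)])
    have "J (\<lambda>t. h t - J h / J \<eta> * \<eta> t) = 0"
      using J unfolding J_diff[OF h c] J_cmult by simp
    then obtain H where "cs1 H" "\<And>t. (H has_real_derivative h t - J h / J \<eta> * \<eta> t) (at t)"
      using cs1_primitive[OF cs1_diff[OF h c]] by blast
    from gam_deriv[OF this, where 'n='n] show ?thesis
      unfolding gam_diff[OF h c] gam_cmult by simp
  qed
  then show ?thesis using J gam_pos[OF \<eta>, where 'n='n] by (intro exI[of _ "gam TYPE('n) \<eta> / J \<eta>"]) auto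
qed

text \<open>Stretching a bump by L divides the quotient of the integrals of g'^2 and g^2 by L^2, and
  \<open>R\<close> contains arbitrarily long intervals. Since \<open>w\<close> is recovered from g
  by integration, its compact support requires one weighted moment of g to vanish.\<close>

lemma almost_extremal:
  fixes R :: "real set"
  assumes k: "k > 0" and R: "\<And>L. \<exists>T. {T - L..T + L} \<subseteq> R"
  obtains w :: "real ^ 'n \<Rightarrow> real" and g where "csm w" "cs1 g" "\<And>s. g s \<noteq> 0 \<Longrightarrow> s \<in> R"
    "\<And>i x. x \<in> punct \<Longrightarrow> ang i w x = 0" "\<And>x. x \<in> punct \<Longrightarrow> wgt x * rad w x = g (tau x)"
    "gam TYPE('n) (\<lambda>s. (deriv g s)\<^sup>2) < k * gam TYPE('n) (\<lambda>s. (g s)\<^sup>2)"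
proof -
  obtain \<eta> where \<eta>: "cs1 \<eta>" "\<And>t. \<eta> t \<ge> 0" "\<eta> 0 > 0" "\<And>t. t \<notin> {-1..1} \<Longrightarrow> \<eta> t = 0"
    by (rule bump_exists) blast
  obtain c where c: "c > 0" "\<And>h. cs1 h \<Longrightarrow> gam TYPE('n) h = c * J h"
    using gam_multiple_of_integral[where 'n='n] by blast
  define A where "A = J (\<lambda>t. (deriv \<eta> t)\<^sup>2)"
  define B where "B = J (\<lambda>t. (\<eta> t)\<^sup>2)"
  have cA: "cs1 (\<lambda>t. (deriv \<eta> t)\<^sup>2)" and cB: "cs1 (\<lambda>t. (\<eta> t)\<^sup>2)"
    by (rule cs1_sq[OF cs1_deriv[OF \<eta>(1)]], rule cs1_sq[OF \<eta>(1)])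
  have A: "A \<ge> 0" unfolding A_def by (rule J_nonneg[OF cA]) simp
  have B: "B > 0" unfolding B_def by (rule J_pos[OF cB, of 0]) (use \<eta>(3) in simp_all)
  \<comment> \<open>Stretching turns A and B into A / L and L B; the choice L > A / (k B) together
    with L >= 1 brings the quotient below k.\<close>
  define L where "L = max 1 (A / (k * B) + 1)"
  have L: "L \<ge> 1" "L > 0" by (auto simp: L_def)
  have "A < k * B * L"
  proof -
    have "A / (k * B) < L" by (simp add: L_def)
    then show ?thesis using k B by (simp add: pos_divide_less_eq mult.commute)
  qed
  also have "\<dots> \<le> k * B * (L * L)"
    using mult_left_mono[OF L(1), of "k * B * L"] k B L(2) by simp
  finally have AB: "A / L < k * (L * B)"
    using L(2) by (simp add: pos_divide_less_eq algebra_simps)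
  \<comment> \<open>Room for two bumps of half-width L centred at T - 2 L and T + 2 L, with a gap of
    2 L between them.\<close>
  obtain T where T: "{T - 3 * L..T + 3 * L} \<subseteq> R" using R by blast
  define g1 where "g1 s = \<eta> ((s - (T - 2 * L)) / L)" for s
  define g2 where "g2 s = \<eta> ((s - (T + 2 * L)) / L)" for s
  have cg: "cs1 g1" "cs1 g2"
    unfolding g1_def[abs_def] g2_def[abs_def] by (rule J_affine(1)[OF \<eta>(1) L(2)])+
  have s1: "g1 s = 0" if "s \<notin> {T - 3 * L..T - L}" for s
    unfolding g1_def by (rule \<eta>(4)) (use that L in \<open>auto simp: field_simps\<close>)
  have s2: "g2 s = 0" if "s \<notin> {T + L..T + 3 * L}" for s
    unfolding g2_def by (rule \<eta>(4)) (use that L in \<open>auto simp: field_simps\<close>)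
  \<comment> \<open>The density that recovers u from g: in the variable s = ln r, du/ds = r u_r = r
    g / \<open>wgt\<close>, which is r^(3/2) (sinh r)^(-(N-1)/2) g.\<close>
  define m where "m s = exp (3 / 2 * s - (real CARD('n) - 1) / 2 * ln (sinh (exp s)))" for s
  have sm_sinh: "sm1 (\<lambda>s. sinh (exp s))"
  proof -
    have "sm1 (\<lambda>s. (1 / 2) * (exp (exp s) - exp ((-1) * exp s)))"
      by (intro sm1_mult sm1_diff sm1_exp sm1_id sm1_const)
    then show ?thesis by (simp add: sinh_def)
  qed
  have sm: "sm1 m"
    unfolding m_def[abs_def] by (intro sm1_exp sm1_diff sm1_mult sm1_const sm1_id sm1_ln[OF sm_sinh]) simp
  have m: "m s > 0" for s by (simp add: m_def)
  have cm: "cs1 (\<lambda>s. m s * g1 s)" "cs1 (\<lambda>s. m s * g2 s)" by (rule cs1_mult[OF sm cg(1)], rule cs1_mult[OF sm cg(2)])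
  have J2: "J (\<lambda>s. m s * g2 s) > 0"
    by (rule J_pos[OF cm(2), of "T + 2 * L"]) (use m \<eta>(2,3) in \<open>simp_all add: g2_def less_imp_le\<close>)
  \<comment> \<open>The coefficient that makes the integral of m g vanish.\<close>
  define l where "l = J (\<lambda>s. m s * g1 s) / J (\<lambda>s. m s * g2 s)"
  define g where "g s = g1 s - l * g2 s" for s
  have cgg: "cs1 g" unfolding g_def[abs_def] by (rule cs1_diff[OF cg(1) cs1_cmult[OF cg(2)]])
  have "J (\<lambda>s. m s * g s) = J (\<lambda>s. m s * g1 s - l * (m s * g2 s))"
    by (simp add: g_def algebra_simps)
  also have "\<dots> = 0"
    unfolding J_diff[OF cm(1) cs1_cmult[OF cm(2)]] J_cmult l_def using J2 by simp
  finally obtain F where F: "cs1 F" "\<And>s. (F has_real_derivative m s * g s) (at s)"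
    using cs1_primitive[OF cs1_mult[OF sm cgg]] by blast
  note sF = cs1_sm1[OF F(1)]
  have w: "wgt x * rad (\<lambda>x. F (tau x)) x = g (tau x)" if x: "x \<in> punct" for x :: "real ^ 'n"
  proof -
    have 1: "rad (\<lambda>x. F (tau x)) x = m (tau x) * g (tau x) / rr x"
      using rad_tau_comp[OF sF x] DERIV_imp_deriv[OF F(2)] by simp
    have "m (tau x) = exp (3 / 2 * tau x - (real CARD('n) - 1) / 2 * ln (sh x))"
      by (simp add: m_def exp_tau[OF x] sinh_rr[OF x])
    moreover have "wgt x = exp ((real CARD('n) - 1) / 2 * ln (sh x) + (- 1 / 2) * tau x)"
      using wgt_eq[OF x] by (simp add: tau_def)
    ultimately have "wgt x * m (tau x) = exp (tau x)"
      by (simp add: exp_add[symmetric])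
    then have "wgt x * m (tau x) = rr x" by (simp add: exp_tau[OF x])
    then show ?thesis unfolding 1 using rr_pos[OF x] by (simp add: mult.assoc[symmetric])
  qed
  have dg: "deriv g s = deriv g1 s - l * deriv g2 s" for s
    unfolding g_def[abs_def]
    by (rule DERIV_imp_deriv[OF DERIV_diff[OF sm1_deriv(1)[OF cs1_sm1[OF cg(1)]] DERIV_cmult[OF sm1_deriv(1)[OF cs1_sm1[OF cg(2)]]]]])
  have disj: "s \<notin> {T - 3 * L..T - L} \<or> s \<notin> {T + L..T + 3 * L}" for s using L by auto
  \<comment> \<open>The supports are disjoint, so there is no cross term, here or for the
    derivatives; \<open>l\<close> enters both integrals through the common factor 1 + l^2.\<close>
  have gsq1: "(g s)\<^sup>2 = (g1 s)\<^sup>2 + l\<^sup>2 * (g2 s)\<^sup>2" for s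
    using disj[of s] s1[of s] s2[of s] by (auto simp: g_def power_mult_distrib)
  have d1: "deriv g1 s = 0" if "s \<notin> {T - 3 * L..T - L}" for s
    by (rule deriv_zero_outside[OF s1 that])
  have d2: "deriv g2 s = 0" if "s \<notin> {T + L..T + 3 * L}" for s
    by (rule deriv_zero_outside[OF s2 that])
  have dsq: "(deriv g s)\<^sup>2 = (deriv g1 s)\<^sup>2 + l\<^sup>2 * (deriv g2 s)\<^sup>2" for s
    using disj[of s] d1[of s] d2[of s] by (auto simp: dg power_mult_distrib)
  have Jg: "J (\<lambda>s. (g1 s)\<^sup>2) = L * B" "J (\<lambda>s. (g2 s)\<^sup>2) = L * B"
    unfolding g1_def g2_def B_def by (rule J_affine(2)[OF cB L(2)])+
  have Jd: "J (\<lambda>s. (deriv g1 s)\<^sup>2) = A / L" "J (\<lambda>s. (deriv g2 s)\<^sup>2) = A / L"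
  proof -
    have "J (\<lambda>s. (deriv (\<lambda>s. \<eta> ((s - T') / L)) s)\<^sup>2) = A / L" for T'
    proof -
      have "J (\<lambda>s. (deriv (\<lambda>s. \<eta> ((s - T') / L)) s)\<^sup>2) = J (\<lambda>s. (1 / L\<^sup>2) * (deriv \<eta> ((s - T') / L))\<^sup>2)"
        by (simp add: deriv_affine[OF cs1_sm1[OF \<eta>(1)] L(2)] power_divide)
      also have "\<dots> = (1 / L\<^sup>2) * (L * A)"
        unfolding J_cmult A_def J_affine(2)[OF cA L(2)] ..
      finally show ?thesis using L by (simp add: power2_eq_square)
    qed
    then show "J (\<lambda>s. (deriv g1 s)\<^sup>2) = A / L" "J (\<lambda>s. (deriv g2 s)\<^sup>2) = A / L"
      unfolding g1_def[abs_def] g2_def[abs_def] by blast+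
  qed
  have "gam TYPE('n) (\<lambda>s. (deriv g s)\<^sup>2) = c * ((1 + l\<^sup>2) * (A / L))"
    unfolding c(2)[OF cs1_sq[OF cs1_deriv[OF cgg]]] unfolding dsq
      J_add[OF cs1_sq[OF cs1_deriv[OF cg(1)]] cs1_cmult[OF cs1_sq[OF cs1_deriv[OF cg(2)]]]] J_cmult Jd
    by (simp add: distrib_right add_divide_distrib)
  also have "\<dots> < c * ((1 + l\<^sup>2) * (k * (L * B)))"
    using c(1) AB by (intro mult_strict_left_mono) (auto intro: add_pos_nonneg)
  also have "\<dots> = k * gam TYPE('n) (\<lambda>s. (g s)\<^sup>2)"
    unfolding c(2)[OF cs1_sq[OF cgg]] unfolding gsq1 J_add[OF cs1_sq[OF cg(1)] cs1_cmult[OF cs1_sq[OF cg(2)]]] J_cmult Jg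
    by (simp add: algebra_simps)
  finally have "gam TYPE('n) (\<lambda>s. (deriv g s)\<^sup>2) < k * gam TYPE('n) (\<lambda>s. (g s)\<^sup>2)" .
  moreover have "s \<in> R" if "g s \<noteq> 0" for s
  proof -
    have "s \<in> {T - 3 * L..T - L} \<or> s \<in> {T + L..T + 3 * L}"
    proof (rule ccontr)
      assume "\<not> ?thesis"
      then have "g1 s = 0" "g2 s = 0" using s1 s2 by blast+
      then show False using that by (simp add: g_def)
    qed
    then have "s \<in> {T - 3 * L..T + 3 * L}" using L by auto
    then show ?thesis using T by blast
  qed
  ultimately show ?thesis
    by (intro that[OF csm_tau[OF F(1)] cgg _ ang_tau_comp[OF sF] w])
qed

lemma hint_mono:
  "csm f \<Longrightarrow> csm g \<Longrightarrow> (\<And>x. x \<in> punct \<Longrightarrow> f x \<le> g x) \<Longrightarrow> hint f \<le> hint g"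
  unfolding hint_def by (intro mint_mono csm_sh_power mult_left_mono) (simp_all add: less_imp_le[OF sh_pos])

text \<open>In the variable s the remainder becomes the integral of g'^2, and u_r^2 times the volume
  becomes r^2 g^2 ds dTheta. The terms of the inequality can thus be compared with the integral of
  g^2 according to the size of r.\<close>

lemma rem_tau_eq:
  fixes w :: "real ^ 'n \<Rightarrow> real"
  assumes g: "cs1 g" and w: "\<And>x. x \<in> punct \<Longrightarrow> wgt x * rad w x = g (tau x)"
  shows "hint (\<lambda>x. rr x / sh x ^ (CARD('n) - 1) * (rad (\<lambda>y. wgt y * rad w y) x)\<^sup>2) = gam TYPE('n) (\<lambda>s. (deriv g s)\<^sup>2)"
    and "x \<in> punct \<Longrightarrow> sh x ^ CARD('n) * (rad w x)\<^sup>2 = sh x * rr x * (g (tau x))\<^sup>2"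
proof -
  have n: "sh x ^ CARD('n) = sh x * sh x ^ (CARD('n) - 1)" for x :: "real ^ 'n" by (simp add: power_eq_if)
  show "hint (\<lambda>x. rr x / sh x ^ (CARD('n) - 1) * (rad (\<lambda>y. wgt y * rad w y) x)\<^sup>2) = gam TYPE('n) (\<lambda>s. (deriv g s)\<^sup>2)"
    unfolding hint_def
  proof (rule gam_eq)
    fix x :: "real ^ 'n" assume x: "x \<in> punct"
    have "rad (\<lambda>y. wgt y * rad w y) x = deriv g (tau x) / rr x"
      using rad_cong[OF x w] rad_tau_comp[OF cs1_sm1[OF g] x] by simp
    then show "sh x ^ CARD('n) * (rr x / sh x ^ (CARD('n) - 1) * (rad (\<lambda>y. wgt y * rad w y) x)\<^sup>2) =
        sh x * ((deriv g (tau x))\<^sup>2 / rr x)"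
      using sh_pos[OF x] rr_pos[OF x] by (simp add: n power2_eq_square)
  qed
  assume x: "x \<in> punct"
  have "rr x * (wgt x)\<^sup>2 = sh x ^ (CARD('n) - 1)"
    using wgt_sq[OF x] sh_pos[OF x] by (simp add: field_simps)
  then show "sh x ^ CARD('n) * (rad w x)\<^sup>2 = sh x * rr x * (g (tau x))\<^sup>2"
    unfolding n w[OF x, symmetric] power_mult_distrib by (simp only: mult.assoc[symmetric]) (simp add: mult.assoc)
qed

lemma sinh_bounds:
  fixes r :: real assumes r: "r > 0"
  shows "r \<le> sinh r" "r \<le> 1 \<Longrightarrow> sinh r \<le> 2 * r"
proof -
  have d: "(sinh has_real_derivative cosh x) (at x)" for x :: real
    by (auto intro!: derivative_eq_intros)
  obtain z where z: "0 < z" "z < r" "sinh r - sinh 0 = (r - 0) * cosh z"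
    using MVT2[OF r d] by blast
  show "r \<le> sinh r"
    using z(3) cosh_real_ge_1[of z] mult_left_mono[of 1 "cosh z" r] r by simp
  assume "r \<le> 1"
  then have "exp z \<le> 3" using exp_le exp_le_cancel_iff[of z 1] z by linarith
  moreover have "exp (- z) \<le> 1" using z by simp
  ultimately have "exp z + exp (- z) \<le> 4" by linarith
  then have "cosh z \<le> 2" by (simp add: cosh_def)
  then show "sinh r \<le> 2 * r" using z(3) mult_left_mono[of "cosh z" 2 r] r by simp
qed

text \<open>The bumps are placed far from the pole. Half of \<open>e\<close> absorbs the terms with
  1/r^2 and 1/sinh^2 r, the other half the remainder.\<close>

lemma gradient_constant_sharp:
  assumes e: "e > 0"
  obtains w :: "real ^ 'n \<Rightarrow> real" where "csm w" "\<And>i x. x \<in> punct \<Longrightarrow> ang i w x = 0"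
    "hint (\<lambda>x. (rlap w x)\<^sup>2) < (((real CARD('n) - 1) / 2)\<^sup>2 + e) * hint (\<lambda>x. (rad w x)\<^sup>2)"
proof -
  define N where "N = real CARD('n)"
  have N: "N \<ge> 1" using zero_less_card_finite[where 'a='n] unfolding N_def by linarith
  \<comment> \<open>For r >= r0, since r <= sinh r, the second and third weights add up to at most
    N^2 / (4 r^2) <= e/2. The bound r0 >= 1 makes the integral of g^2 at most that of r^2 g^2, which
    is the integral of u_r^2.\<close>
  define r0 where "r0 = max 1 (N / sqrt e)"
  have r0: "r0 \<ge> 1" by (simp add: r0_def)
  have r0': "N\<^sup>2 / 4 \<le> e / 2 * r0\<^sup>2"
  proof -
    have "N / sqrt e \<le> r0" by (simp add: r0_def)
    then have "(N / sqrt e)\<^sup>2 \<le> r0\<^sup>2" using N e by (intro power_mono) auto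
    then have "N\<^sup>2 \<le> e * r0\<^sup>2" using e by (simp add: power_divide pos_divide_le_eq mult.commute)
    then show ?thesis using zero_le_power2[of N] by linarith
  qed
  have reg: "\<exists>T. {T - L..T + L} \<subseteq> {ln r0..}" for L :: real
    by (rule exI[of _ "ln r0 + L"]) auto
  obtain w :: "real ^ 'n \<Rightarrow> real" and g where w: "csm w" "cs1 g" "\<And>s. g s \<noteq> 0 \<Longrightarrow> s \<in> {ln r0..}"
    "\<And>i x. x \<in> punct \<Longrightarrow> ang i w x = 0" "\<And>x. x \<in> punct \<Longrightarrow> wgt x * rad w x = g (tau x)"
    "gam TYPE('n) (\<lambda>s. (deriv g s)\<^sup>2) < e / 2 * gam TYPE('n) (\<lambda>s. (g s)\<^sup>2)"
    by (rule almost_extremal[OF half_gt_zero[OF e] reg, where 'n='n]) blast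
  have big: "r0 \<le> rr x" if x: "x \<in> punct" and g: "g (tau x) \<noteq> 0" for x :: "real ^ 'n"
    using w(3)[OF g] ln_le_cancel_iff[of r0 "rr x"] rr_pos[OF x] r0 by (simp add: tau_def)
  have cr: "csm (\<lambda>x. (rad w x)\<^sup>2)" by (intro csm_intros w(1))
  have i1: "hint (\<lambda>x. rr x / sh x ^ (CARD('n) - 1) * (rad (\<lambda>y. wgt y * rad w y) x)\<^sup>2) = gam TYPE('n) (\<lambda>s. (deriv g s)\<^sup>2)"
    by (rule rem_tau_eq(1)[OF w(2)]) (rule w(5))
  have i2: "sh x ^ CARD('n) * (rad w x)\<^sup>2 = sh x * rr x * (g (tau x))\<^sup>2" if "x \<in> punct" for x
    by (rule rem_tau_eq(2)[OF w(2) _ that]) (rule w(5))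
  have "1 / 4 * hint (\<lambda>x. (rad w x)\<^sup>2 / (rr x)\<^sup>2) + (N\<^sup>2 - 1) / 4 * hint (\<lambda>x. (rad w x)\<^sup>2 / (sh x)\<^sup>2) =
      hint (\<lambda>x. 1 / 4 * ((rad w x)\<^sup>2 / (rr x)\<^sup>2) + (N\<^sup>2 - 1) / 4 * ((rad w x)\<^sup>2 / (sh x)\<^sup>2))"
    using hint_add[OF csm_cmult[OF csm_div_rr[OF cr]] csm_cmult[OF csm_div_sh[OF cr]], of "1/4" 2 "(N\<^sup>2 - 1) / 4" 2]
    by (simp only: hint_cmult)
  also have "\<dots> \<le> hint (\<lambda>x. e / 2 * (rad w x)\<^sup>2)"
  proof (rule hint_mono)
    show "csm (\<lambda>x. 1 / 4 * ((rad w x)\<^sup>2 / (rr x)\<^sup>2) + (N\<^sup>2 - 1) / 4 * ((rad w x)\<^sup>2 / (sh x)\<^sup>2))"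
      "csm (\<lambda>x. e / 2 * (rad w x)\<^sup>2)" by (intro csm_intros w(1))+
    fix x :: "real ^ 'n" assume x: "x \<in> punct"
    show "1 / 4 * ((rad w x)\<^sup>2 / (rr x)\<^sup>2) + (N\<^sup>2 - 1) / 4 * ((rad w x)\<^sup>2 / (sh x)\<^sup>2) \<le> e / 2 * (rad w x)\<^sup>2"
    proof (cases "g (tau x) = 0")
      case True
      have "wgt x \<noteq> 0" using wgt_eq[OF x] by simp
      then have "rad w x = 0" using w(5)[OF x] True by simp
      then show ?thesis by simp
    next
      case False
      note b = big[OF x False]
      have p: "rr x > 0" "sh x > 0" using rr_pos[OF x] sh_pos[OF x] .
      have rs: "rr x \<le> sh x" using sinh_bounds(1)[OF p(1)] by (simp add: sinh_rr[OF x])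
      have N1: "(N\<^sup>2 - 1) / 4 \<ge> 0" using N by simp
      have "(rad w x)\<^sup>2 / (sh x)\<^sup>2 \<le> (rad w x)\<^sup>2 / (rr x)\<^sup>2"
        using p rs by (intro divide_left_mono power_mono) auto
      then have "(N\<^sup>2 - 1) / 4 * ((rad w x)\<^sup>2 / (sh x)\<^sup>2) \<le> (N\<^sup>2 - 1) / 4 * ((rad w x)\<^sup>2 / (rr x)\<^sup>2)"
        using N1 by (rule mult_left_mono)
      note * = this
      have "1 / 4 * ((rad w x)\<^sup>2 / (rr x)\<^sup>2) + (N\<^sup>2 - 1) / 4 * ((rad w x)\<^sup>2 / (sh x)\<^sup>2) \<le> N\<^sup>2 / 4 * ((rad w x)\<^sup>2 / (rr x)\<^sup>2)"
      proof -
        have "(N\<^sup>2 - 1) / 4 * q = N\<^sup>2 / 4 * q - 1 / 4 * q" for q by (simp add: field_simps)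
        from * this[of "(rad w x)\<^sup>2 / (rr x)\<^sup>2"] show ?thesis by linarith
      qed
      also have "\<dots> = (N\<^sup>2 / 4) / (rr x)\<^sup>2 * (rad w x)\<^sup>2" by simp
      also have "\<dots> \<le> e / 2 * (rad w x)\<^sup>2"
      proof (rule mult_right_mono)
        have "r0\<^sup>2 \<le> (rr x)\<^sup>2" using b r0 by (intro power_mono) auto
        then have "e / 2 * r0\<^sup>2 \<le> e / 2 * (rr x)\<^sup>2" using e by (intro mult_left_mono) auto
        then show "(N\<^sup>2 / 4) / (rr x)\<^sup>2 \<le> e / 2" using r0' p by (simp add: pos_divide_le_eq)
      qed simp
      finally show ?thesis .
    qed
  qed
  also have "\<dots> = e / 2 * hint (\<lambda>x. (rad w x)\<^sup>2)" by (rule hint_cmult)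
  finally have 1: "1 / 4 * hint (\<lambda>x. (rad w x)\<^sup>2 / (rr x)\<^sup>2) + (N\<^sup>2 - 1) / 4 * hint (\<lambda>x. (rad w x)\<^sup>2 / (sh x)\<^sup>2)
      \<le> e / 2 * hint (\<lambda>x. (rad w x)\<^sup>2)" .
  have "gam TYPE('n) (\<lambda>s. (g s)\<^sup>2) \<le> hint (\<lambda>x. (rad w x)\<^sup>2)"
    unfolding gam_def hint_def
  proof (rule mint_mono[OF csm_gam[OF cs1_sq[OF w(2)]] csm_sh_power[OF cr]])
    fix x :: "real ^ 'n" assume x: "x \<in> punct"
    have p: "rr x > 0" "sh x > 0" using rr_pos[OF x] sh_pos[OF x] .
    have "(g (tau x))\<^sup>2 / rr x \<le> rr x * (g (tau x))\<^sup>2"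
    proof (cases "g (tau x) = 0")
      case False
      have "1 \<le> rr x" using big[OF x False] r0 by simp
      then have "1 \<le> rr x * rr x" using mult_mono[of 1 "rr x" 1 "rr x"] by simp
      then have "(g (tau x))\<^sup>2 * 1 \<le> (g (tau x))\<^sup>2 * (rr x * rr x)" by (intro mult_left_mono) auto
      then show ?thesis using p by (simp add: pos_divide_le_eq algebra_simps)
    qed simp
    then have "sh x * ((g (tau x))\<^sup>2 / rr x) \<le> sh x * (rr x * (g (tau x))\<^sup>2)" using p by (intro mult_left_mono) auto
    then show "sh x * ((g (tau x))\<^sup>2 / rr x) \<le> sh x ^ CARD('n) * (rad w x)\<^sup>2"
      unfolding i2[OF x] by (simp only: mult.assoc)
  qed
  then have "e / 2 * gam TYPE('n) (\<lambda>s. (g s)\<^sup>2) \<le> e / 2 * hint (\<lambda>x. (rad w x)\<^sup>2)"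
    using e by (intro mult_left_mono) auto
  then have "hint (\<lambda>x. (rlap w x)\<^sup>2) < (((real CARD('n) - 1) / 2)\<^sup>2 + e) * hint (\<lambda>x. (rad w x)\<^sup>2)"
    using radial_identity[OF w(1)] i1 w(6) 1 unfolding N_def by (simp add: distrib_right)
  note lt = this
  show ?thesis by (rule that[OF w(1) _ lt]) (rule w(4))
qed

text \<open>The bumps are placed at r <= 1, where sinh r <= 2 r. There the integral of u_r^2 /
  sinh^2 r is at least a quarter of that of g^2, which is why the remainder is kept below
  \<open>e / 4\<close> times the latter.\<close>

lemma sinh_constant_sharp:
  assumes e: "e > 0"
  obtains w :: "real ^ 'n \<Rightarrow> real" where "csm w" "\<And>i x. x \<in> punct \<Longrightarrow> ang i w x = 0"
    "hint (\<lambda>x. (rlap w x)\<^sup>2) < ((real CARD('n) - 1) / 2)\<^sup>2 * hint (\<lambda>x. (rad w x)\<^sup>2)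
      + 1 / 4 * hint (\<lambda>x. (rad w x)\<^sup>2 / (rr x)\<^sup>2)
      + (((real CARD('n))\<^sup>2 - 1) / 4 + e) * hint (\<lambda>x. (rad w x)\<^sup>2 / (sh x)\<^sup>2)"
proof -
  have reg: "\<exists>T. {T - L..T + L} \<subseteq> {..0}" for L :: real
    by (rule exI[of _ "- L"]) auto
  have e4: "e / 4 > 0" using e by simp
  obtain w :: "real ^ 'n \<Rightarrow> real" and g where w: "csm w" "cs1 g" "\<And>s. g s \<noteq> 0 \<Longrightarrow> s \<in> {..0}"
    "\<And>i x. x \<in> punct \<Longrightarrow> ang i w x = 0" "\<And>x. x \<in> punct \<Longrightarrow> wgt x * rad w x = g (tau x)"
    "gam TYPE('n) (\<lambda>s. (deriv g s)\<^sup>2) < e / 4 * gam TYPE('n) (\<lambda>s. (g s)\<^sup>2)"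
    by (rule almost_extremal[OF e4 reg, where 'n='n]) blast
  have i1: "hint (\<lambda>x. rr x / sh x ^ (CARD('n) - 1) * (rad (\<lambda>y. wgt y * rad w y) x)\<^sup>2) = gam TYPE('n) (\<lambda>s. (deriv g s)\<^sup>2)"
    by (rule rem_tau_eq(1)[OF w(2)]) (rule w(5))
  have i2: "sh x ^ CARD('n) * (rad w x)\<^sup>2 = sh x * rr x * (g (tau x))\<^sup>2" if "x \<in> punct" for x
    by (rule rem_tau_eq(2)[OF w(2) _ that]) (rule w(5))
  have cr: "csm (\<lambda>x. (rad w x)\<^sup>2 / (sh x)\<^sup>2)" by (intro csm_intros w(1))
  have "1 / 4 * gam TYPE('n) (\<lambda>s. (g s)\<^sup>2) = mint (\<lambda>x :: real ^ 'n. 1 / 4 * (sh x * ((g (tau x))\<^sup>2 / rr x)))"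
    unfolding gam_def by (rule mint_cmult[symmetric])
  also have "\<dots> \<le> hint (\<lambda>x. (rad w x)\<^sup>2 / (sh x)\<^sup>2)"
    unfolding hint_def
  proof (rule mint_mono[OF csm_cmult[OF csm_gam[OF cs1_sq[OF w(2)]]] csm_sh_power[OF cr]])
    fix x :: "real ^ 'n" assume x: "x \<in> punct"
    have p: "rr x > 0" "sh x > 0" using rr_pos[OF x] sh_pos[OF x] .
    have "1 / 4 * ((g (tau x))\<^sup>2 / rr x) \<le> rr x * (g (tau x))\<^sup>2 / (sh x)\<^sup>2"
    proof (cases "g (tau x) = 0")
      case False
      then have "rr x \<le> 1" using w(3)[OF False] p by (simp add: tau_def)
      then have "sh x \<le> 2 * rr x" using sinh_bounds(2)[OF p(1)] by (simp add: sinh_rr[OF x])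
      then have "(sh x)\<^sup>2 \<le> (2 * rr x)\<^sup>2" using p by (intro power_mono) auto
      then have "(g (tau x))\<^sup>2 * (sh x)\<^sup>2 \<le> (g (tau x))\<^sup>2 * (4 * (rr x)\<^sup>2)"
        by (intro mult_left_mono) (auto simp: power_mult_distrib)
      then show ?thesis using p by (simp add: divide_simps) (simp add: power2_eq_square algebra_simps)
    qed simp
    then have "sh x * (1 / 4 * ((g (tau x))\<^sup>2 / rr x)) \<le> sh x * (rr x * (g (tau x))\<^sup>2 / (sh x)\<^sup>2)"
      using p by (intro mult_left_mono) auto
    also have "\<dots> = sh x ^ CARD('n) * (rad w x)\<^sup>2 / (sh x)\<^sup>2"
      unfolding i2[OF x] by simp
    finally show "1 / 4 * (sh x * ((g (tau x))\<^sup>2 / rr x)) \<le> sh x ^ CARD('n) * ((rad w x)\<^sup>2 / (sh x)\<^sup>2)"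
      by simp
  qed
  finally have "e * (1 / 4 * gam TYPE('n) (\<lambda>s. (g s)\<^sup>2)) \<le> e * hint (\<lambda>x. (rad w x)\<^sup>2 / (sh x)\<^sup>2)"
    using e by (intro mult_left_mono) auto
  then have "hint (\<lambda>x. (rlap w x)\<^sup>2) < ((real CARD('n) - 1) / 2)\<^sup>2 * hint (\<lambda>x. (rad w x)\<^sup>2)
      + 1 / 4 * hint (\<lambda>x. (rad w x)\<^sup>2 / (rr x)\<^sup>2)
      + (((real CARD('n))\<^sup>2 - 1) / 4 + e) * hint (\<lambda>x. (rad w x)\<^sup>2 / (sh x)\<^sup>2)"
    using radial_identity[OF w(1)] i1 w(6) by (simp add: distrib_right)
  note lt = this
  show ?thesis by (rule that[OF w(1) _ lt]) (rule w(4))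
qed

section \<open>Translation of all integrals, and assembly\<close>

lemma integrals_pullback:
  fixes p :: "real ^ 'n"
  assumes p: "p \<in> hyp_space" and w: "csm w" and u: "pullback p u w"
  shows "(\<integral>x. (hrlap p u x)\<^sup>2 \<partial>hvol) = hint (\<lambda>x. (rlap w x)\<^sup>2)"
    and "(\<integral>x. hrgrad_sq p u x \<partial>hvol) = hint (\<lambda>x. (rad w x)\<^sup>2)"
    and "(\<integral>x. hrgrad_sq p u x / (hdist p x)\<^sup>2 \<partial>hvol) = hint (\<lambda>x. (rad w x)\<^sup>2 / (rr x)\<^sup>2)"
    and "(\<integral>x. hrgrad_sq p u x / (sinh (hdist p x))\<^sup>2 \<partial>hvol) = hint (\<lambda>x. (rad w x)\<^sup>2 / (sh x)\<^sup>2)"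
    and "(\<integral>x. hdist p x / sinh (hdist p x) ^ (CARD('n) - 1) * hrgrad_sq p (\<lambda>y. sinh (hdist p y) powr ((real CARD('n) - 1) / 2)
        * hrad p u y / sqrt (hdist p y)) x \<partial>hvol) = hint (\<lambda>x. rr x / sh x ^ (CARD('n) - 1) * (rad (\<lambda>y. wgt y * rad w y) x)\<^sup>2)"
    and "(\<integral>x. hgrad_sq u x \<partial>hvol) = hint (gsq w)"
    and "(\<integral>x. hgrad_sq u x / (hdist p x)\<^sup>2 \<partial>hvol) = hint (\<lambda>x. gsq w x / (rr x)\<^sup>2)"
    and "(\<integral>x. hgrad_sq u x / (sinh (hdist p x))\<^sup>2 \<partial>hvol) = hint (\<lambda>x. gsq w x / (sh x)\<^sup>2)"
    and "(\<integral>x. hdist p x / sinh (hdist p x) ^ (CARD('n) - 1) * hgrad_sq (\<lambda>y. sinh (hdist p y) powr ((real CARD('n) - 1) / 2)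
        * hrad p u y / sqrt (hdist p y)) x \<partial>hvol) = hint (\<lambda>x. rr x / sh x ^ (CARD('n) - 1) * gsq (\<lambda>y. wgt y * rad w y) x)"
proof -
  note sw = csmooth_on_smooth[OF w]
  note hr = pullback_hrad[OF p u sw]
  have cv: "csm (\<lambda>y. wgt y * rad w y)" by (intro csm_intros w)
  note sv = csmooth_on_smooth[OF cv]
  have v: "pullback p (\<lambda>y. sinh (hdist p y) powr ((real CARD('n) - 1) / 2) * hrad p u y / sqrt (hdist p y)) (\<lambda>y. wgt y * rad w y)"
    using hr by (simp add: pullback_def hdist_mobius[OF p] sinh_rr wgt_def)
  note pb = pullback_hrlap[OF p u sw] pullback_hrad[OF p u sw] pullback_hrad[OF p v sv]
    pullback_hgrad_sq[OF p u sw] pullback_hgrad_sq[OF p v sv]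
  show "(\<integral>x. (hrlap p u x)\<^sup>2 \<partial>hvol) = hint (\<lambda>x. (rlap w x)\<^sup>2)"
    by (rule hvol_integral[OF p]) (use pb(1) in \<open>simp_all add: pullback_def csm_sq csm_rlap w\<close>)
  show "(\<integral>x. hrgrad_sq p u x \<partial>hvol) = hint (\<lambda>x. (rad w x)\<^sup>2)"
    by (rule hvol_integral[OF p csm_sq[OF csm_rad[OF w]]]) (use pb(2) in \<open>simp add: pullback_def hrgrad_sq_def\<close>)
  show "(\<integral>x. hrgrad_sq p u x / (hdist p x)\<^sup>2 \<partial>hvol) = hint (\<lambda>x. (rad w x)\<^sup>2 / (rr x)\<^sup>2)"
    by (rule hvol_integral[OF p csm_div_rr[OF csm_sq[OF csm_rad[OF w]]]])
      (use pb(2) in \<open>simp add: pullback_def hrgrad_sq_def hdist_mobius[OF p]\<close>)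
  show "(\<integral>x. hrgrad_sq p u x / (sinh (hdist p x))\<^sup>2 \<partial>hvol) = hint (\<lambda>x. (rad w x)\<^sup>2 / (sh x)\<^sup>2)"
    by (rule hvol_integral[OF p csm_div_sh[OF csm_sq[OF csm_rad[OF w]]]])
      (use pb(2) in \<open>simp add: pullback_def hrgrad_sq_def hdist_mobius[OF p] sinh_rr\<close>)
  show "(\<integral>x. hdist p x / sinh (hdist p x) ^ (CARD('n) - 1) * hrgrad_sq p (\<lambda>y. sinh (hdist p y) powr ((real CARD('n) - 1) / 2)
        * hrad p u y / sqrt (hdist p y)) x \<partial>hvol) = hint (\<lambda>x. rr x / sh x ^ (CARD('n) - 1) * (rad (\<lambda>y. wgt y * rad w y) x)\<^sup>2)"
    by (rule hvol_integral[OF p csm_rem[OF csm_sq[OF csm_rad[OF cv]]]])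
      (use pb(3) in \<open>simp add: pullback_def hrgrad_sq_def hdist_mobius[OF p] sinh_rr\<close>)
  show "(\<integral>x. hgrad_sq u x \<partial>hvol) = hint (gsq w)"
    by (rule hvol_integral[OF p csm_gsq[OF w] pb(4)])
  show "(\<integral>x. hgrad_sq u x / (hdist p x)\<^sup>2 \<partial>hvol) = hint (\<lambda>x. gsq w x / (rr x)\<^sup>2)"
    by (rule hvol_integral[OF p csm_div_rr[OF csm_gsq[OF w]]])
      (use pb(4) in \<open>simp add: pullback_def hdist_mobius[OF p]\<close>)
  show "(\<integral>x. hgrad_sq u x / (sinh (hdist p x))\<^sup>2 \<partial>hvol) = hint (\<lambda>x. gsq w x / (sh x)\<^sup>2)"
    by (rule hvol_integral[OF p csm_div_sh[OF csm_gsq[OF w]]])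
      (use pb(4) in \<open>simp add: pullback_def hdist_mobius[OF p] sinh_rr\<close>)
  show "(\<integral>x. hdist p x / sinh (hdist p x) ^ (CARD('n) - 1) * hgrad_sq (\<lambda>y. sinh (hdist p y) powr ((real CARD('n) - 1) / 2)
        * hrad p u y / sqrt (hdist p y)) x \<partial>hvol) = hint (\<lambda>x. rr x / sh x ^ (CARD('n) - 1) * gsq (\<lambda>y. wgt y * rad w y) x)"
    by (rule hvol_integral[OF p csm_rem[OF csm_gsq[OF cv]]])
      (use pb(5) in \<open>simp add: pullback_def hdist_mobius[OF p] sinh_rr\<close>)
qed

text \<open>On radial functions the full operators reduce to the radial ones, so the functions that
  witness sharpness of the radial relation serve for the full one as well.\<close>

lemma radial_laplacian_eq:
  fixes w :: "real ^ 'n \<Rightarrow> real"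
  assumes w: "\<And>i x. x \<in> punct \<Longrightarrow> ang i w x = 0" and x: "x \<in> punct"
  shows "slap w x = 0" "gsq w x = (rad w x)\<^sup>2"
proof -
  have "ang i (ang i w) x = 0" for i
    using ang_cong[OF x, of "ang i w" "\<lambda>x. 0" i] w by (simp add: ang_const)
  then show "slap w x = 0" by (simp add: slap_def)
  show "gsq w x = (rad w x)\<^sup>2" using w[OF x] by (simp add: gsq_def)
qed

theorem corollary2p2:
  fixes p :: "real ^ 'n" and N :: nat
  assumes N_eq: "N = CARD('n)" and N_ge: "N \<ge> 2" and p: "p \<in> hyp_space"
  shows
    "(\<forall>u \<in> test_fun p.
      (\<integral>x. (hrlap p u x)\<^sup>2 \<partial>hvol) =
        ((real N - 1) / 2)\<^sup>2 * (\<integral>x. hrgrad_sq p u x \<partial>hvol)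
        + 1 / 4 * (\<integral>x. hrgrad_sq p u x / (hdist p x)\<^sup>2 \<partial>hvol)
        + ((real N)\<^sup>2 - 1) / 4 * (\<integral>x. hrgrad_sq p u x / (sinh (hdist p x))\<^sup>2 \<partial>hvol)
        + (\<integral>x. hdist p x / sinh (hdist p x) ^ (N - 1) *
              hrgrad_sq p (\<lambda>y. sinh (hdist p y) powr ((real N - 1) / 2) * hrad p u y
                / sqrt (hdist p y)) x \<partial>hvol))
    \<and>
    (N \<ge> 5 \<longrightarrow> (\<forall>u \<in> test_fun p.
      (\<integral>x. (hlap u x)\<^sup>2 \<partial>hvol) \<ge>
        ((real N - 1) / 2)\<^sup>2 * (\<integral>x. hgrad_sq u x \<partial>hvol)
        + 1 / 4 * (\<integral>x. hgrad_sq u x / (hdist p x)\<^sup>2 \<partial>hvol)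
        + ((real N)\<^sup>2 - 1) / 4 * (\<integral>x. hgrad_sq u x / (sinh (hdist p x))\<^sup>2 \<partial>hvol)
        + (\<integral>x. hdist p x / sinh (hdist p x) ^ (N - 1) *
              hgrad_sq (\<lambda>y. sinh (hdist p y) powr ((real N - 1) / 2) * hrad p u y
                / sqrt (hdist p y)) x \<partial>hvol)))
    \<and>
    ((\<forall>u \<in> test_fun p. (\<integral>x. (hrlap p u x)\<^sup>2 \<partial>hvol) \<ge>
        ((real N - 1) / 2)\<^sup>2 * (\<integral>x. hrgrad_sq p u x \<partial>hvol)) \<and>
     (\<forall>C. (\<forall>u \<in> test_fun p. (\<integral>x. (hrlap p u x)\<^sup>2 \<partial>hvol) \<ge>
        C * (\<integral>x. hrgrad_sq p u x \<partial>hvol)) \<longrightarrow> C \<le> ((real N - 1) / 2)\<^sup>2))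
    \<and>
    (N \<ge> 5 \<longrightarrow>
     (\<forall>u \<in> test_fun p. (\<integral>x. (hlap u x)\<^sup>2 \<partial>hvol) \<ge>
        ((real N - 1) / 2)\<^sup>2 * (\<integral>x. hgrad_sq u x \<partial>hvol)) \<and>
     (\<forall>C. (\<forall>u \<in> test_fun p. (\<integral>x. (hlap u x)\<^sup>2 \<partial>hvol) \<ge>
        C * (\<integral>x. hgrad_sq u x \<partial>hvol)) \<longrightarrow> C \<le> ((real N - 1) / 2)\<^sup>2))
    \<and>
    (N \<ge> 5 \<longrightarrow> (\<forall>K > ((real N)\<^sup>2 - 1) / 4.
     (\<exists>u \<in> test_fun p.
      \<not> (\<integral>x. (hrlap p u x)\<^sup>2 \<partial>hvol) \<ge>
        ((real N - 1) / 2)\<^sup>2 * (\<integral>x. hrgrad_sq p u x \<partial>hvol)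
        + 1 / 4 * (\<integral>x. hrgrad_sq p u x / (hdist p x)\<^sup>2 \<partial>hvol)
        + K * (\<integral>x. hrgrad_sq p u x / (sinh (hdist p x))\<^sup>2 \<partial>hvol)) \<and>
     (\<exists>u \<in> test_fun p.
      \<not> (\<integral>x. (hlap u x)\<^sup>2 \<partial>hvol) \<ge>
        ((real N - 1) / 2)\<^sup>2 * (\<integral>x. hgrad_sq u x \<partial>hvol)
        + 1 / 4 * (\<integral>x. hgrad_sq u x / (hdist p x)\<^sup>2 \<partial>hvol)
        + K * (\<integral>x. hgrad_sq u x / (sinh (hdist p x))\<^sup>2 \<partial>hvol))))"
proof (intro conjI impI allI ballI)
  let ?a = "((real N - 1) / 2)\<^sup>2" and ?b = "((real N)\<^sup>2 - 1) / 4"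
  have b0: "?b \<ge> 0"
  proof -
    have "(real N)\<^sup>2 \<ge> 1" using N_ge by simp
    then show ?thesis by simp
  qed
  \<comment> \<open>A radial function about 0, transported to the pole \<open>p\<close>, is a test
    function on which both relations have the same left- and right-hand integrals.\<close>
  have radial_test: "\<exists>u\<in>test_fun p. (\<integral>x. (hrlap p u x)\<^sup>2 \<partial>hvol) = hint (\<lambda>x. (rlap w x)\<^sup>2)
      \<and> (\<integral>x. hrgrad_sq p u x \<partial>hvol) = hint (\<lambda>x. (rad w x)\<^sup>2)
      \<and> (\<integral>x. hrgrad_sq p u x / (hdist p x)\<^sup>2 \<partial>hvol) = hint (\<lambda>x. (rad w x)\<^sup>2 / (rr x)\<^sup>2)
      \<and> (\<integral>x. hrgrad_sq p u x / (sinh (hdist p x))\<^sup>2 \<partial>hvol) = hint (\<lambda>x. (rad w x)\<^sup>2 / (sh x)\<^sup>2)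
      \<and> (\<integral>x. (hlap u x)\<^sup>2 \<partial>hvol) = hint (\<lambda>x. (rlap w x)\<^sup>2)
      \<and> (\<integral>x. hgrad_sq u x \<partial>hvol) = hint (\<lambda>x. (rad w x)\<^sup>2)
      \<and> (\<integral>x. hgrad_sq u x / (hdist p x)\<^sup>2 \<partial>hvol) = hint (\<lambda>x. (rad w x)\<^sup>2 / (rr x)\<^sup>2)
      \<and> (\<integral>x. hgrad_sq u x / (sinh (hdist p x))\<^sup>2 \<partial>hvol) = hint (\<lambda>x. (rad w x)\<^sup>2 / (sh x)\<^sup>2)"
    if w: "csm w" and r: "\<And>i x. x \<in> punct \<Longrightarrow> ang i w x = 0" for w :: "real ^ 'n \<Rightarrow> real"
  proof -
    obtain u where u: "u \<in> test_fun p" "pullback p u w" using pullback_test_fun[OF p w] by blast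
    note i = integrals_pullback[OF p w u(2)]
    have "(\<integral>x. (hlap u x)\<^sup>2 \<partial>hvol) = hint (\<lambda>x. (rlap w x)\<^sup>2)"
      unfolding hlap_integral[OF p u(2) w] by (rule hint_cong) (simp add: radial_laplacian_eq(1)[OF r])
    moreover have "hint (gsq w) = hint (\<lambda>x. (rad w x)\<^sup>2)"
      "hint (\<lambda>x. gsq w x / (rr x)\<^sup>2) = hint (\<lambda>x. (rad w x)\<^sup>2 / (rr x)\<^sup>2)"
      "hint (\<lambda>x. gsq w x / (sh x)\<^sup>2) = hint (\<lambda>x. (rad w x)\<^sup>2 / (sh x)\<^sup>2)"
      by (rule hint_cong, simp add: radial_laplacian_eq(2)[OF r])+
    ultimately show ?thesis using u(1) i by (intro bexI[of _ u]) simp_all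
  qed
  {
    fix u assume "u \<in> test_fun p"
    then obtain w where w: "csm w" and u: "pullback p u w" using test_fun_pullback[OF p] by blast
    note i = integrals_pullback[OF p w u]
    note id = radial_identity[OF w]
    show "(\<integral>x. (hrlap p u x)\<^sup>2 \<partial>hvol) = ?a * (\<integral>x. hrgrad_sq p u x \<partial>hvol)
        + 1 / 4 * (\<integral>x. hrgrad_sq p u x / (hdist p x)\<^sup>2 \<partial>hvol)
        + ?b * (\<integral>x. hrgrad_sq p u x / (sinh (hdist p x))\<^sup>2 \<partial>hvol)
        + (\<integral>x. hdist p x / sinh (hdist p x) ^ (N - 1) *
              hrgrad_sq p (\<lambda>y. sinh (hdist p y) powr ((real N - 1) / 2) * hrad p u y
                / sqrt (hdist p y)) x \<partial>hvol)"
      unfolding N_eq i by (rule id)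
    have "hint (\<lambda>x. (rad w x)\<^sup>2 / (rr x)\<^sup>2) \<ge> 0" "hint (\<lambda>x. (rad w x)\<^sup>2 / (sh x)\<^sup>2) \<ge> 0"
      "hint (\<lambda>x. rr x / sh x ^ (CARD('n) - 1) * (rad (\<lambda>y. wgt y * rad w y) x)\<^sup>2) \<ge> 0"
      by (auto intro!: hint_nonneg mult_nonneg_nonneg divide_nonneg_nonneg zero_le_power[OF less_imp_le[OF sh_pos]]
          less_imp_le[OF sh_pos] less_imp_le[OF rr_pos] simp del: times_divide_eq_left)
    note nn = this this(2)[THEN mult_nonneg_nonneg[OF b0]]
    show "(\<integral>x. (hrlap p u x)\<^sup>2 \<partial>hvol) \<ge> ?a * (\<integral>x. hrgrad_sq p u x \<partial>hvol)"
      unfolding i id using nn unfolding N_eq by linarith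
    assume N5: "N \<ge> 5"
    have full: "hint (\<lambda>x. (rlap w x + slap w x / (sh x)\<^sup>2)\<^sup>2) \<ge> ?a * hint (gsq w)
      + 1 / 4 * hint (\<lambda>x. gsq w x / (rr x)\<^sup>2) + ?b * hint (\<lambda>x. gsq w x / (sh x)\<^sup>2)
      + hint (\<lambda>x. rr x / sh x ^ (CARD('n) - 1) * gsq (\<lambda>y. wgt y * rad w y) x)"
      using full_inequality[OF _ w] N5 unfolding N_eq by blast
    then show "(\<integral>x. (hlap u x)\<^sup>2 \<partial>hvol) \<ge> ?a * (\<integral>x. hgrad_sq u x \<partial>hvol)
        + 1 / 4 * (\<integral>x. hgrad_sq u x / (hdist p x)\<^sup>2 \<partial>hvol)
        + ?b * (\<integral>x. hgrad_sq u x / (sinh (hdist p x))\<^sup>2 \<partial>hvol)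
        + (\<integral>x. hdist p x / sinh (hdist p x) ^ (N - 1) *
              hgrad_sq (\<lambda>y. sinh (hdist p y) powr ((real N - 1) / 2) * hrad p u y
                / sqrt (hdist p y)) x \<partial>hvol)"
      unfolding N_eq i hlap_integral[OF p u w] .
    have gp: "gsq v x \<ge> 0" for v and x :: "real ^ 'n" by (simp add: gsq_def sum_nonneg)
    have "hint (\<lambda>x. gsq w x / (rr x)\<^sup>2) \<ge> 0" "hint (\<lambda>x. gsq w x / (sh x)\<^sup>2) \<ge> 0"
      "hint (\<lambda>x. rr x / sh x ^ (CARD('n) - 1) * gsq (\<lambda>y. wgt y * rad w y) x) \<ge> 0"
      by (auto intro!: hint_nonneg mult_nonneg_nonneg divide_nonneg_nonneg zero_le_power[OF less_imp_le[OF sh_pos]] gp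
          less_imp_le[OF sh_pos] less_imp_le[OF rr_pos] simp del: times_divide_eq_left)
    note nn = this this(2)[THEN mult_nonneg_nonneg[OF b0]]
    show "(\<integral>x. (hlap u x)\<^sup>2 \<partial>hvol) \<ge> ?a * (\<integral>x. hgrad_sq u x \<partial>hvol)"
      unfolding i hlap_integral[OF p u w] using full nn by linarith
  }
  {
    fix C assume *: "\<forall>u\<in>test_fun p. (\<integral>x. (hrlap p u x)\<^sup>2 \<partial>hvol) \<ge> C * (\<integral>x. hrgrad_sq p u x \<partial>hvol)"
    show "C \<le> ?a"
    proof (rule ccontr)
      assume "\<not> C \<le> ?a"
      \<comment> \<open>The excess of the assumed constant over the claimed one serves as the
        \<open>e\<close> of the sharpness lemma; the two further contradictions below follow the
        same pattern.\<close>
      then have "C - ?a > 0" by simp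
      then obtain w :: "real ^ 'n \<Rightarrow> real" where w: "csm w" "\<And>i x. x \<in> punct \<Longrightarrow> ang i w x = 0"
        "hint (\<lambda>x. (rlap w x)\<^sup>2) < (((real CARD('n) - 1) / 2)\<^sup>2 + (C - ?a)) * hint (\<lambda>x. (rad w x)\<^sup>2)"
        by (rule gradient_constant_sharp[where 'n='n]) blast
      obtain u where u: "u \<in> test_fun p" "(\<integral>x. (hrlap p u x)\<^sup>2 \<partial>hvol) = hint (\<lambda>x. (rlap w x)\<^sup>2)"
        "(\<integral>x. hrgrad_sq p u x \<partial>hvol) = hint (\<lambda>x. (rad w x)\<^sup>2)"
        using radial_test[OF w(1,2)] by blast
      from *[rule_format, OF u(1)] have "C * hint (\<lambda>x. (rad w x)\<^sup>2) \<le> hint (\<lambda>x. (rlap w x)\<^sup>2)"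
        unfolding u(2,3) .
      then show False using w(3) by (simp add: N_eq)
    qed
  }
  {
    fix C assume *: "\<forall>u\<in>test_fun p. (\<integral>x. (hlap u x)\<^sup>2 \<partial>hvol) \<ge> C * (\<integral>x. hgrad_sq u x \<partial>hvol)"
    show "C \<le> ?a"
    proof (rule ccontr)
      assume "\<not> C \<le> ?a"
      then have "C - ?a > 0" by simp
      then obtain w :: "real ^ 'n \<Rightarrow> real" where w: "csm w" "\<And>i x. x \<in> punct \<Longrightarrow> ang i w x = 0"
        "hint (\<lambda>x. (rlap w x)\<^sup>2) < (((real CARD('n) - 1) / 2)\<^sup>2 + (C - ?a)) * hint (\<lambda>x. (rad w x)\<^sup>2)"
        by (rule gradient_constant_sharp[where 'n='n]) blast
      obtain u where u: "u \<in> test_fun p" "(\<integral>x. (hlap u x)\<^sup>2 \<partial>hvol) = hint (\<lambda>x. (rlap w x)\<^sup>2)"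
        "(\<integral>x. hgrad_sq u x \<partial>hvol) = hint (\<lambda>x. (rad w x)\<^sup>2)"
        using radial_test[OF w(1,2)] by blast
      from *[rule_format, OF u(1)] have "C * hint (\<lambda>x. (rad w x)\<^sup>2) \<le> hint (\<lambda>x. (rlap w x)\<^sup>2)"
        unfolding u(2,3) .
      then show False using w(3) by (simp add: N_eq)
    qed
  }
  {
    fix K assume "K > ?b"
    then have "K - ?b > 0" by simp
    then obtain w :: "real ^ 'n \<Rightarrow> real" where w: "csm w" "\<And>i x. x \<in> punct \<Longrightarrow> ang i w x = 0"
      "hint (\<lambda>x. (rlap w x)\<^sup>2) < ((real CARD('n) - 1) / 2)\<^sup>2 * hint (\<lambda>x. (rad w x)\<^sup>2)
      + 1 / 4 * hint (\<lambda>x. (rad w x)\<^sup>2 / (rr x)\<^sup>2)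
      + (((real CARD('n))\<^sup>2 - 1) / 4 + (K - ?b)) * hint (\<lambda>x. (rad w x)\<^sup>2 / (sh x)\<^sup>2)"
      by (rule sinh_constant_sharp[where 'n='n]) blast
    then have lt: "hint (\<lambda>x. (rlap w x)\<^sup>2) < ?a * hint (\<lambda>x. (rad w x)\<^sup>2)
      + 1 / 4 * hint (\<lambda>x. (rad w x)\<^sup>2 / (rr x)\<^sup>2) + K * hint (\<lambda>x. (rad w x)\<^sup>2 / (sh x)\<^sup>2)"
      by (simp add: N_eq)
    obtain u where u: "u \<in> test_fun p" and i: "(\<integral>x. (hrlap p u x)\<^sup>2 \<partial>hvol) = hint (\<lambda>x. (rlap w x)\<^sup>2)"
      "(\<integral>x. hrgrad_sq p u x \<partial>hvol) = hint (\<lambda>x. (rad w x)\<^sup>2)"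
      "(\<integral>x. hrgrad_sq p u x / (hdist p x)\<^sup>2 \<partial>hvol) = hint (\<lambda>x. (rad w x)\<^sup>2 / (rr x)\<^sup>2)"
      "(\<integral>x. hrgrad_sq p u x / (sinh (hdist p x))\<^sup>2 \<partial>hvol) = hint (\<lambda>x. (rad w x)\<^sup>2 / (sh x)\<^sup>2)"
      "(\<integral>x. (hlap u x)\<^sup>2 \<partial>hvol) = hint (\<lambda>x. (rlap w x)\<^sup>2)"
      "(\<integral>x. hgrad_sq u x \<partial>hvol) = hint (\<lambda>x. (rad w x)\<^sup>2)"
      "(\<integral>x. hgrad_sq u x / (hdist p x)\<^sup>2 \<partial>hvol) = hint (\<lambda>x. (rad w x)\<^sup>2 / (rr x)\<^sup>2)"
      "(\<integral>x. hgrad_sq u x / (sinh (hdist p x))\<^sup>2 \<partial>hvol) = hint (\<lambda>x. (rad w x)\<^sup>2 / (sh x)\<^sup>2)"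
      using radial_test[OF w(1,2)] by blast
    show "\<exists>u\<in>test_fun p. \<not> (\<integral>x. (hrlap p u x)\<^sup>2 \<partial>hvol) \<ge> ?a * (\<integral>x. hrgrad_sq p u x \<partial>hvol)
        + 1 / 4 * (\<integral>x. hrgrad_sq p u x / (hdist p x)\<^sup>2 \<partial>hvol)
        + K * (\<integral>x. hrgrad_sq p u x / (sinh (hdist p x))\<^sup>2 \<partial>hvol)"
      by (rule bexI[OF _ u]) (use lt in \<open>simp only: i not_le\<close>)
    show "\<exists>u\<in>test_fun p. \<not> (\<integral>x. (hlap u x)\<^sup>2 \<partial>hvol) \<ge> ?a * (\<integral>x. hgrad_sq u x \<partial>hvol)
        + 1 / 4 * (\<integral>x. hgrad_sq u x / (hdist p x)\<^sup>2 \<partial>hvol)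
        + K * (\<integral>x. hgrad_sq u x / (sinh (hdist p x))\<^sup>2 \<partial>hvol)"
      by (rule bexI[OF _ u]) (use lt in \<open>simp only: i not_le\<close>)
  }
qed

end
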